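(* There is an algorithm that solves the \textsc{multiterminal cut} problem in time $1.84^k \cdot n^{O(1)}$, where $n$ is the number of vertices of the input graph and $k$ is the input size bound.
   Context: \textsc{Multiterminal cut}: the input is a simple undirected graph $G=(V,E)$ with $n=|V|$, a weight function $w:E\to\mathbb{N}$ assigning each edge a positive integer weight, a set $T=\{t_1,\dots,t_p\}$ of $p$ distinct vertices called terminals, and a nonnegative integer $k$. A multiterminal cut for $T$ is a partition $\{V_1,\dots,V_p\}$ of $V$ with $t_i\in V_i$ for each $1\le i\le p$; its size is the total weight of the edges whose two ends lie in different parts. The task is to either output a multiterminal cut for $T$ of size at most $k$, or correctly report that none exists. *)

theory Defs
  imports Complex_Main "HOL-Library.Disjoint_Sets"
begin

section \<open>Multiterminal cuts\<close>

text \<open>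
  Graphs are on the vertex set \<open>{..<n}\<close>, an edge is the two-element set of its ends. The
  terminals \<open>t\<^sub>1, \<dots>, t\<^sub>p\<close> form a distinct list \<open>ts\<close>, and a partition
  \<open>V\<^sub>1, \<dots>, V\<^sub>p\<close> is a list \<open>Ps\<close> of vertex sets in the corresponding order.
\<close>

definition mtc_instance :: "nat \<Rightarrow> nat set set \<Rightarrow> (nat set \<Rightarrow> nat) \<Rightarrow> nat list \<Rightarrow> bool" where
  "mtc_instance n E w ts \<longleftrightarrow>
     (\<forall>e\<in>E. e \<subseteq> {..<n} \<and> card e = 2) \<and> (\<forall>e\<in>E. 0 < w e) \<and>
     distinct ts \<and> set ts \<subseteq> {..<n}"

definition multiterminal_cut :: "nat \<Rightarrow> nat list \<Rightarrow> nat set list \<Rightarrow> bool" where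
  "multiterminal_cut n ts Ps \<longleftrightarrow>
     length Ps = length ts \<and> distinct Ps \<and> partition_on {..<n} (set Ps) \<and>
     (\<forall>i<length ts. ts ! i \<in> Ps ! i)"

definition cut_size :: "nat set set \<Rightarrow> (nat set \<Rightarrow> nat) \<Rightarrow> nat set list \<Rightarrow> nat" where
  "cut_size E w Ps =
     (\<Sum>e | e \<in> E \<and> (\<exists>A\<in>set Ps. \<exists>B\<in>set Ps. A \<noteq> B \<and> e \<inter> A \<noteq> {} \<and> e \<inter> B \<noteq> {}). w e)"


section \<open>Random access machine programs\<close>

text \<open>
  Algorithms are programs for a unit-cost random access machine over the natural numbers,
  written with structured control flow. The store consists of scalar variables (registers) and
  of unbounded arrays with indirect addressing; a program mentions only finitely many of each.
  The only arithmetic operations are addition and truncated subtraction: with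
  multiplication, unit cost would not be a realistic measure of time.
  Every operator, memory access, assignment and test costs one unit.
\<close>

type_synonym vname = string

datatype aexp =
    Const nat
  | Var vname
  | Get vname aexp
  | Plus aexp aexp
  | Minus aexp aexp

datatype bexp =
    Less aexp aexp
  | Neg bexp
  | Conj bexp bexp

datatype com =
    Skip
  | Assign vname aexp
  | Store vname aexp aexp
  | Seq com com
  | Cond bexp com com
  | While bexp com

record state =
  var :: "vname \<Rightarrow> nat"
  arr :: "vname \<Rightarrow> nat \<Rightarrow> nat"

fun aval :: "aexp \<Rightarrow> state \<Rightarrow> nat" where
  "aval (Const c) s = c"
| "aval (Var x) s = var s x"
| "aval (Get a i) s = arr s a (aval i s)"
| "aval (Plus e f) s = aval e s + aval f s"
| "aval (Minus e f) s = aval e s - aval f s"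

fun bval :: "bexp \<Rightarrow> state \<Rightarrow> bool" where
  "bval (Less e f) s = (aval e s < aval f s)"
| "bval (Neg b) s = (\<not> bval b s)"
| "bval (Conj b c) s = (bval b s \<and> bval c s)"

fun acost :: "aexp \<Rightarrow> nat" where
  "acost (Const c) = 1"
| "acost (Var x) = 1"
| "acost (Get a i) = 1 + acost i"
| "acost (Plus e f) = 1 + acost e + acost f"
| "acost (Minus e f) = 1 + acost e + acost f"

fun bcost :: "bexp \<Rightarrow> nat" where
  "bcost (Less e f) = 1 + acost e + acost f"
| "bcost (Neg b) = 1 + bcost b"
| "bcost (Conj b c) = 1 + bcost b + bcost c"

text \<open>\<open>exec c s t s'\<close>: started in \<open>s\<close>, program \<open>c\<close> halts after \<open>t\<close> time units in \<open>s'\<close>.\<close>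

inductive exec :: "com \<Rightarrow> state \<Rightarrow> nat \<Rightarrow> state \<Rightarrow> bool" where
  Skip: "exec Skip s 1 s"
| Assign: "exec (Assign x e) s (1 + acost e) (s\<lparr>var := (var s)(x := aval e s)\<rparr>)"
| Store: "exec (Store a i e) s (1 + acost i + acost e)
    (s\<lparr>arr := (arr s)(a := (arr s a)(aval i s := aval e s))\<rparr>)"
| Seq: "exec c s t s' \<Longrightarrow> exec d s' t' s'' \<Longrightarrow> exec (Seq c d) s (t + t') s''"
| CondTrue: "bval b s \<Longrightarrow> exec c s t s' \<Longrightarrow> exec (Cond b c d) s (1 + bcost b + t) s'"
| CondFalse: "\<not> bval b s \<Longrightarrow> exec d s t s' \<Longrightarrow> exec (Cond b c d) s (1 + bcost b + t) s'"
| WhileFalse: "\<not> bval b s \<Longrightarrow> exec (While b c) s (1 + bcost b) s"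
| WhileTrue: "bval b s \<Longrightarrow> exec c s t s' \<Longrightarrow> exec (While b c) s' t' s'' \<Longrightarrow>
    exec (While b c) s (1 + bcost b + t + t') s''"

inductive_cases exec_SkipE: "exec Skip s t s'"
inductive_cases exec_AssignE: "exec (Assign x e) s t s'"
inductive_cases exec_StoreE: "exec (Store a i e) s t s'"
inductive_cases exec_SeqE: "exec (Seq c d) s t s'"
inductive_cases exec_CondE: "exec (Cond b c d) s t s'"
inductive_cases exec_WhileE: "exec (While b c) s t s'"

lemma exec_deterministic:
  "exec c s t s' \<Longrightarrow> exec c s u s'' \<Longrightarrow> u = t \<and> s'' = s'"
proof (induction arbitrary: u s'' rule: exec.induct)
  case (Skip s)
  then show ?case by (auto elim: exec_SkipE)
next
  case (Assign x e s)
  then show ?case by (auto elim: exec_AssignE)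
next
  case (Store a i e s)
  then show ?case by (auto elim: exec_StoreE)
next
  case (Seq c s t s' d t' s'')
  from Seq.prems show ?case
    by (rule exec_SeqE) (auto dest!: Seq.IH(1), auto dest!: Seq.IH(2))
next
  case (CondTrue b s c t s' d)
  from CondTrue.prems show ?case
    by (rule exec_CondE) (use CondTrue.hyps in \<open>auto dest!: CondTrue.IH\<close>)
next
  case (CondFalse b s d t s' c)
  from CondFalse.prems show ?case
    by (rule exec_CondE) (use CondFalse.hyps in \<open>auto dest!: CondFalse.IH\<close>)
next
  case (WhileFalse b s c)
  from WhileFalse.prems show ?case
    by (rule exec_WhileE) (use WhileFalse.hyps in auto)
next
  case (WhileTrue b s c t s' t' s'')
  from WhileTrue.prems show ?case
    by (rule exec_WhileE)
       (use WhileTrue.hyps in \<open>auto dest!: WhileTrue.IH(1)\<close>, auto dest!: WhileTrue.IH(2))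
qed


section \<open>Solving the multiterminal cut problem\<close>

text \<open>
  The graph is given by its weight matrix, stored row by row in \<open>''w''\<close>. Since edge weights are
  positive, a zero entry marks a non-edge. All other cells initially hold zero.
\<close>

definition mtc_input :: "nat \<Rightarrow> nat set set \<Rightarrow> (nat set \<Rightarrow> nat) \<Rightarrow> nat list \<Rightarrow> nat \<Rightarrow> state" where
  "mtc_input n E w ts k =
     \<lparr>var = (\<lambda>_. 0)(''n'' := n, ''p'' := length ts, ''k'' := k),
      arr = (\<lambda>_ _. 0)
        (''w'' := \<lambda>x. if x < n * n \<and> {x div n, x mod n} \<in> E then w {x div n, x mod n} else 0,
         ''t'' := \<lambda>i. if i < length ts then ts ! i else 0)\<rparr>"

text \<open>
  A final state reports that no cut of size at most \<open>k\<close> exists by \<open>''found'' = 0\<close>. Otherwise it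
  outputs a cut: \<open>''part''\<close> then maps each vertex to the (zero-based) index of its part.
\<close>

definition mtc_output :: "nat \<Rightarrow> nat list \<Rightarrow> state \<Rightarrow> nat set list option" where
  "mtc_output n ts s =
     (if var s ''found'' = 0 then None
      else Some (map (\<lambda>i. {v. v < n \<and> arr s ''part'' v = i}) [0..<length ts]))"

definition mtc_correct ::
  "nat \<Rightarrow> nat set set \<Rightarrow> (nat set \<Rightarrow> nat) \<Rightarrow> nat list \<Rightarrow> nat \<Rightarrow> nat set list option \<Rightarrow> bool" where
  "mtc_correct n E w ts k out \<longleftrightarrow>
     (case out of
        Some Ps \<Rightarrow> multiterminal_cut n ts Ps \<and> cut_size E w Ps \<le> k
      | None \<Rightarrow> \<not> (\<exists>Ps. multiterminal_cut n ts Ps \<and> cut_size E w Ps \<le> k))"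

definition solves_mtc_in_time :: "com \<Rightarrow> (nat \<Rightarrow> nat \<Rightarrow> real) \<Rightarrow> bool" where
  "solves_mtc_in_time c f \<longleftrightarrow>
     (\<forall>n E w ts k. mtc_instance n E w ts \<longrightarrow>
        (\<exists>t s. exec c (mtc_input n E w ts k) t s \<and>
               mtc_correct n E w ts k (mtc_output n ts s) \<and> real t \<le> f n k))"

end

theory Submission
  imports Defs
begin

text \<open>
  Vertices known to be on the side of terminal \<open>i\<close> are merged into a class \<open>S\<^sub>i\<close>; \<open>\<lambda>\<^sub>i\<close> is the
  minimum weight of a cut separating \<open>S\<^sub>i\<close> from the other classes. Some optimal solution keeps the
  largest such minimum cut on side \<open>i\<close>, so it may be merged too. The branching decreases
  \<open>\<mu> = 2 k - \<Sum>\<^sub>i \<lambda>\<^sub>i\<close>, where \<open>k\<close> is the remaining budget. If giving all unlabelled vertices to the first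
  terminal is too expensive then \<open>\<Sum>\<^sub>i \<lambda>\<^sub>i > k\<close>, hence \<open>\<mu> < k\<close>.

  Deciding that \<open>v\<close> is on side \<open>i\<close> raises \<open>\<lambda>\<^sub>i\<close>; deciding that it is not deletes its edges to \<open>S\<^sub>i\<close>,
  which also lowers \<open>\<mu>\<close>. If no decision raises a \<open>\<lambda>\<^sub>i\<close> by exactly one, the two branches gain 2 and 1.
  Otherwise take the largest set \<open>U\<close> (over all terminals) of unlabelled vertices such that \<open>S\<^sub>i \<union> U\<close> has
  cut weight \<open>\<lambda>\<^sub>i + 1\<close>; it is entirely on side \<open>i\<close> or disjoint from it. Let \<open>a\<close> be the weight between
  \<open>S\<^sub>i\<close> and \<open>U\<close>. Unless \<open>a = 1\<close> or some \<open>S\<^sub>j\<close> also has weight at least \<open>a\<close> to \<open>U\<close>, excluding \<open>U\<close> gains 2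
  and including it gains 1. In the exceptional cases \<open>U\<close> has at most two other unlabelled neighbours
  \<open>x\<close> and \<open>y\<close>, and including \<open>U\<close> is only useful together with \<open>x\<close> (gain 2) or with \<open>y\<close> but not \<open>x\<close>
  (gain 3). The worst recurrence is thus \<open>T(\<mu>) = T(\<mu> - 1) + T(\<mu> - 2) + T(\<mu> - 3)\<close>, whose growth rate
  is below \<open>1.8395\<close>; the gap to \<open>1.84\<close> absorbs the polynomial in \<open>k\<close>.
\<close>

section \<open>Cuts\<close>

text \<open>Every cut edge lies on the boundary of exactly two parts, so the sum of the minimum
  isolating cuts bounds twice the cost; doubled costs keep all measures integral. The obstacle is
  exclusion. Deleting weight \<open>a\<close> between a class and a set adds \<open>2 * a\<close> to
  the lower bound, but the class itself loses up to \<open>a\<close>, and the other terminals may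
  lose the rest since their cuts become cheaper too. Taking the new minimum cuts pairwise disjoint
  makes each deleted edge the loss of at most one other terminal, and a terminal that loses anything
  had to leave its unique old minimum, which costs it at least one. So exclusion always gains one,
  and for \<open>a \<ge> 2\<close> it can stop at one only if a single opponent swallows all
  \<open>a\<close> edges with a cut one above its minimum. The exceptional cases stay small because
  tightness fixes the boundary of \<open>U\<close> at \<open>2 * a + 1\<close>: beside the edges to
  its own class only \<open>a + 1\<close> remain, that is two if \<open>a = 1\<close>, and at most
  one outside if another class takes \<open>a\<close> of them. If no remaining neighbour joins side
  \<open>i\<close>, moving \<open>U\<close> to another part is no worse, so inclusion splits over
  the first neighbour that joins.\<close>

definition wsum :: "nat \<Rightarrow> (nat \<Rightarrow> nat \<Rightarrow> nat) \<Rightarrow> (nat \<Rightarrow> nat \<Rightarrow> nat) \<Rightarrow> nat" where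
  "wsum n W g = (\<Sum>u<n. \<Sum>v<n. g u v * W u v)"

definition between :: "nat \<Rightarrow> (nat \<Rightarrow> nat \<Rightarrow> nat) \<Rightarrow> nat set \<Rightarrow> nat set \<Rightarrow> nat" where
  "between n W A B = wsum n W (\<lambda>u v. of_bool (u \<in> A \<and> v \<in> B))"

definition cut :: "nat \<Rightarrow> (nat \<Rightarrow> nat \<Rightarrow> nat) \<Rightarrow> nat set \<Rightarrow> nat" where
  "cut n W X = wsum n W (\<lambda>u v. of_bool (u \<in> X \<and> v \<notin> X))"

text \<open>A cut edge is counted in both directions, so this is twice the cost of the assignment
  \<open>f\<close>. In contrast \<open>cut\<close> counts only outgoing pairs, hence every boundary
  edge of a symmetric \<open>W\<close> once.\<close>

definition cost2 :: "nat \<Rightarrow> (nat \<Rightarrow> nat \<Rightarrow> nat) \<Rightarrow> (nat \<Rightarrow> nat) \<Rightarrow> nat" where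
  "cost2 n W f = wsum n W (\<lambda>u v. of_bool (f u \<noteq> f v))"

definition symmetric :: "(nat \<Rightarrow> nat \<Rightarrow> nat) \<Rightarrow> bool" where
  "symmetric W \<longleftrightarrow> (\<forall>u v. W u v = W v u)"

lemmas wsum_defs = between_def cut_def cost2_def

lemma wsum_add: "wsum n W g + wsum n W h = wsum n W (\<lambda>u v. g u v + h u v)"
  by (simp add: wsum_def sum.distrib algebra_simps)

lemma wsum_double: "2 * wsum n W g = wsum n W (\<lambda>u v. 2 * g u v)"
  by (simp add: wsum_def sum_distrib_left algebra_simps)

lemma wsum_sum: "(\<Sum>i\<in>I. wsum n W (g i)) = wsum n W (\<lambda>u v. \<Sum>i\<in>I. g i u v)"
proof (cases "finite I")
  case True
  then show ?thesis
    by (induction I) (simp_all add: wsum_def sum.distrib algebra_simps)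
qed (simp add: wsum_def)

lemma wsum_le_pointwise:
  assumes "\<And>u v. \<lbrakk>u < n; v < n; W u v \<noteq> 0\<rbrakk> \<Longrightarrow> g u v \<le> h u v"
  shows "wsum n W g \<le> wsum n W h"
  unfolding wsum_def using assms by (intro sum_mono) (metis le_refl lessThan_iff mult_0_right mult_le_mono1)

lemma wsum_symmetrize:
  assumes "symmetric W"
  shows "2 * wsum n W g = wsum n W (\<lambda>u v. g u v + g v u)"
proof -
  have "wsum n W g = (\<Sum>v<n. \<Sum>u<n. g u v * W u v)"
    unfolding wsum_def by (rule sum.swap)
  also have "\<dots> = wsum n W (\<lambda>u v. g v u)"
    using assms by (simp add: wsum_def symmetric_def)
  finally show ?thesis using wsum_add[of n W g "\<lambda>u v. g v u"] by simp
qed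

text \<open>All the cut inequalities below are checked on a single edge, in both directions at once.\<close>

lemma wsum_le:
  assumes "symmetric W"
    and "\<And>u v. \<lbrakk>u < n; v < n; W u v \<noteq> 0\<rbrakk> \<Longrightarrow> g u v + g v u \<le> h u v + h v u"
  shows "wsum n W g \<le> wsum n W h"
proof -
  have "2 * wsum n W g \<le> 2 * wsum n W h"
    unfolding wsum_symmetrize[OF assms(1)] by (rule wsum_le_pointwise) (rule assms(2))
  then show ?thesis by simp
qed

lemma wsum_eq:
  assumes "symmetric W"
    and "\<And>u v. \<lbrakk>u < n; v < n; W u v \<noteq> 0\<rbrakk> \<Longrightarrow> g u v + g v u = h u v + h v u"
  shows "wsum n W g = wsum n W h"
  by (rule antisym; rule wsum_le[OF assms(1)]) (simp_all add: assms(2))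

lemma cut_submodular:
  assumes "symmetric W"
  shows "cut n W (A \<union> B) + cut n W (A \<inter> B) \<le> cut n W A + cut n W B"
  unfolding wsum_defs wsum_add by (rule wsum_le[OF assms]) (auto simp: of_bool_def)

lemma cut_posimodular:
  assumes "symmetric W"
  shows "cut n W (A - B) + cut n W (B - A) \<le> cut n W A + cut n W B"
  unfolding wsum_defs wsum_add by (rule wsum_le[OF assms]) (auto simp: of_bool_def)

section \<open>Deleting all edges between two vertex sets\<close>

definition delete :: "nat set \<Rightarrow> nat set \<Rightarrow> (nat \<Rightarrow> nat \<Rightarrow> nat) \<Rightarrow> nat \<Rightarrow> nat \<Rightarrow> nat" where
  "delete A B W u v = (if u \<in> A \<and> v \<in> B \<or> u \<in> B \<and> v \<in> A then 0 else W u v)"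

lemma symmetric_delete: "symmetric W \<Longrightarrow> symmetric (delete A B W)"
  by (auto simp: symmetric_def delete_def)

lemma wsum_delete:
  "wsum n (delete A B W) g
   = wsum n W (\<lambda>u v. if u \<in> A \<and> v \<in> B \<or> u \<in> B \<and> v \<in> A then 0 else g u v)"
  unfolding wsum_def by (intro sum.cong refl) (auto simp: delete_def)

text \<open>Each deleted edge is charged in full, whatever \<open>f\<close> does with it. This gives
  soundness: an assignment evaluated in the reduced graph never looks cheaper than it is. Equality
  requires that \<open>f\<close> separates every deleted pair.\<close>

lemma cost2_delete_le:
  assumes "symmetric W"
  shows "cost2 n W f \<le> cost2 n (delete A B W) f + 2 * between n W A B"
  unfolding wsum_defs wsum_delete wsum_double wsum_add
  by (rule wsum_le[OF assms]) (auto simp: of_bool_def)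

lemma cost2_delete_eq:
  assumes "symmetric W" "A \<inter> B = {}" "\<And>u v. u \<in> A \<Longrightarrow> v \<in> B \<Longrightarrow> f u \<noteq> f v"
  shows "cost2 n W f = cost2 n (delete A B W) f + 2 * between n W A B"
  unfolding wsum_defs wsum_delete wsum_double wsum_add
  using assms(2) assms(3) by (intro wsum_eq[OF assms(1)]) (auto simp: of_bool_def, (metis IntI empty_iff)+)

section \<open>Terminal classes and their minimum isolating cuts\<close>

definition cls :: "nat \<Rightarrow> (nat \<Rightarrow> nat) \<Rightarrow> nat \<Rightarrow> nat set" where
  "cls n L i = {v. v < n \<and> L v = Suc i}"

text \<open>The possible sides of a cut isolating class \<open>i\<close> from all other classes.
  Labels are shifted by one, so that \<open>0\<close> marks the unlabelled vertices, on which such a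
  side is free.\<close>

definition feas :: "nat \<Rightarrow> (nat \<Rightarrow> nat) \<Rightarrow> nat \<Rightarrow> nat set set" where
  "feas n L i = {X. X \<subseteq> {..<n} \<and> cls n L i \<subseteq> X \<and> (\<forall>v\<in>X. L v = 0 \<or> L v = Suc i)}"

definition lam :: "nat \<Rightarrow> (nat \<Rightarrow> nat \<Rightarrow> nat) \<Rightarrow> (nat \<Rightarrow> nat) \<Rightarrow> nat \<Rightarrow> nat" where
  "lam n W L i = Inf (cut n W ` feas n L i)"

lemma cls_feas: "cls n L i \<in> feas n L i"
  by (auto simp: cls_def feas_def)

lemma lam_le: "X \<in> feas n L i \<Longrightarrow> lam n W L i \<le> cut n W X"
  unfolding lam_def by (simp add: cInf_lower)

lemma lam_greatest: "(\<And>X. X \<in> feas n L i \<Longrightarrow> m \<le> cut n W X) \<Longrightarrow> m \<le> lam n W L i"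
  unfolding lam_def by (rule cInf_greatest) (use cls_feas[of n L i] in blast, blast)

lemma lam_attained: obtains X where "X \<in> feas n L i" "cut n W X = lam n W L i"
proof -
  have "lam n W L i \<in> cut n W ` feas n L i"
    unfolding lam_def by (rule Inf_nat_def1) (use cls_feas[of n L i] in blast)
  then show ?thesis using that by auto
qed

lemma feas_finite: "X \<in> feas n L i \<Longrightarrow> finite X"
  by (auto simp: feas_def intro: finite_subset)

lemma feas_Int: "X \<in> feas n L i \<Longrightarrow> Y \<in> feas n L i \<Longrightarrow> X \<inter> Y \<in> feas n L i"
  by (auto simp: feas_def)

lemma feas_Diff:
  "X \<in> feas n L i \<Longrightarrow> Y \<in> feas n L j \<Longrightarrow> i \<noteq> j \<Longrightarrow> X - Y \<in> feas n L i"
  by (auto simp: feas_def cls_def)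

text \<open>The class is the unique minimum isolating cut of its terminal. Hence every proper
  enlargement costs at least one more, which is where each unit of progress comes from.\<close>

definition closed_at :: "nat \<Rightarrow> (nat \<Rightarrow> nat \<Rightarrow> nat) \<Rightarrow> (nat \<Rightarrow> nat) \<Rightarrow> nat \<Rightarrow> bool" where
  "closed_at n W L i \<longleftrightarrow> (\<forall>X\<in>feas n L i. X \<noteq> cls n L i \<longrightarrow> cut n W (cls n L i) < cut n W X)"

lemma closed_at_lam: "closed_at n W L i \<Longrightarrow> lam n W L i = cut n W (cls n L i)"
  by (metis antisym cls_feas closed_at_def lam_attained lam_le less_or_eq_imp_le)

lemma closed_at_gt:
  "closed_at n W L i \<Longrightarrow> X \<in> feas n L i \<Longrightarrow> X \<noteq> cls n L i \<Longrightarrow> lam n W L i < cut n W X"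
  by (simp add: closed_at_lam) (simp add: closed_at_def)

text \<open>Uncrossing: take minimum isolating cuts with as few vertices as possible. If two of them
  met, posimodularity would make both set differences minimum as well, and these are
  smaller.\<close>

lemma disjoint_minimizers:
  assumes "symmetric W"
  obtains Y where "\<And>j. Y j \<in> feas n L j" "\<And>j. cut n W (Y j) = lam n W L j"
    "\<And>j l. j \<noteq> l \<Longrightarrow> Y j \<inter> Y l = {}"
proof -
  have "\<exists>X. (X \<in> feas n L j \<and> cut n W X = lam n W L j) \<and>
     (\<forall>Z. Z \<in> feas n L j \<and> cut n W Z = lam n W L j \<longrightarrow> card X \<le> card Z)" for j
    using ex_has_least_nat[of "\<lambda>X. X \<in> feas n L j \<and> cut n W X = lam n W L j" _ card]
      lam_attained[of n L j W] by blast
  then obtain Y where Y: "\<And>j. Y j \<in> feas n L j" "\<And>j. cut n W (Y j) = lam n W L j"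
    and least: "\<And>j Z. \<lbrakk>Z \<in> feas n L j; cut n W Z = lam n W L j\<rbrakk> \<Longrightarrow> card (Y j) \<le> card Z"
    by metis
  have "Y j \<inter> Y l = {}" if "j \<noteq> l" for j l
  proof (rule ccontr)
    assume ne: "Y j \<inter> Y l \<noteq> {}"
    have f: "Y j - Y l \<in> feas n L j" "Y l - Y j \<in> feas n L l"
      using feas_Diff Y(1) that by metis+
    have "cut n W (Y j - Y l) + cut n W (Y l - Y j) \<le> lam n W L j + lam n W L l"
      using cut_posimodular[OF assms, of n "Y j" "Y l"] Y(2) by simp
    then have "cut n W (Y j - Y l) = lam n W L j"
      using lam_le[OF f(1), of W] lam_le[OF f(2), of W] by linarith
    then have "card (Y j) \<le> card (Y j - Y l)" using least f(1) by blast
    moreover have "card (Y j - Y l) < card (Y j)"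
      using ne Y(1)[of j, THEN feas_finite] by (intro psubset_card_mono) auto
    ultimately show False by simp
  qed
  with Y show ?thesis using that by blast
qed

lemma between_empty: "between n W A {} = 0"
  by (simp add: between_def wsum_def)

text \<open>Disjoint minimizers after the deletion bound the total loss: an edge leaving \<open>B\<close> is lost by at
  most one \<open>Y j\<close>, and whoever loses one had to grow beyond its unique minimum cut.\<close>

lemma delete_structure:
  assumes sym: "symmetric W" and cl: "\<And>j. j < p \<Longrightarrow> closed_at n W L j" and "i < p"
    and ext: "\<And>v. L' v = L v \<or> L v = 0 \<and> L' v = Suc i"
    and B: "B \<subseteq> cls n L' i" and D: "D \<subseteq> {..<n}" "\<And>v. v \<in> D \<Longrightarrow> L' v = 0"
    and g: "\<And>X. X \<in> feas n L' i \<Longrightarrow> lam n W L i + g \<le> cut n W X"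
  obtains Y x xi r where
    "\<And>j. j < p \<Longrightarrow> j \<noteq> i \<Longrightarrow> Y j \<in> feas n L j \<and> cut n W (Y j) = lam n W L j + r j
       \<and> x j = between n W B (D \<inter> Y j) \<and> (0 < x j \<longrightarrow> 0 < r j)"
    "(\<Sum>j\<in>{..<p} - {i}. x j) + xi \<le> between n W B D"
    "(\<Sum>j<p. lam n W L j) + g + (\<Sum>j\<in>{..<p} - {i}. r j) + xi
      \<le> (\<Sum>j<p. lam n (delete B D W) L' j) + between n W B D + (\<Sum>j\<in>{..<p} - {i}. x j)"
proof -
  let ?W' = "delete B D W"
  let ?I = "{..<p} - {i}"
  obtain Y where Y: "\<And>j. Y j \<in> feas n L' j" "\<And>j. cut n ?W' (Y j) = lam n ?W' L' j"
    "\<And>j l. j \<noteq> l \<Longrightarrow> Y j \<inter> Y l = {}"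
    using disjoint_minimizers[OF symmetric_delete[OF sym], of n L' B D] by metis
  define x where "x j = between n W B (D \<inter> Y j)" for j
  define r where "r j = cut n W (Y j) - lam n W L j" for j
  have disj: "B \<inter> D = {}" using B D(2) by (fastforce simp: cls_def)
  have feas: "Y j \<in> feas n L j" if "j \<noteq> i" for j
  proof -
    have "L v = Suc j \<longleftrightarrow> L' v = Suc j" for v using ext[of v] that by auto
    then have cls: "cls n L j = cls n L' j" by (simp add: cls_def)
    have "L v = 0 \<or> L v = Suc j" if "v \<in> Y j" for v
    proof -
      have "L' v = 0 \<or> L' v = Suc j" using Y(1)[of j] that by (simp add: feas_def)
      then show ?thesis using ext[of v] by auto
    qed
    then show ?thesis using Y(1)[of j] by (simp add: feas_def cls)
  qed
  have YB: "Y j \<inter> B = {}" if "j \<noteq> i" for j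
    using Y(1)[of j] B that by (fastforce simp: feas_def cls_def)
  have BYi: "B \<subseteq> Y i" using B Y(1)[of i] by (auto simp: feas_def)
  have cj: "cut n W (Y j) = lam n ?W' L' j + x j" if "j \<noteq> i" for j
    unfolding Y(2)[symmetric] x_def wsum_defs wsum_delete wsum_add
    by (rule wsum_eq[OF sym]) (use YB[OF that] disj in \<open>auto simp: of_bool_def\<close>)
  \<comment> \<open>\<open>Y i\<close> contains \<open>B\<close>, so it loses the deleted edges
    whose end in \<open>D\<close> lies outside \<open>Y i\<close>, which is all of them except
    \<open>x i\<close>.\<close>
  have ci: "cut n W (Y i) + x i = lam n ?W' L' i + between n W B D"
    unfolding Y(2)[symmetric] x_def wsum_defs wsum_delete wsum_add
    by (rule wsum_eq[OF sym]) (use BYi disj in \<open>auto simp: of_bool_def\<close>)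
  have "(\<Sum>j<p. x j) \<le> between n W B D"
    unfolding x_def between_def wsum_sum
  proof (rule wsum_le_pointwise)
    fix u v assume "u < n" "v < n"
    show "(\<Sum>j<p. of_bool (u \<in> B \<and> v \<in> D \<inter> Y j)) \<le> (of_bool (u \<in> B \<and> v \<in> D) :: nat)"
    proof (cases "u \<in> B \<and> v \<in> D")
      case True
      have "(\<Sum>j<p. of_bool (v \<in> Y j)) = (card {j. j < p \<and> v \<in> Y j} :: nat)"
        by (simp add: of_bool_def sum.If_cases Int_def)
      also have "\<dots> \<le> 1" using Y(3) by (intro card_le_Suc0_iff_eq[THEN iffD2, simplified One_nat_def[symmetric]]) auto
      finally show ?thesis using True by simp
    qed auto
  qed
  then have sumx: "(\<Sum>j\<in>?I. x j) + x i \<le> between n W B D"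
    using \<open>i < p\<close> by (simp add: sum.remove[of "{..<p}" i])
  have rj: "cut n W (Y j) = lam n W L j + r j" "0 < x j \<longrightarrow> 0 < r j" if "j < p" "j \<noteq> i" for j
  proof -
    show eq: "cut n W (Y j) = lam n W L j + r j"
      using lam_le[OF feas[OF that(2)], of W] by (simp add: r_def)
    show "0 < x j \<longrightarrow> 0 < r j"
    proof
      assume "0 < x j"
      then have "0 < between n W B (D \<inter> Y j)" by (simp only: x_def)
      then have "D \<inter> Y j \<noteq> {}" using between_empty[of n W B] by force
      then obtain v where v: "v \<in> D" "v \<in> Y j" by blast
      have "L' v = 0" by (rule D(2)[OF v(1)])
      then have "L v = 0" using ext[of v] by linarith
      then have "v \<notin> cls n L j" by (simp add: cls_def)
      then have "Y j \<noteq> cls n L j" using v by blast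
      then show "0 < r j" using closed_at_gt[OF cl[OF that(1)] feas[OF that(2)]] eq by linarith
    qed
  qed
  have "(\<Sum>j\<in>?I. lam n W L j + r j) = (\<Sum>j\<in>?I. lam n ?W' L' j + x j)"
    using rj(1) cj by (intro sum.cong) auto
  moreover have "lam n W L i + g + x i \<le> lam n ?W' L' i + between n W B D"
    using ci g[OF Y(1)[of i]] by linarith
  ultimately have "(\<Sum>j<p. lam n W L j) + g + (\<Sum>j\<in>?I. r j) + x i
      \<le> (\<Sum>j<p. lam n ?W' L' j) + between n W B D + (\<Sum>j\<in>?I. x j)"
    using \<open>i < p\<close> by (simp add: sum.remove[of "{..<p}" i] sum.distrib)
  moreover have "Y j \<in> feas n L j \<and> cut n W (Y j) = lam n W L j + r j
       \<and> x j = between n W B (D \<inter> Y j) \<and> (0 < x j \<longrightarrow> 0 < r j)" if "j < p" "j \<noteq> i" for j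
    using feas[OF that(2)] rj[OF that] by (simp only: x_def simp_thms)
  ultimately show ?thesis by (intro that[of Y r x "x i"] sumx)
qed

text \<open>Write \<open>a\<close> for the deleted weight. If the other terminals lose nothing, the
  surplus beyond \<open>g\<close> is at least \<open>a\<close>. If some terminal \<open>j\<close>
  loses an edge, its slack \<open>r j\<close> supplies the extra unit, since all losses of the
  others together are at most \<open>a\<close>. The labelling may grow at the same time, as happens
  when a set is included and some of its neighbours are excluded.\<close>

lemma gain_delete:
  assumes sym: "symmetric W" and cl: "\<And>j. j < p \<Longrightarrow> closed_at n W L j" and "i < p"
    and ext: "\<And>v. L' v = L v \<or> L v = 0 \<and> L' v = Suc i"
    and B: "B \<subseteq> cls n L' i" and D: "D \<subseteq> {..<n}" "\<And>v. v \<in> D \<Longrightarrow> L' v = 0"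
    and g: "\<And>X. X \<in> feas n L' i \<Longrightarrow> lam n W L i + g \<le> cut n W X"
    and pos: "0 < between n W B D"
  shows "(\<Sum>j<p. lam n W L j) + g + 1
     \<le> (\<Sum>j<p. lam n (delete B D W) L' j) + 2 * between n W B D"
proof -
  from delete_structure[OF sym cl \<open>i < p\<close> ext B D g]
  obtain Y x xi r where *:
    "\<And>j. j < p \<Longrightarrow> j \<noteq> i \<Longrightarrow> Y j \<in> feas n L j \<and> cut n W (Y j) = lam n W L j + r j
       \<and> x j = between n W B (D \<inter> Y j) \<and> (0 < x j \<longrightarrow> 0 < r j)"
    "(\<Sum>j\<in>{..<p} - {i}. x j) + xi \<le> between n W B D"
    "(\<Sum>j<p. lam n W L j) + g + (\<Sum>j\<in>{..<p} - {i}. r j) + xi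
      \<le> (\<Sum>j<p. lam n (delete B D W) L' j) + between n W B D + (\<Sum>j\<in>{..<p} - {i}. x j)"
    by metis
  show ?thesis
  proof (cases "(\<Sum>j\<in>{..<p} - {i}. x j) = 0")
    case True
    then show ?thesis using *(3) pos by linarith
  next
    case False
    then obtain j where "j \<in> {..<p} - {i}" "0 < x j" by (metis gr0I sum.neutral)
    then have "0 < (\<Sum>j\<in>{..<p} - {i}. r j)" using *(1) by (auto intro!: sum_pos2)
    then show ?thesis using *(2,3) by linarith
  qed
qed

text \<open>A gain of only one from weight at least two leaves no room: the total slack of the other
  terminals must be one and their total loss must be the whole deleted weight. The only terminal
  with slack then takes every deleted edge, with a set that exceeds its old minimum by one.\<close>

lemma gain_delete_tight:
  assumes sym: "symmetric W" and cl: "\<And>j. j < p \<Longrightarrow> closed_at n W L j" and "i < p"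
    and D: "D \<subseteq> {..<n}" "\<And>v. v \<in> D \<Longrightarrow> L v = 0"
    and ge2: "2 \<le> between n W (cls n L i) D"
    and tight: "(\<Sum>j<p. lam n (delete (cls n L i) D W) L j) + 2 * between n W (cls n L i) D
       \<le> (\<Sum>j<p. lam n W L j) + 1"
  obtains j Y where "j < p" "j \<noteq> i" "Y \<in> feas n L j" "cut n W Y = lam n W L j + 1"
    "between n W (cls n L i) (D - Y) = 0"
proof -
  let ?B = "cls n L i"
  let ?I = "{..<p} - {i}"
  from delete_structure[OF sym cl \<open>i < p\<close>, of L ?B D 0] D lam_le
  obtain Y x xi r where *:
    "\<And>j. j < p \<Longrightarrow> j \<noteq> i \<Longrightarrow> Y j \<in> feas n L j \<and> cut n W (Y j) = lam n W L j + r j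
       \<and> x j = between n W ?B (D \<inter> Y j) \<and> (0 < x j \<longrightarrow> 0 < r j)"
    "(\<Sum>j\<in>?I. x j) + xi \<le> between n W ?B D"
    "(\<Sum>j<p. lam n W L j) + 0 + (\<Sum>j\<in>?I. r j) + xi
      \<le> (\<Sum>j<p. lam n (delete ?B D W) L j) + between n W ?B D + (\<Sum>j\<in>?I. x j)"
    by (metis add.right_neutral order_refl)
  have "(\<Sum>j\<in>?I. x j) \<noteq> 0" using * tight ge2 by linarith
  then obtain j where j: "j \<in> ?I" "0 < x j" by (metis gr0I sum.neutral)
  have rj: "0 < r j" using *(1) j by auto
  have sr: "(\<Sum>j\<in>?I. r j) = r j + (\<Sum>j\<in>?I - {j}. r j)"
    and sx: "(\<Sum>j\<in>?I. x j) = x j + (\<Sum>j\<in>?I - {j}. x j)" using j by (simp_all add: sum.remove)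
  \<comment> \<open>Since the losses sum to at most the deleted weight, the total slack is at most
    one, and \<open>r j\<close> already uses it up.\<close>
  have bd: "(\<Sum>j\<in>?I. r j) + between n W ?B D \<le> 1 + (\<Sum>j\<in>?I. x j)"
    using *(3) tight by linarith
  have r1: "r j = 1" "(\<Sum>j\<in>?I - {j}. r j) = 0" using bd sr rj *(2) by linarith+
  then have "\<And>l. l \<in> ?I - {j} \<Longrightarrow> r l = 0" by simp
  then have "\<And>l. l \<in> ?I - {j} \<Longrightarrow> x l = 0" using *(1) by (metis DiffE gr0I lessThan_iff not_gr_zero singletonI)
  then have "(\<Sum>j\<in>?I - {j}. x j) = 0" by simp
  then have "x j = between n W ?B D" using bd sx r1 sr *(2) by linarith
  moreover have "x j + between n W ?B (D - Y j) = between n W ?B D"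
    using *(1) j by (auto simp: between_def wsum_add intro!: wsum_eq[OF sym])
  ultimately have "between n W ?B (D - Y j) = 0" by simp
  then show ?thesis using that[of j "Y j"] j *(1) r1 by auto
qed

section \<open>Exchange arguments\<close>

lemma between_mono: "A \<subseteq> A' \<Longrightarrow> B \<subseteq> B' \<Longrightarrow> between n W A B \<le> between n W A' B'"
  unfolding between_def by (rule wsum_le_pointwise) auto

lemma between_commute: "symmetric W \<Longrightarrow> between n W A B = between n W B A"
  unfolding between_def by (rule wsum_eq) auto

lemma between_Un:
  assumes "B \<inter> C = {}"
  shows "between n W A (B \<union> C) = between n W A B + between n W A C"
  unfolding between_def wsum_add
  by (rule antisym; rule wsum_le_pointwise) (use assms in auto)

lemma between_pos_obtains:
  assumes "0 < between n W A B"
  obtains u v where "u < n" "v < n" "u \<in> A" "v \<in> B" "0 < W u v"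
proof (rule ccontr)
  assume "\<not> thesis"
  then have "between n W A B \<le> wsum n W (\<lambda>u v. 0)"
    unfolding between_def using that by (intro wsum_le_pointwise) auto
  with assms show False by (simp add: wsum_def)
qed

lemma between_pos:
  assumes "u < n" "v < n" "u \<in> A" "v \<in> B" "0 < W u v"
  shows "0 < between n W A B"
  unfolding between_def wsum_def
  by (rule sum_pos2[of _ u], simp, simp add: assms, rule sum_pos2[of _ v]) (use assms in auto)

lemma cut_Un_disjoint:
  assumes "symmetric W" "A \<inter> B = {}"
  shows "cut n W (A \<union> B) + 2 * between n W A B = cut n W A + cut n W B"
  unfolding wsum_defs wsum_double wsum_add
  using assms(2) by (intro wsum_eq[OF assms(1)]) (auto simp: of_bool_def)

definition label :: "nat set \<Rightarrow> nat \<Rightarrow> (nat \<Rightarrow> nat) \<Rightarrow> nat \<Rightarrow> nat" where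
  "label X i L v = (if v \<in> X then Suc i else L v)"

definition fiber :: "nat \<Rightarrow> (nat \<Rightarrow> nat) \<Rightarrow> nat \<Rightarrow> nat set" where
  "fiber n f i = {v. v < n \<and> f v = i}"

definition compatible :: "nat \<Rightarrow> nat \<Rightarrow> (nat \<Rightarrow> nat) \<Rightarrow> (nat \<Rightarrow> nat) \<Rightarrow> bool" where
  "compatible n p L f \<longleftrightarrow> (\<forall>v<n. f v < p \<and> (L v \<noteq> 0 \<longrightarrow> L v = Suc (f v)))"

type_synonym node = "(nat \<Rightarrow> nat \<Rightarrow> nat) \<times> (nat \<Rightarrow> nat) \<times> nat"

text \<open>In a node \<open>(W, L, c)\<close> the positive entries of \<open>L\<close> say which terminal a vertex has been merged
  with, and \<open>c\<close> is the weight of the edges already cut.\<close>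

fun solution :: "nat \<Rightarrow> nat \<Rightarrow> nat \<Rightarrow> node \<Rightarrow> (nat \<Rightarrow> nat) \<Rightarrow> bool" where
  "solution n p k (W, L, c) f \<longleftrightarrow> compatible n p L f \<and> cost2 n W f + 2 * c \<le> 2 * k"

text \<open>Bounds twice the final cost and is therefore compared with \<open>2 * k\<close>; the
  measure \<open>\<mu>\<close> of a node is \<open>2 * k\<close> minus this value.\<close>

fun lower :: "nat \<Rightarrow> nat \<Rightarrow> node \<Rightarrow> nat" where
  "lower n p (W, L, c) = 2 * c + (\<Sum>i<p. lam n W L i)"

lemma fiber_feas: "compatible n p L f \<Longrightarrow> fiber n f i \<in> feas n L i"
  by (auto simp: compatible_def fiber_def feas_def cls_def)

text \<open>An ordered pair with different values leaves exactly one fiber, namely that of its first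
  vertex.\<close>

lemma cost2_fibers:
  assumes "\<And>v. v < n \<Longrightarrow> f v < p"
  shows "cost2 n W f = (\<Sum>i<p. cut n W (fiber n f i))"
proof -
  have "(\<Sum>i<p. of_bool (u \<in> fiber n f i \<and> v \<notin> fiber n f i)) = (of_bool (f u \<noteq> f v) :: nat)"
    if "u < n" "v < n" for u v
  proof -
    have "(\<Sum>i<p. of_bool (u \<in> fiber n f i \<and> v \<notin> fiber n f i))
        = (\<Sum>i<p. if i = f u then of_bool (f u \<noteq> f v) else (0 :: nat))"
      using that by (intro sum.cong) (auto simp: fiber_def)
    then show ?thesis using assms[OF that(1)] by simp
  qed
  then show ?thesis
    unfolding wsum_defs wsum_sum by (intro antisym wsum_le_pointwise) auto
qed

lemma lower_bound:
  assumes "solution n p k N f"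
  shows "lower n p N \<le> 2 * k"
proof (cases N)
  case (fields W L c)
  have r: "compatible n p L f" using assms fields by simp
  have "(\<Sum>i<p. lam n W L i) \<le> (\<Sum>i<p. cut n W (fiber n f i))"
    by (intro sum_mono lam_le fiber_feas[OF r])
  also have "\<dots> = cost2 n W f" using r by (intro cost2_fibers[symmetric]) (simp add: compatible_def)
  finally show ?thesis using assms fields by simp
qed

text \<open>The doubled cost is twice the cut of part \<open>i\<close> plus the contribution of
  edges between two other parts, and the latter can only shrink when vertices move into part
  \<open>i\<close>.\<close>

lemma exchange:
  assumes sym: "symmetric W" and "X \<subseteq> {..<n}"
    and le: "cut n W (fiber n f i \<union> X) \<le> cut n W (fiber n f i)"
  shows "cost2 n W (\<lambda>v. if v \<in> X then i else f v) \<le> cost2 n W f"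
proof -
  have "cost2 n W (\<lambda>v. if v \<in> X then i else f v) + 2 * cut n W (fiber n f i)
      \<le> cost2 n W f + 2 * cut n W (fiber n f i \<union> X)"
    unfolding wsum_defs wsum_double wsum_add
    by (rule wsum_le[OF sym]) (auto simp: fiber_def of_bool_def)
  with le show ?thesis by simp
qed

text \<open>Submodularity of the cut turns the hypothesis \<open>min\<close> into the statement that
  absorbing \<open>X\<close> does not enlarge the boundary of part \<open>i\<close>. This serves
  both minimum sets (closure) and sets one above the minimum (splitting).\<close>

lemma solution_grow:
  assumes sym: "symmetric W" and X: "X \<in> feas n L i" and "i < p"
    and f: "solution n p k (W, L, c) f"
    and min: "cut n W X \<le> cut n W (fiber n f i \<inter> X)"
  shows "solution n p k (W, label X i L, c) (\<lambda>v. if v \<in> X then i else f v)"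
proof -
  have "cut n W (fiber n f i \<union> X) \<le> cut n W (fiber n f i)"
    using cut_submodular[OF sym, of n "fiber n f i" X] min by linarith
  then have "cost2 n W (\<lambda>v. if v \<in> X then i else f v) \<le> cost2 n W f"
    using X by (intro exchange[OF sym]) (auto simp: feas_def)
  then show ?thesis using f X \<open>i < p\<close> by (auto simp: compatible_def label_def feas_def)
qed

lemma solution_closure:
  assumes "symmetric W" "X \<in> feas n L i" "i < p" "cut n W X = lam n W L i"
    and f: "solution n p k (W, L, c) f"
  shows "\<exists>f. solution n p k (W, label X i L, c) f"
proof -
  have "fiber n f i \<inter> X \<in> feas n L i"
    using f assms(2) by (intro feas_Int fiber_feas) auto
  from lam_le[OF this, of W] show ?thesis using solution_grow[OF assms(1-3) f] assms(4) by auto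
qed

lemma solution_label:
  "solution n p k (W, L, c) f \<Longrightarrow> (\<And>v. v \<in> A \<Longrightarrow> f v = i) \<Longrightarrow> solution n p k (W, label A i L, c) f"
  by (auto simp: compatible_def label_def)

lemma solution_delete:
  assumes "symmetric W" "A \<inter> B = {}" "\<And>u v. u \<in> A \<Longrightarrow> v \<in> B \<Longrightarrow> f u \<noteq> f v"
    and "solution n p k (W, L, c) f"
  shows "solution n p k (delete A B W, L, c + between n W A B) f"
  using assms(4) cost2_delete_eq[where n = n, OF assms(1-3)] by simp

text \<open>As soon as one vertex of \<open>U\<close> is on side \<open>i\<close>, the intersection
  of that side with the tight set properly contains the class. Closedness then makes it at least as
  expensive as the tight set, so all of \<open>U\<close> can be absorbed.\<close>

lemma solution_split:
  assumes sym: "symmetric W" and cl: "closed_at n W L i" and "i < p"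
    and X: "cls n L i \<union> U \<in> feas n L i" and U: "\<And>v. v \<in> U \<Longrightarrow> L v = 0"
    and tight: "cut n W (cls n L i \<union> U) = lam n W L i + 1"
    and f: "solution n p k (W, L, c) f"
  shows "\<exists>f. solution n p k (W, L, c) f \<and> ((\<forall>v\<in>U. f v = i) \<or> (\<forall>v\<in>U. f v \<noteq> i))"
proof (cases "\<forall>v\<in>U. f v \<noteq> i")
  case False
  then obtain v where v: "v \<in> U" "f v = i" by blast
  let ?X = "cls n L i \<union> U"
  have "v < n" using X v by (auto simp: feas_def)
  have A: "fiber n f i \<inter> ?X \<in> feas n L i"
    using f X by (intro feas_Int fiber_feas) auto
  have "v \<notin> cls n L i" using U[OF v(1)] by (simp add: cls_def)
  moreover have "v \<in> fiber n f i \<inter> ?X" using v \<open>v < n\<close> by (simp add: fiber_def)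
  ultimately have "fiber n f i \<inter> ?X \<noteq> cls n L i" by blast
  then have "cut n W ?X \<le> cut n W (fiber n f i \<inter> ?X)"
    using closed_at_gt[OF cl A] tight by linarith
  from solution_grow[OF sym X \<open>i < p\<close> f this]
  have "solution n p k (W, label ?X i L, c) (\<lambda>v. if v \<in> ?X then i else f v)" .
  then have "solution n p k (W, L, c) (\<lambda>v. if v \<in> ?X then i else f v)"
    using U X unfolding solution.simps compatible_def label_def
    by (auto split: if_splits simp: feas_def cls_def)
  then show ?thesis by (intro exI[of _ "\<lambda>v. if v \<in> ?X then i else f v"]) auto
qed (use f in blast)

text \<open>If no neighbour of \<open>U\<close> outside \<open>X = S\<^sub>i \<union> U\<close> is on the side of terminal \<open>i\<close>, moving \<open>U\<close> to the
  part \<open>j\<close> cuts the edges to \<open>S\<^sub>i\<close> but saves those to part \<open>j\<close>.\<close>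

lemma solution_move:
  assumes sym: "symmetric W" and "j < p" "j \<noteq> i"
    and X: "cls n L i \<union> U \<in> feas n L i" and U: "\<And>v. v \<in> U \<Longrightarrow> L v = 0"
    and f: "solution n p k (W, L, c) f" and fU: "\<And>v. v \<in> U \<Longrightarrow> f v = i"
    and nb: "\<And>u z. \<lbrakk>u \<in> U; z < n; 0 < W u z; z \<notin> cls n L i \<union> U\<rbrakk> \<Longrightarrow> f z \<noteq> i"
    and le: "between n W (cls n L i) U \<le> between n W U (fiber n f j)"
  shows "solution n p k (W, L, c) (\<lambda>v. if v \<in> U then j else f v)"
proof -
  have fc: "f v = i" if "v \<in> cls n L i" for v
    using that f by (auto simp: compatible_def cls_def)
  have nb': "f z \<noteq> i" if "u \<in> U" "z < n" "u < n" "W u z \<noteq> 0 \<or> W z u \<noteq> 0" "z \<notin> cls n L i" "z \<notin> U" for u z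
    using nb[of u z] that sym by (auto simp: symmetric_def)
  have "cost2 n W (\<lambda>v. if v \<in> U then j else f v) + 2 * between n W U (fiber n f j)
      \<le> cost2 n W f + 2 * between n W (cls n L i) U"
    unfolding wsum_defs wsum_double wsum_add
  proof (rule wsum_le[OF sym], goal_cases)
    case (1 u v)
    have W2: "W v u \<noteq> 0" using 1 sym by (simp add: symmetric_def)
    have c: "U \<inter> cls n L i = {}" using U by (fastforce simp: cls_def)
    show ?case
    proof (cases "u \<in> U"; cases "v \<in> U")
      assume uv: "u \<in> U" "v \<notin> U"
      show ?thesis
        using nb'[of u v] uv 1 W2 fc[of v] fU[of u] \<open>j \<noteq> i\<close> c
        by (cases "v \<in> cls n L i") (auto simp: fiber_def)
    next
      assume uv: "u \<notin> U" "v \<in> U"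
      show ?thesis
        using nb'[of v u] uv 1 W2 fc[of u] fU[of v] \<open>j \<noteq> i\<close> c
        by (cases "u \<in> cls n L i") (auto simp: fiber_def)
    qed (use fU \<open>j \<noteq> i\<close> in \<open>auto simp: fiber_def\<close>)
  qed
  with le have "cost2 n W (\<lambda>v. if v \<in> U then j else f v) \<le> cost2 n W f" by linarith
  then show ?thesis using f U \<open>j < p\<close> by (auto simp: compatible_def)
qed

text \<open>A tight set of another terminal that takes over all edges from \<open>S\<^sub>i\<close> to \<open>U\<close> can be enlarged to
  contain \<open>U\<close>; since \<open>U\<close> has maximum size, it then equals \<open>U\<close> up to its terminal.\<close>

lemma tight_opponent:
  assumes sym: "symmetric W" and cli: "closed_at n W L i" and clj: "closed_at n W L j" and "j \<noteq> i"
    and X: "cls n L i \<union> U \<in> feas n L i" and U: "\<And>v. v \<in> U \<Longrightarrow> L v = 0"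
    and tight: "cut n W (cls n L i \<union> U) = lam n W L i + 1"
    and ge2: "2 \<le> between n W (cls n L i) U"
    and Y0: "Y0 \<in> feas n L j" "cut n W Y0 = lam n W L j + 1" "between n W (cls n L i) (U - Y0) = 0"
    and largest: "\<And>Y. \<lbrakk>Y \<in> feas n L j; cut n W Y = lam n W L j + 1;
        0 < between n W (cls n L j) (Y - cls n L j)\<rbrakk> \<Longrightarrow> card (Y - cls n L j) \<le> card U"
  shows "between n W (cls n L i) U = between n W U (cls n L j)"
proof -
  let ?S = "cls n L i" and ?R = "cls n L j"
  let ?Q = "\<lambda>Y. Y \<in> feas n L j \<and> cut n W Y = lam n W L j + 1 \<and> between n W ?S (U - Y) = 0"
  have "card Y \<le> n" if "Y \<in> feas n L j" for Y
    using card_mono[of "{..<n}" Y] that by (auto simp: feas_def)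
  then have "\<forall>Y. ?Q Y \<longrightarrow> card Y < Suc n" by (simp add: le_imp_less_Suc)
  \<comment> \<open>Enlarging the opponent's tight set as far as possible prepares the
    contradiction: if \<open>U\<close> is not yet contained, adding the missing piece
    \<open>P\<close> must leave the tight range.\<close>
  from ex_has_greatest_nat[of ?Q Y0, OF _ this] Y0
  obtain Y where Y: "?Q Y" and maxY: "\<And>Z. ?Q Z \<Longrightarrow> card Z \<le> card Y" by auto
  define P where "P = U - Y"
  have US: "U \<inter> ?S = {}" and UR: "U \<inter> ?R = {}" using U by (fastforce simp: cls_def)+
  have YS: "Y \<inter> ?S = {}" using Y \<open>j \<noteq> i\<close> by (fastforce simp: feas_def cls_def)
  have RY: "?R \<subseteq> Y" using Y by (auto simp: feas_def)
  have XR: "(?S \<union> U) \<inter> ?R = {}" using UR RY YS by blast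
  have fU: "finite U" using feas_finite[OF X] by simp
  have "P = {}"
  proof (rule ccontr)
    assume "P \<noteq> {}"
    have XY: "(?S \<union> U) - Y = ?S \<union> P" using YS by (auto simp: P_def)
    have SP: "between n W ?S P = 0" using Y by (simp add: P_def)
    have "cut n W (?S \<union> P) = lam n W L i + cut n W P"
      using cut_Un_disjoint[OF sym, of ?S P n] US SP closed_at_lam[OF cli] by (auto simp: P_def)
    moreover have "lam n W L j \<le> cut n W (Y - (?S \<union> U))"
      using lam_le[OF feas_Diff[OF _ X \<open>j \<noteq> i\<close>]] Y by blast
    \<comment> \<open>No edge runs from \<open>?S\<close> to \<open>P\<close>, so
      \<open>?S \<union> P\<close> costs \<open>lam n W L i + cut n W P\<close>. Posimodularity
      leaves for \<open>P\<close> only the two units by which the two tight sets exceed their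
      minima.\<close>
    ultimately have P2: "cut n W P \<le> 2"
      using cut_posimodular[OF sym, of n "?S \<union> U" Y] XY Y tight by simp
    have fYP: "Y \<union> P \<in> feas n L j"
      using Y X U by (auto simp: feas_def P_def)
    have "Y \<union> P \<noteq> ?R" using \<open>P \<noteq> {}\<close> UR RY by (auto simp: P_def)
    then have "lam n W L j < cut n W (Y \<union> P)" using closed_at_gt[OF clj fYP] by simp
    moreover have "cut n W (Y \<union> P) \<noteq> lam n W L j + 1"
    proof
      assume "cut n W (Y \<union> P) = lam n W L j + 1"
      then have "card (Y \<union> P) \<le> card Y"
        using maxY[of "Y \<union> P"] fYP Y between_mono[of ?S ?S "U - (Y \<union> P)" "U - Y" n W]
        by fastforce
      moreover have "card Y < card (Y \<union> P)"
        using \<open>P \<noteq> {}\<close> feas_finite[OF fYP] by (intro psubset_card_mono) (auto simp: P_def)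
      ultimately show False by simp
    qed
    \<comment> \<open>By closedness and maximality of \<open>Y\<close>, the set
      \<open>Y \<union> P\<close> costs at least \<open>lam n W L j + 2\<close>, yet disjointness
      gives at most \<open>lam n W L j + 3\<close> minus twice the weight between \<open>Y\<close>
      and \<open>P\<close>. By parity that weight is zero.\<close>
    ultimately have YP: "between n W Y P = 0" "1 \<le> cut n W P"
      using cut_Un_disjoint[OF sym, of Y P n] Y P2 by (auto simp: P_def)
    \<comment> \<open>\<open>P\<close> is now disconnected from the rest of the tight set, so
      dropping it saves \<open>cut n W P \<ge> 1\<close>. Only the class itself can be that cheap;
      then \<open>U = P\<close> has no edge to \<open>?S\<close>, against
      \<open>ge2\<close>.\<close>
    let ?Z = "(?S \<union> U) - P"
    have "between n W P ?Z \<le> between n W P ?S + between n W P Y"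
      unfolding between_def wsum_add by (rule wsum_le_pointwise) (auto simp: P_def)
    then have "between n W P ?Z = 0"
      using SP YP between_commute[OF sym] by (metis add_0 le_zero_eq)
    then have "cut n W ?Z + cut n W P = lam n W L i + 1"
      using cut_Un_disjoint[OF sym, of P ?Z n] tight
      by (simp add: Un_absorb1 P_def) (metis (no_types, lifting) Diff_subset P_def Un_Diff_cancel add.commute le_supI2 sup.absorb2 sup_assoc)
    moreover have fZ: "?Z \<in> feas n L i" using X US by (auto simp: feas_def P_def)
    ultimately have "?Z = ?S" using closed_at_gt[OF cli fZ] YP(2) by force
    then have "U = P" using US by (auto simp: P_def)
    with SP ge2 show False by simp
  qed
  then have UY: "U \<subseteq> Y - ?R" using UR by (auto simp: P_def)
  have RYu: "?R \<union> (Y - ?R) = Y" using RY by blast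
  \<comment> \<open>The free part of a tight set with weight \<open>b\<close> to its class has cut
    \<open>2 * b + 1\<close>. The same identity for \<open>U\<close> yields equal weights to both
    classes once \<open>Y - ?R = U\<close> is known.\<close>
  have cY: "lam n W L j + 1 + 2 * between n W ?R (Y - ?R) = lam n W L j + cut n W (Y - ?R)"
    using cut_Un_disjoint[OF sym, of ?R "Y - ?R" n] RYu Y closed_at_lam[OF clj] by simp
  have "between n W ?S U \<le> cut n W (Y - ?R)"
    unfolding wsum_defs by (rule wsum_le[OF sym]) (use UY YS in \<open>auto simp: of_bool_def\<close>)
  then have "0 < between n W ?R (Y - ?R)" using cY ge2 by linarith
  then have "card (Y - ?R) \<le> card U" using largest Y by blast
  then have YU: "Y - ?R = U" using UY Y[THEN conjunct1, THEN feas_finite]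
    by (metis card_seteq finite_Diff)
  have "lam n W L i + 1 + 2 * between n W ?S U = lam n W L i + cut n W U"
    using cut_Un_disjoint[OF sym, of ?S U n] tight US closed_at_lam[OF cli] by (simp add: Int_commute)
  with cY YU have "between n W ?S U = between n W ?R U" by simp
  then show ?thesis using between_commute[OF sym] by metis
qed

section \<open>The branching rules\<close>

text \<open>Counts search nodes; the summand \<open>1\<close> pays for the node itself. Three base
  values equal to one account for children that are popped only to be rejected.\<close>

fun trib :: "nat \<Rightarrow> nat" where
  "trib 0 = 1"
| "trib (Suc 0) = 1"
| "trib (Suc (Suc 0)) = 1"
| "trib (Suc (Suc (Suc m))) = 1 + trib (Suc (Suc m)) + trib (Suc m) + trib m"

lemma trib_Suc_mono: "trib m \<le> trib (Suc m)"
  by (induction m rule: trib.induct) auto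

lemma trib_mono: "l \<le> m \<Longrightarrow> trib l \<le> trib m"
  using lift_Suc_mono_le[of trib] trib_Suc_mono by blast

text \<open>\<open>1.8395\<close> exceeds the real root of \<open>x\<^sup>3 = x\<^sup>2 + x + 1\<close>; the offset \<open>1 / 2\<close> absorbs the
  additive constant of the recurrence.\<close>

lemma trib_bound: "real (trib m) \<le> 3 / 2 * 1.8395 ^ m - 1 / 2"
proof (induction m rule: trib.induct)
  case (4 m)
  define y :: real where "y = 1.8395 ^ m"
  have "0 \<le> y" by (simp add: y_def)
  \<comment> \<open>Numerically \<open>1 + 1.8395 + 3.38376025 = 6.22326025\<close>, just below the
    cube \<open>6.224426979875\<close>.\<close>
  have pw: "1.8395 ^ Suc m = 1.8395 * y" "1.8395 ^ Suc (Suc m) = 3.38376025 * y"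
    "1.8395 ^ Suc (Suc (Suc m)) = 6.224426979875 * y" by (simp_all add: y_def)
  have tr: "real (trib (Suc (Suc (Suc m)))) = 1 + real (trib (Suc (Suc m))) + real (trib (Suc m)) + real (trib m)"
    by simp
  show ?case using 4 \<open>0 \<le> y\<close> unfolding tr pw y_def[symmetric] by (simp add: field_simps)
qed (simp_all add: power2_eq_square)

text \<open>The number of search nodes granted to the subtree of \<open>N\<close>. The measure is
  capped at \<open>k\<close> because a node with a larger one is settled by its default assignment;
  the shift by three leaves room for children of negative measure, which are still popped
  once.\<close>

definition pot :: "nat \<Rightarrow> nat \<Rightarrow> nat \<Rightarrow> node \<Rightarrow> nat" where
  "pot n p k N = trib (nat (min (2 * int k - int (lower n p N)) (int k) + 3))"

lemma pot_pos: "0 < pot n p k N"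
  using trib_mono[of 0 "nat (min (2 * int k - int (lower n p N)) (int k) + 3)"] by (simp add: pot_def)

lemma pot_le_root: "pot n p k N \<le> trib (k + 3)"
  unfolding pot_def by (rule trib_mono) linarith

lemma pot_antimono: "lower n p N \<le> lower n p N' \<Longrightarrow> pot n p k N' \<le> pot n p k N"
  unfolding pot_def by (rule trib_mono) linarith

text \<open>Under the two assumptions the cap is inactive and \<open>m\<close> is the measure
  itself. Gains up to three are absorbed by the shift, even if the child has negative
  measure.\<close>

lemma pot_branch:
  assumes "k \<le> lower n p N" "lower n p N \<le> 2 * k"
  obtains m where "pot n p k N = 1 + trib (m + 2) + trib (m + 1) + trib m"
    "\<And>N' g. \<lbrakk>lower n p N + g \<le> lower n p N'; g \<le> 3\<rbrakk> \<Longrightarrow> pot n p k N' \<le> trib (m + 3 - g)"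
proof -
  define m where "m = 2 * k - lower n p N"
  have "nat (min (2 * int k - int (lower n p N)) (int k) + 3) = Suc (Suc (Suc m))"
    using assms by (simp add: m_def)
  then have "pot n p k N = 1 + trib (m + 2) + trib (m + 1) + trib m"
    by (simp add: pot_def numeral_eq_Suc)
  moreover have "pot n p k N' \<le> trib (m + 3 - g)"
    if "lower n p N + g \<le> lower n p N'" "g \<le> 3" for N' g
    unfolding pot_def using that assms by (intro trib_mono) (simp add: m_def)
  ultimately show ?thesis using that by blast
qed

lemma lam_label_mono: "(\<And>v. v \<in> X \<Longrightarrow> L v = 0) \<Longrightarrow> lam n W L j \<le> lam n W (label X i L) j"
  by (rule lam_greatest, rule lam_le) (fastforce simp: feas_def cls_def label_def split: if_splits)

lemma feas_label: "(\<And>v. v \<in> X \<Longrightarrow> L v = 0) \<Longrightarrow> X \<subseteq> {..<n} \<Longrightarrow>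
    feas n (label X i L) i = {Y \<in> feas n L i. X \<subseteq> Y}"
  by (auto simp: feas_def cls_def label_def split: if_splits)

lemma lower_label:
  assumes "i < p" "\<And>v. v \<in> X \<Longrightarrow> L v = 0" "X \<subseteq> {..<n}"
    and "\<And>Y. Y \<in> feas n L i \<Longrightarrow> X \<subseteq> Y \<Longrightarrow> lam n W L i + g \<le> cut n W Y"
  shows "lower n p (W, L, c) + g \<le> lower n p (W, label X i L, c)"
proof -
  have "lam n W L i + g \<le> lam n W (label X i L) i"
    using assms(4) feas_label[where i = i and L = L, OF assms(2,3)] by (intro lam_greatest) blast
  moreover have "(\<Sum>j\<in>{..<p} - {i}. lam n W L j) \<le> (\<Sum>j\<in>{..<p} - {i}. lam n W (label X i L) j)"
    by (intro sum_mono lam_label_mono assms(2))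
  ultimately show ?thesis using \<open>i < p\<close> by (simp add: sum.remove[of "{..<p}" i])
qed

lemma card_le_between:
  assumes "finite B" "\<And>z. z \<in> B \<Longrightarrow> 0 < between n W A {z}"
  shows "card B \<le> between n W A B"
  using assms
proof (induction B)
  case (insert z B)
  have "between n W A ({z} \<union> B) = between n W A {z} + between n W A B"
    using insert.hyps by (intro between_Un) auto
  moreover have "0 < between n W A {z}" "card B \<le> between n W A B" using insert by auto
  ultimately show ?case using insert.hyps by simp
qed simp

text \<open>A closed node together with the set to branch on. The assumptions \<open>alive\<close>
  place it exactly in the range where the cap in \<open>pot\<close> is inactive and the node is not
  yet hopeless.\<close>

locale branching =
  fixes n p k :: nat and W :: "nat \<Rightarrow> nat \<Rightarrow> nat" and L :: "nat \<Rightarrow> nat" and c i :: nat and U :: "nat set"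
  assumes sym: "symmetric W"
    and cl: "\<And>j. j < p \<Longrightarrow> closed_at n W L j"
    and i: "i < p"
    and U: "U \<subseteq> {..<n}" "\<And>v. v \<in> U \<Longrightarrow> L v = 0"
    and adj: "0 < between n W (cls n L i) U"
    and alive: "k \<le> lower n p (W, L, c)" "lower n p (W, L, c) \<le> 2 * k"
begin

abbreviation "S \<equiv> cls n L i"

definition nbrs :: "nat set" where
  "nbrs = {z. z < n \<and> L z = 0 \<and> z \<notin> U \<and> 0 < between n W U {z}}"

definition out :: node where
  "out = (delete S U W, L, c + between n W S U)"

definition ins :: node where
  "ins = (W, label U i L, c)"

text \<open>The case in which \<open>U\<close> joins side \<open>i\<close> and \<open>z\<close> is
  its smallest neighbour doing so: the smaller neighbours are then known to be elsewhere, and their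
  edges to \<open>S \<union> U\<close> are cut. This makes the cases disjoint and gives later ones
  an additional gain.\<close>

definition via :: "nat \<Rightarrow> node" where
  "via z = (delete (S \<union> U) {y \<in> nbrs. y < z} W, label (insert z U) i L,
            c + between n W (S \<union> U) {y \<in> nbrs. y < z})"

definition special :: bool where
  "special \<longleftrightarrow> between n W S U = 1 \<or> (\<exists>j<p. j \<noteq> i \<and> between n W S U \<le> between n W (cls n L j) U)"

lemma SU: "S \<inter> U = {}"
  using U(2) by (fastforce simp: cls_def)

lemma feas_X: "S \<union> U \<in> feas n L i"
  using U by (auto simp: feas_def cls_def)

lemma U_ne: "U \<noteq> {}"
  using adj by (auto simp: between_empty)

lemma lower_out: "lower n p (W, L, c) + 1 \<le> lower n p out"
  using gain_delete[OF sym cl i, of L S U 0] U adj lam_le by (simp add: out_def)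

lemma lower_ins: "lower n p (W, L, c) + 1 \<le> lower n p ins"
  unfolding ins_def
proof (rule lower_label[OF i U(2,1)])
  fix Y assume Y: "Y \<in> feas n L i" "U \<subseteq> Y"
  then have "Y \<noteq> S" using SU U_ne by blast
  then show "lam n W L i + 1 \<le> cut n W Y" using closed_at_gt[OF cl[OF i] Y(1)] by simp
qed

lemma solution_out:
  assumes "solution n p k (W, L, c) f" "\<And>v. v \<in> U \<Longrightarrow> f v \<noteq> i"
  shows "solution n p k out f"
  unfolding out_def
proof (rule solution_delete[OF sym SU _ assms(1)])
  fix u v assume "u \<in> S" "v \<in> U"
  then show "f u \<noteq> f v" using assms by (auto simp: compatible_def cls_def)
qed

lemma solution_ins:
  assumes "solution n p k (W, L, c) f" "\<And>v. v \<in> U \<Longrightarrow> f v = i"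
  shows "solution n p k ins f"
  unfolding ins_def by (rule solution_label[OF assms])

end

locale loose_branching = branching +
  fixes v
  assumes single: "U = {v}"
    and loose: "\<And>X. X \<in> feas n L i \<Longrightarrow> v \<in> X \<Longrightarrow> lam n W L i + 2 \<le> cut n W X"
begin

lemma complete: "solution n p k (W, L, c) f \<Longrightarrow> \<exists>N\<in>set [out, ins]. \<exists>f. solution n p k N f"
  using solution_out[of f] solution_ins[of f] single by (cases "f v = i") auto

lemma decreasing: "sum_list (map (pot n p k) [out, ins]) + 1 \<le> pot n p k (W, L, c)"
proof -
  have "lower n p (W, L, c) + 2 \<le> lower n p ins"
    unfolding ins_def by (rule lower_label[OF i U(2,1)]) (use loose single in auto)
  moreover obtain m where m: "pot n p k (W, L, c) = 1 + trib (m + 2) + trib (m + 1) + trib m"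
    and le: "\<And>N' g. \<lbrakk>lower n p (W, L, c) + g \<le> lower n p N'; g \<le> 3\<rbrakk> \<Longrightarrow> pot n p k N' \<le> trib (m + 3 - g)"
    using pot_branch[OF alive] by blast
  ultimately have "pot n p k ins \<le> trib (m + 1)" "pot n p k out \<le> trib (m + 2)"
    using le[of 2 ins] le[OF lower_out] by simp_all
  then show ?thesis using m by simp
qed

end

text \<open>\<open>maximal\<close> provides a second unit when any further vertex is added to
  \<open>U\<close>. \<open>largest\<close> ranges over the tight sets of all terminals, since the
  set that spoils the exclusion of \<open>U\<close> belongs to an opponent.\<close>

locale tight_branching = branching +
  assumes tight: "cut n W (cls n L i \<union> U) = lam n W L i + 1"
    and maximal: "\<And>Z. Z \<in> feas n L i \<Longrightarrow> cls n L i \<union> U \<subset> Z \<Longrightarrow> lam n W L i + 2 \<le> cut n W Z"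
    and largest: "\<And>j Y. \<lbrakk>j < p; Y \<in> feas n L j; cut n W Y = lam n W L j + 1;
        0 < between n W (cls n L j) (Y - cls n L j)\<rbrakk> \<Longrightarrow> card (Y - cls n L j) \<le> card U"
begin

definition children :: "node list" where
  "children = out # (if special then map via (filter (\<lambda>z. z \<in> nbrs) [0..<n]) else [ins])"

text \<open>Of the boundary of \<open>U\<close>, the part to \<open>S\<close> falls one short of the
  rest. All counting of neighbours below rests on this identity.\<close>

lemma cut_U: "cut n W U = 2 * between n W S U + 1"
  using cut_Un_disjoint[OF sym SU, of n] tight closed_at_lam[OF cl[OF i]] by simp

text \<open>If exclusion gained only one, \<open>gain_delete_tight\<close> would produce an
  opponent's tight set that takes all edges from \<open>S\<close> to \<open>U\<close>, and
  \<open>tight_opponent\<close> would turn it into a class with equal weight to \<open>U\<close>,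
  the second case of \<open>special\<close>.\<close>

lemma lower_out_plain:
  assumes "\<not> special"
  shows "lower n p (W, L, c) + 2 \<le> lower n p out"
proof (rule ccontr)
  assume "\<not> ?thesis"
  then have "(\<Sum>j<p. lam n (delete S U W) L j) + 2 * between n W S U \<le> (\<Sum>j<p. lam n W L j) + 1"
    by (simp add: out_def)
  moreover have ge2: "2 \<le> between n W S U" using assms adj by (simp add: special_def)
  ultimately obtain j Y where j: "j < p" "j \<noteq> i" and Y: "Y \<in> feas n L j"
    "cut n W Y = lam n W L j + 1" "between n W S (U - Y) = 0"
    using gain_delete_tight[OF sym cl i U] by metis
  have "between n W S U = between n W U (cls n L j)"
    by (rule tight_opponent[OF sym cl[OF i] cl[OF j(1)] j(2) feas_X U(2) tight ge2 Y largest[OF j(1)]])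
  then have special using j between_commute[OF sym] unfolding special_def by (metis le_refl)
  with assms show False by simp
qed

lemma nbrs_not_X: "z \<in> nbrs \<Longrightarrow> z \<notin> S \<union> U" "z \<in> nbrs \<Longrightarrow> z < n" "z \<in> nbrs \<Longrightarrow> L z = 0"
  by (auto simp: nbrs_def cls_def)

lemma between_nbrs_pos:
  assumes "y \<in> nbrs"
  shows "0 < between n W (S \<union> U) {y}"
proof -
  have "0 < between n W U {y}" using assms by (simp add: nbrs_def)
  then show ?thesis using between_mono[of U "S \<union> U" "{y}" "{y}" n W] by auto
qed

text \<open>Two units come from \<open>maximal\<close>, as \<open>z\<close> lies outside the tight
  set. If a smaller neighbour exists, the deleted weight is positive and \<open>gain_delete\<close>
  adds the third.\<close>

lemma lower_via:
  assumes z: "z \<in> nbrs"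
  shows "lower n p (W, L, c) + 2 + of_bool (\<exists>y\<in>nbrs. y < z) \<le> lower n p (via z)"
proof -
  let ?D = "{y \<in> nbrs. y < z}" and ?L = "label (insert z U) i L"
  have L0: "\<And>v. v \<in> insert z U \<Longrightarrow> L v = 0" using nbrs_not_X[OF z] U by auto
  have sub: "insert z U \<subseteq> {..<n}" using nbrs_not_X[OF z] U by auto
  have g: "lam n W L i + 2 \<le> cut n W Y" if "Y \<in> feas n L i" "insert z U \<subseteq> Y" for Y
    using that nbrs_not_X(1)[OF z] by (intro maximal) (auto simp: feas_def)
  show ?thesis
  proof (cases "?D = {}")
    case True
    have "delete (S \<union> U) {} W = W" by (intro ext) (simp add: delete_def)
    then have "via z = (W, ?L, c)" unfolding via_def True by (simp add: between_empty)
    then show ?thesis using lower_label[OF i L0 sub g] True by auto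
  next
    case False
    then obtain y where y: "y \<in> ?D" by blast
    have "0 < between n W (S \<union> U) {y}" using between_nbrs_pos y by blast
    then have pos: "0 < between n W (S \<union> U) ?D"
      using between_mono[of "S \<union> U" "S \<union> U" "{y}" ?D n W] y by auto
    have "(\<Sum>j<p. lam n W L j) + 2 + 1
      \<le> (\<Sum>j<p. lam n (delete (S \<union> U) ?D W) ?L j) + 2 * between n W (S \<union> U) ?D"
    proof (rule gain_delete[OF sym cl i _ _ _ _ _ pos])
      show "?L v = L v \<or> L v = 0 \<and> ?L v = Suc i" for v using L0 by (auto simp: label_def)
      show "S \<union> U \<subseteq> cls n ?L i" using U by (auto simp: cls_def label_def)
      show "?D \<subseteq> {..<n}" using nbrs_not_X by auto
      show "?L v = 0" if "v \<in> ?D" for v using that nbrs_not_X by (auto simp: label_def)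
      show "lam n W L i + 2 \<le> cut n W X" if "X \<in> feas n ?L i" for X
        using that g feas_label[where i = i and L = L, OF L0 sub] by blast
    qed
    then show ?thesis using y by (auto simp: via_def)
  qed
qed

text \<open>With \<open>a\<close> the weight from \<open>S\<close> to \<open>U\<close>, the boundary
  of \<open>U\<close> is \<open>2 * a + 1\<close>. Removing \<open>a\<close> leaves two if
  \<open>a = 1\<close>; removing another \<open>a\<close> or more for an opposing class leaves at
  most one. Every neighbour takes at least one.\<close>

lemma card_nbrs:
  assumes special
  shows "card nbrs \<le> 2"
proof -
  have fin: "finite nbrs" by (rule finite_subset[of _ "{..<n}"]) (auto simp: nbrs_def)
  have 1: "card nbrs \<le> between n W U nbrs"
    by (rule card_le_between[OF fin]) (simp add: nbrs_def)
  have SU': "between n W U S = between n W S U" by (rule between_commute[OF sym])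
  have *: "between n W U S + between n W U nbrs + between n W U (cls n L j) \<le> cut n W U"
    if "j \<noteq> i" for j
    unfolding wsum_defs wsum_add
    using SU nbrs_not_X U(2) that by (intro wsum_le_pointwise) (fastforce simp: of_bool_def cls_def)
  have **: "between n W U S + between n W U nbrs \<le> cut n W U"
    unfolding wsum_defs wsum_add
    using SU nbrs_not_X by (intro wsum_le_pointwise) (fastforce simp: of_bool_def)
  from assms consider "between n W S U = 1"
    | j where "j \<noteq> i" "between n W S U \<le> between n W (cls n L j) U"
    by (auto simp: special_def)
  then show ?thesis
  proof cases
    case 1
    then show ?thesis using ** \<open>card nbrs \<le> _\<close> SU' cut_U by linarith
  next
    case (2 j)
    then show ?thesis using *[OF 2(1)] \<open>card nbrs \<le> _\<close> SU' cut_U between_commute[OF sym, of n U "cls n L j"]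
      by linarith
  qed
qed

lemma decreasing: "sum_list (map (pot n p k) children) + 1 \<le> pot n p k (W, L, c)"
proof -
  obtain m where m: "pot n p k (W, L, c) = 1 + trib (m + 2) + trib (m + 1) + trib m"
    and le: "\<And>N' g. \<lbrakk>lower n p (W, L, c) + g \<le> lower n p N'; g \<le> 3\<rbrakk> \<Longrightarrow> pot n p k N' \<le> trib (m + 3 - g)"
    using pot_branch[OF alive] by blast
  show ?thesis
  proof (cases special)
    case False
    have "pot n p k ins \<le> trib (m + 2)" "pot n p k out \<le> trib (m + 1)"
      using le[OF lower_ins] le[OF lower_out_plain[OF False]] by simp_all
    then show ?thesis using m False by (simp add: children_def)
  next
    case True
    let ?zs = "filter (\<lambda>z. z \<in> nbrs) [0..<n]"
    have set: "set ?zs = nbrs" using nbrs_not_X by auto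
    have so: "sorted ?zs" "distinct ?zs" by (auto intro: sorted_wrt_filter)
    have "length ?zs \<le> 2" using card_nbrs[OF True] distinct_card[OF so(2)] set by simp
    then consider "?zs = []" | a where "?zs = [a]" | a b where "?zs = [a, b]"
      by (cases ?zs; cases "tl ?zs"; cases "tl (tl ?zs)") auto
    then have "sum_list (map (\<lambda>z. pot n p k (via z)) ?zs) \<le> trib (m + 1) + trib m"
    proof cases
      case 1
      then show ?thesis by (simp only: list.map sum_list.Nil le0)
    next
      case (2 a)
      then have "a \<in> nbrs" using set by auto
      then have "pot n p k (via a) \<le> trib (m + 1)" using le[of 2 "via a"] lower_via[of a] by simp
      then show ?thesis by (simp only: 2 list.map sum_list.Cons sum_list.Nil)
    next
      case (3 a b)
      then have ab: "a \<in> nbrs" "b \<in> nbrs" "a < b" using set so by (auto simp: less_le)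
      have "pot n p k (via a) \<le> trib (m + 1)" using le[of 2 "via a"] lower_via[OF ab(1)] by simp
      \<comment> \<open>The second case profits from the exclusion of \<open>a\<close> and hence
        gains three instead of two.\<close>
      moreover have "(\<exists>y\<in>nbrs. y < b)" using ab by blast
      then have "pot n p k (via b) \<le> trib m" using le[of 3 "via b"] lower_via[OF ab(2)] by simp
      ultimately show ?thesis by (simp only: 3 list.map sum_list.Cons sum_list.Nil)
    qed
    moreover have "pot n p k out \<le> trib (m + 2)" using le[OF lower_out] by simp
    ultimately show ?thesis using m True by (simp add: children_def o_def)
  qed
qed

lemma complete:
  assumes "solution n p k (W, L, c) f"
  shows "\<exists>N\<in>set children. \<exists>f. solution n p k N f"
proof -
  obtain f where f: "solution n p k (W, L, c) f"
    and sp: "(\<forall>v\<in>U. f v = i) \<or> (\<forall>v\<in>U. f v \<noteq> i)"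
    using solution_split[OF sym cl[OF i] i feas_X U(2) tight assms] by blast
  have out: "\<exists>N\<in>set children. \<exists>f. solution n p k N f"
    if "solution n p k (W, L, c) f" "\<And>v. v \<in> U \<Longrightarrow> f v \<noteq> i" for f
    using solution_out[OF that] by (auto simp: children_def)
  show ?thesis
  proof (cases "\<forall>v\<in>U. f v = i")
    case False
    then show ?thesis using out[OF f] sp by blast
  next
    case inU: True
    show ?thesis
    proof (cases special)
      case False
      then show ?thesis using solution_ins[OF f] inU by (auto simp: children_def)
    next
      case True
      show ?thesis
      proof (cases "\<exists>z\<in>nbrs. f z = i")
        case ex: True
        \<comment> \<open>The smallest neighbour on side \<open>i\<close> selects the case of
          \<open>via\<close> to which \<open>f\<close> belongs.\<close>
        define z where "z = (LEAST z. z \<in> nbrs \<and> f z = i)"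
        have z: "z \<in> nbrs" "f z = i" using ex LeastI_ex[of "\<lambda>z. z \<in> nbrs \<and> f z = i"] by (auto simp: z_def)
        have before: "f y \<noteq> i" if "y \<in> nbrs" "y < z" for y
          using that not_less_Least unfolding z_def by blast
        have "solution n p k (W, label (insert z U) i L, c) f"
          using inU z by (intro solution_label[OF f]) auto
        then have "solution n p k (via z) f"
          unfolding via_def
        proof (rule solution_delete[OF sym, rotated 2])
          show "(S \<union> U) \<inter> {y \<in> nbrs. y < z} = {}" using nbrs_not_X by blast
          fix u y assume "u \<in> S \<union> U" "y \<in> {y \<in> nbrs. y < z}"
          moreover from this have "f u = i" using inU f by (auto simp: compatible_def cls_def)
          ultimately show "f u \<noteq> f y" using before[of y] by simp
        qed
        moreover have "via z \<in> set children" using z nbrs_not_X True by (auto simp: children_def)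
        ultimately show ?thesis by blast
      next
        case none: False
        have nb: "f z \<noteq> i" if "u \<in> U" "z < n" "0 < W u z" "z \<notin> S \<union> U" for u z
        proof
          assume "f z = i"
          then have "L z = 0" using f that by (auto simp: compatible_def cls_def)
          moreover have "0 < between n W U {z}" using that U by (intro between_pos) auto
          ultimately have "z \<in> nbrs" using that by (simp add: nbrs_def)
          with none \<open>f z = i\<close> show False by blast
        qed
        have "\<exists>j<p. j \<noteq> i \<and> between n W S U \<le> between n W U (fiber n f j)"
        proof (cases "between n W S U = 1")
          case a1: True
          \<comment> \<open>Here the boundary of \<open>U\<close> is three and only one of it goes
            to \<open>S\<close>, so some edge leaves \<open>S \<union> U\<close>. Its other end is
            on a side \<open>j\<close> different from \<open>i\<close>, and weight one there already
            balances the move.\<close>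
          have "cut n W U \<le> between n W U S + between n W U ({..<n} - (S \<union> U))"
            unfolding wsum_defs wsum_add by (rule wsum_le_pointwise) (auto simp: of_bool_def)
          then have "0 < between n W U ({..<n} - (S \<union> U))"
            using cut_U a1 between_commute[OF sym, of n U S] by linarith
          then obtain u z where uz: "u < n" "z < n" "u \<in> U" "z \<notin> S \<union> U" "0 < W u z"
            by (metis DiffD2 between_pos_obtains)
          have "0 < between n W U (fiber n f (f z))"
            using uz by (intro between_pos[of u n z]) (auto simp: fiber_def)
          moreover have "f z < p" using f uz by (auto simp: compatible_def)
          ultimately show ?thesis using nb uz a1 by (intro exI[of _ "f z"]) auto
        next
          case False
          with True obtain j where j: "j < p" "j \<noteq> i" "between n W S U \<le> between n W (cls n L j) U"
            by (auto simp: special_def)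
          have "cls n L j \<subseteq> fiber n f j" using f by (auto simp: compatible_def cls_def fiber_def)
          then have "between n W U (cls n L j) \<le> between n W U (fiber n f j)"
            by (intro between_mono) auto
          then show ?thesis using j between_commute[OF sym, of n U "cls n L j"] by auto
        qed
        then obtain j where j: "j < p" "j \<noteq> i" "between n W S U \<le> between n W U (fiber n f j)" by blast
        have "solution n p k (W, L, c) (\<lambda>v. if v \<in> U then j else f v)"
          using inU by (intro solution_move[OF sym j(1,2) feas_X U(2) f _ nb j(3)]) auto
        then show ?thesis by (rule out) (use j in auto)
      qed
    qed
  qed
qed

end

text \<open>Truncated subtraction sends unlabelled vertices to the part of the first terminal. If
  the ends of an edge get different parts, one of them has a label above one, so the edge lies on
  the boundary of that class. The factor two stems from the two directions.\<close>

lemma default_cost: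
  assumes sym: "symmetric W" and cl: "\<And>j. j < p \<Longrightarrow> closed_at n W L j" and Lp: "\<And>v. L v \<le> p"
  shows "cost2 n W (\<lambda>v. L v - 1) \<le> 2 * (\<Sum>i<p. lam n W L i)"
proof -
  have "cost2 n W (\<lambda>v. L v - 1) \<le> (\<Sum>i<p. 2 * cut n W (cls n L i))"
    unfolding wsum_defs wsum_double wsum_sum
  proof (rule wsum_le[OF sym])
    fix u v assume uv: "u < n" "v < n"
    have *: "2 * of_bool (L u - 1 \<noteq> L v - 1 \<and> 1 < L u)
        \<le> (\<Sum>i<p. 2 * of_bool (u \<in> cls n L i \<and> v \<notin> cls n L i) :: nat)" if "u < n" for u v
    proof (cases "L u - 1 \<noteq> L v - 1 \<and> 1 < L u")
      case True
      have m: "L u - 1 \<in> {..<p}" using True Lp[of u] by auto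
      have "u \<in> cls n L (L u - 1)" "v \<notin> cls n L (L u - 1)" using True that by (auto simp: cls_def)
      then show ?thesis by (subst sum.remove[OF _ m]) auto
    qed auto
    show "of_bool (L u - 1 \<noteq> L v - 1) + of_bool (L v - 1 \<noteq> L u - 1)
      \<le> (\<Sum>i<p. 2 * of_bool (u \<in> cls n L i \<and> v \<notin> cls n L i)) +
         (\<Sum>i<p. 2 * of_bool (v \<in> cls n L i \<and> u \<notin> cls n L i) :: nat)"
      using *[OF uv(1), of v] *[OF uv(2), of u] by (auto simp: of_bool_def split: if_splits)
  qed
  also have "\<dots> = 2 * (\<Sum>i<p. lam n W L i)"
    using cl by (simp add: closed_at_lam sum_distrib_left)
  finally show ?thesis .
qed

text \<open>When no class has an unlabelled neighbour, each cut edge joins two classes and lies on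
  both boundaries, so the factor two disappears and the default assignment meets the lower
  bound.\<close>

lemma default_cost_separated:
  assumes sym: "symmetric W" and cl: "\<And>j. j < p \<Longrightarrow> closed_at n W L j" and Lp: "\<And>v. L v \<le> p"
    and sep: "\<And>i v. i < p \<Longrightarrow> v < n \<Longrightarrow> L v = 0 \<Longrightarrow> between n W (cls n L i) {v} = 0"
  shows "cost2 n W (\<lambda>v. L v - 1) \<le> (\<Sum>i<p. lam n W L i)"
proof -
  have "cost2 n W (\<lambda>v. L v - 1) \<le> (\<Sum>i<p. cut n W (cls n L i))"
    unfolding wsum_defs wsum_sum
  proof (rule wsum_le[OF sym])
    fix u v assume uv: "u < n" "v < n" "W u v \<noteq> 0"
    have sep': "L v \<noteq> 0" if "L u \<noteq> 0" "u < n" "v < n" "W u v \<noteq> 0" for u v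
    proof
      assume "L v = 0"
      then have "between n W (cls n L (L u - 1)) {v} = 0" using sep[of "L u - 1" v] Lp[of u] that by simp
      moreover have "0 < between n W (cls n L (L u - 1)) {v}"
        using that by (intro between_pos) (auto simp: cls_def)
      ultimately show False by simp
    qed
    have *: "of_bool (L u - 1 \<noteq> L v - 1)
        \<le> (\<Sum>i<p. of_bool (u \<in> cls n L i \<and> v \<notin> cls n L i) :: nat)"
      if "u < n" "L u \<noteq> 0" "L v \<noteq> 0" for u v
    proof (cases "L u - 1 \<noteq> L v - 1")
      case True
      have m: "L u - 1 \<in> {..<p}" using that Lp[of u] by auto
      have "u \<in> cls n L (L u - 1)" "v \<notin> cls n L (L u - 1)" using True that by (auto simp: cls_def)
      then show ?thesis by (subst sum.remove[OF _ m]) auto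
    qed auto
    have "W v u \<noteq> 0" using uv sym by (simp add: symmetric_def)
    then consider "L u \<noteq> 0" "L v \<noteq> 0" | "L u = 0" "L v = 0" using sep'[of u v] sep'[of v u] uv by blast
    then show "of_bool (L u - 1 \<noteq> L v - 1) + of_bool (L v - 1 \<noteq> L u - 1)
      \<le> (\<Sum>i<p. of_bool (u \<in> cls n L i \<and> v \<notin> cls n L i)) +
         (\<Sum>i<p. of_bool (v \<in> cls n L i \<and> u \<notin> cls n L i) :: nat)"
      by cases (use *[of u v] *[of v u] uv in auto)
  qed
  also have "\<dots> = (\<Sum>i<p. lam n W L i)" using cl by (simp add: closed_at_lam)
  finally show ?thesis .
qed

text \<open>The last conjunct is soundness relative to the original weights: any assignment
  evaluated in the node, plus the weight already cut, bounds its original cost. A leaf can thus be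
  output without undoing deletions.\<close>

definition valid :: "nat \<Rightarrow> nat list \<Rightarrow> (nat \<Rightarrow> nat \<Rightarrow> nat) \<Rightarrow> node \<Rightarrow> bool" where
  "valid n ts W\<^sub>0 = (\<lambda>(W, L, c). symmetric W \<and> (\<forall>v. L v \<le> length ts) \<and>
     (\<forall>i<length ts. L (ts ! i) = Suc i) \<and> (\<forall>f. cost2 n W\<^sub>0 f \<le> cost2 n W f + 2 * c))"

lemma valid_label:
  assumes "valid n ts W\<^sub>0 (W, L, c)" "i < length ts" "\<And>v. v \<in> X \<Longrightarrow> L v = 0 \<or> L v = Suc i"
  shows "valid n ts W\<^sub>0 (W, label X i L, c)"
proof -
  have "label X i L (ts ! j) = Suc j" if "j < length ts" for j
    using assms(1) assms(3)[of "ts ! j"] that by (auto simp: valid_def label_def)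
  then show ?thesis using assms(1,2) by (auto simp: valid_def label_def)
qed

lemma valid_delete:
  assumes "valid n ts W\<^sub>0 (W, L, c)"
  shows "valid n ts W\<^sub>0 (delete A B W, L, c + between n W A B)"
proof -
  have "cost2 n W\<^sub>0 f \<le> cost2 n (delete A B W) f + 2 * (c + between n W A B)" for f
  proof -
    have "cost2 n W\<^sub>0 f \<le> cost2 n W f + 2 * c" "symmetric W" using assms by (auto simp: valid_def)
    then show ?thesis using cost2_delete_le[of W n f A B] by simp
  qed
  then show ?thesis using assms by (auto simp: valid_def symmetric_delete)
qed

section \<open>Programs with bounded loops\<close>

definition setv :: "state \<Rightarrow> vname \<Rightarrow> nat \<Rightarrow> state" where
  "setv s x m = s\<lparr>var := (var s)(x := m)\<rparr>"

definition seta :: "state \<Rightarrow> vname \<Rightarrow> nat \<Rightarrow> nat \<Rightarrow> state" where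
  "seta s a j m = s\<lparr>arr := (arr s)(a := (arr s a)(j := m))\<rparr>"

lemma var_setv [simp]: "var (setv s x m) y = (if y = x then m else var s y)"
  and arr_setv [simp]: "arr (setv s x m) = arr s"
  and var_seta [simp]: "var (seta s a j m) = var s"
  and arr_seta [simp]: "arr (seta s a j m) b = (if b = a then (arr s a)(j := m) else arr s b)"
  by (simp_all add: setv_def seta_def)

text \<open>A sublanguage whose only loops are counting loops. It always terminates, so its meaning
  is a function and its running time has a bound depending only on the loop bounds; the only
  unbounded loop is the outer search.\<close>

datatype prog =
    PSkip
  | PAssign vname aexp
  | PStore vname aexp aexp
  | PSeq prog prog (infixr \<open>;;;\<close> 60)
  | PCond bexp prog prog
  | PFor vname vname prog

fun compile :: "prog \<Rightarrow> com" where
  "compile PSkip = Skip"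
| "compile (PAssign x e) = Assign x e"
| "compile (PStore a e f) = Store a e f"
| "compile (c ;;; d) = Seq (compile c) (compile d)"
| "compile (PCond b c d) = Cond b (compile c) (compile d)"
| "compile (PFor x y c) =
     Seq (Assign x (Const 0))
       (While (Less (Var x) (Var y)) (Seq (compile c) (Assign x (Plus (Var x) (Const 1)))))"

text \<open>The loop bound is read once, whereas the compiled loop rereads it in every test. The two
  agree as long as the body changes neither the bound nor the counter.\<close>

fun sem :: "prog \<Rightarrow> state \<Rightarrow> state" where
  "sem PSkip s = s"
| "sem (PAssign x e) s = setv s x (aval e s)"
| "sem (PStore a e f) s = seta s a (aval e s) (aval f s)"
| "sem (c ;;; d) s = sem d (sem c s)"
| "sem (PCond b c d) s = (if bval b s then sem c s else sem d s)"
| "sem (PFor x y c) s =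
     setv (fold (\<lambda>i s. sem c (setv s x i)) [0..<var s y] s) x (var s y)"

fun modv :: "prog \<Rightarrow> vname set" where
  "modv PSkip = {}"
| "modv (PAssign x e) = {x}"
| "modv (PStore a e f) = {}"
| "modv (c ;;; d) = modv c \<union> modv d"
| "modv (PCond b c d) = modv c \<union> modv d"
| "modv (PFor x y c) = insert x (modv c)"

fun moda :: "prog \<Rightarrow> vname set" where
  "moda PSkip = {}"
| "moda (PAssign x e) = {}"
| "moda (PStore a e f) = {a}"
| "moda (c ;;; d) = moda c \<union> moda d"
| "moda (PCond b c d) = moda c \<union> moda d"
| "moda (PFor x y c) = moda c"

fun bounds :: "prog \<Rightarrow> vname set" where
  "bounds (c ;;; d) = bounds c \<union> bounds d"
| "bounds (PCond b c d) = bounds c \<union> bounds d"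
| "bounds (PFor x y c) = insert y (bounds c)"
| "bounds _ = {}"

fun counters_ok :: "prog \<Rightarrow> bool" where
  "counters_ok (c ;;; d) \<longleftrightarrow> counters_ok c \<and> counters_ok d"
| "counters_ok (PCond b c d) \<longleftrightarrow> counters_ok c \<and> counters_ok d"
| "counters_ok (PFor x y c) \<longleftrightarrow> x \<notin> modv c \<and> counters_ok c"
| "counters_ok _ \<longleftrightarrow> True"

text \<open>In a loop, \<open>6\<close> is the initial assignment (2) plus the failing test (4), and
  \<open>8\<close> is a successful test (4) plus the increment (4). A conditional is charged for
  both branches.\<close>

fun ptime :: "prog \<Rightarrow> nat \<Rightarrow> nat" where
  "ptime PSkip N = 1"
| "ptime (PAssign x e) N = 1 + acost e"
| "ptime (PStore a e f) N = 1 + acost e + acost f"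
| "ptime (c ;;; d) N = ptime c N + ptime d N"
| "ptime (PCond b c d) N = 1 + bcost b + ptime c N + ptime d N"
| "ptime (PFor x y c) N = 6 + N * (ptime c N + 8)"

lemma frame_var: "x \<notin> modv c \<Longrightarrow> var (sem c s) x = var s x"
proof (induction c arbitrary: s)
  case (PFor z y c)
  have "var (fold (\<lambda>i s. sem c (setv s z i)) js s) x = var s x" for js
    using PFor by (induction js arbitrary: s) auto
  then show ?case using PFor.prems by simp
qed auto

lemma frame_arr: "a \<notin> moda c \<Longrightarrow> arr (sem c s) a = arr s a"
proof (induction c arbitrary: s)
  case (PFor z y c)
  have "arr (fold (\<lambda>i s. sem c (setv s z i)) js s) a = arr s a" for js
    using PFor by (induction js arbitrary: s) auto
  then show ?case by simp
qed auto

text \<open>The rule for loop invariants hands over the frame conditions of the body, so an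
  invariant has to mention only what the loop changes.\<close>

lemma For_induct:
  assumes "P 0 s"
    and step: "\<And>i s'. \<lbrakk>i < var s y; P i s'; \<And>z. z \<notin> insert x (modv c) \<Longrightarrow> var s' z = var s z;
      \<And>a. a \<notin> moda c \<Longrightarrow> arr s' a = arr s a\<rbrakk> \<Longrightarrow> P (Suc i) (sem c (setv s' x i))"
    and fin: "\<And>s'. \<lbrakk>P (var s y) s'; \<And>z. z \<notin> insert x (modv c) \<Longrightarrow> var s' z = var s z;
      \<And>a. a \<notin> moda c \<Longrightarrow> arr s' a = arr s a\<rbrakk> \<Longrightarrow> Q (setv s' x (var s y))"
  shows "Q (sem (PFor x y c) s)"
proof -
  let ?s = "\<lambda>m. fold (\<lambda>i s. sem c (setv s x i)) [0..<m] s"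
  have fv: "var (?s m) z = var s z" if "z \<notin> insert x (modv c)" for m z
    using that by (induction m) (auto simp: frame_var)
  have fa: "arr (?s m) a = arr s a" if "a \<notin> moda c" for m a
    using that by (induction m) (auto simp: frame_arr)
  have "P m (?s m)" if "m \<le> var s y" for m
    using that
  proof (induction m)
    case (Suc m)
    then have "P (Suc m) (sem c (setv (?s m) x m))" by (intro step fv fa) auto
    then show ?case by simp
  qed (simp add: assms(1))
  then show ?thesis unfolding sem.simps by (intro fin fv fa) auto
qed

lemma compile_exec:
  assumes "counters_ok c" "\<And>y. y \<in> bounds c \<Longrightarrow> y \<notin> modv c \<and> var s y \<le> N"
  shows "\<exists>t. exec (compile c) s t (sem c s) \<and> t \<le> ptime c N"
  using assms
proof (induction c arbitrary: s)
  case PSkip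
  show ?case using exec.Skip by auto
next
  case (PAssign x e)
  show ?case using exec.Assign by (auto simp: setv_def)
next
  case (PStore a e f)
  show ?case using exec.Store[of a e f s]
    by (intro exI[of _ "1 + acost e + acost f"]) (simp add: seta_def)
next
  case (PSeq c d)
  obtain t where t: "exec (compile c) s t (sem c s)" "t \<le> ptime c N"
    using PSeq.IH(1)[of s] PSeq.prems by auto
  have "y \<in> bounds d \<Longrightarrow> y \<notin> modv d \<and> var (sem c s) y \<le> N" for y
    using PSeq.prems(2)[of y] frame_var[of y c s] by auto
  then obtain t' where t': "exec (compile d) (sem c s) t' (sem d (sem c s))" "t' \<le> ptime d N"
    using PSeq.IH(2)[of "sem c s"] PSeq.prems(1) by auto
  show ?case using exec.Seq[OF t(1) t'(1)] t t' by (intro exI[of _ "t + t'"]) auto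
next
  case (PCond b c d)
  show ?case
  proof (cases "bval b s")
    case True
    obtain t where t: "exec (compile c) s t (sem c s)" "t \<le> ptime c N"
      using PCond.IH(1)[of s] PCond.prems by auto
    then show ?thesis using exec.CondTrue[OF True t(1)] True by (intro exI[of _ "1 + bcost b + t"]) auto
  next
    case False
    obtain t where t: "exec (compile d) s t (sem d s)" "t \<le> ptime d N"
      using PCond.IH(2)[of s] PCond.prems by auto
    then show ?thesis using exec.CondFalse[OF False t(1)] False by (intro exI[of _ "1 + bcost b + t"]) auto
  qed
next
  case (PFor x y c)
  let ?b = "Less (Var x) (Var y)"
  let ?d = "Seq (compile c) (Assign x (Plus (Var x) (Const 1)))"
  let ?f = "\<lambda>i s. sem c (setv s x i)"
  have x: "x \<notin> modv c" "counters_ok c" and y: "y \<notin> modv c" "y \<noteq> x"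
    using PFor.prems by auto
  \<comment> \<open>Generalised to the remaining iterations from \<open>i\<close> and to any state
    that agrees with \<open>s\<close> on the loop bounds, so that the induction can pass through one
    execution of the body.\<close>
  have loop: "\<exists>t. exec (While ?b ?d) (setv s' x i) t (setv (fold ?f [i..<var s y] s') x (var s y))
      \<and> t \<le> 4 + (var s y - i) * (ptime c N + 8)"
    if "i \<le> var s y" "\<And>z. z \<in> insert y (bounds c) \<Longrightarrow> var s' z = var s z" for i s'
    using that
  proof (induction "var s y - i" arbitrary: i s')
    case 0
    then have "i = var s y" by simp
    then show ?case using exec.WhileFalse[of ?b "setv s' x i" ?d] y 0 by auto
  next
    case (Suc m)
    then have lt: "i < var s y" by simp
    have b: "bval ?b (setv s' x i)" using lt y Suc.prems by simp
    have bs: "z \<notin> modv c \<and> var (setv s' x i) z \<le> N" if "z \<in> bounds c" for z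
      using PFor.prems(2)[of z] Suc.prems(2)[of z] that by auto
    obtain t where t: "exec (compile c) (setv s' x i) t (?f i s')" "t \<le> ptime c N"
      using PFor.IH[OF x(2) bs] by blast
    have "var (?f i s') x = i" using frame_var[OF x(1)] by simp
    then have step: "exec ?d (setv s' x i) (t + 4) (setv (?f i s') x (Suc i))"
      using exec.Seq[OF t(1) exec.Assign[of x "Plus (Var x) (Const 1)"]]
      by (simp add: setv_def numeral_eq_Suc)
    have fr: "var (?f i s') z = var s z" if "z \<in> insert y (bounds c)" for z
      using that Suc.prems(2)[OF that] PFor.prems(2)[of z] frame_var[of z c] by auto
    obtain t' where t': "exec (While ?b ?d) (setv (?f i s') x (Suc i)) t'
        (setv (fold ?f [Suc i..<var s y] (?f i s')) x (var s y))"
      "t' \<le> 4 + (var s y - Suc i) * (ptime c N + 8)"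
      using Suc.hyps(1)[OF _ Suc_leI[OF lt] fr] Suc.hyps(2) by fastforce
    have "fold ?f [i..<var s y] s' = fold ?f [Suc i..<var s y] (?f i s')"
      using lt by (simp add: upt_conv_Cons)
    moreover have "var s y - i = Suc (var s y - Suc i)" using lt by simp
    ultimately show ?case using exec.WhileTrue[OF b step t'(1)] t(2) t'(2)
      by (intro exI[of _ "1 + bcost ?b + (t + 4) + t'"]) auto
  qed
  obtain t where t: "exec (While ?b ?d) (setv s x 0) t (sem (PFor x y c) s)"
    "t \<le> 4 + var s y * (ptime c N + 8)"
    using loop[of 0 s] by auto
  have "var s y \<le> N" using PFor.prems(2)[of y] by simp
  then have "t \<le> 4 + N * (ptime c N + 8)" using t(2) by (meson add_left_mono le_trans mult_le_mono1)
  moreover have "exec (Assign x (Const 0)) s 2 (setv s x 0)"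
    using exec.Assign[of x "Const 0" s] by (simp add: setv_def numeral_2_eq_2)
  then have "exec (compile (PFor x y c)) s (2 + t) (sem (PFor x y c) s)"
    unfolding compile.simps by (rule exec.Seq) (rule t(1))
  ultimately show ?case by (intro exI[of _ "2 + t"]) simp
qed

text \<open>Each loop raises the degree by one, and degrees are added at branchings and sequences.
  The base \<open>Suc N\<close> is at least one, so powers are monotone in the exponent.\<close>

lemma ptime_polynomial: "\<exists>C d. \<forall>N. ptime c N \<le> C * Suc N ^ d"
proof (induction c)
  case (PSeq c1 c2)
  then obtain C d C' d' where *: "\<And>N. ptime c1 N \<le> C * Suc N ^ d" "\<And>N. ptime c2 N \<le> C' * Suc N ^ d'"
    by blast
  have "ptime (c1 ;;; c2) N \<le> (C + C') * Suc N ^ (d + d')" for N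
  proof -
    have "C * Suc N ^ d \<le> C * Suc N ^ (d + d')" "C' * Suc N ^ d' \<le> C' * Suc N ^ (d + d')"
      by (intro mult_le_mono2 power_increasing; simp)+
    then show ?thesis using *[of N] unfolding ptime.simps add_mult_distrib by linarith
  qed
  then show ?case by blast
next
  case (PCond b c1 c2)
  then obtain C d C' d' where *: "\<And>N. ptime c1 N \<le> C * Suc N ^ d" "\<And>N. ptime c2 N \<le> C' * Suc N ^ d'"
    by blast
  have "ptime (PCond b c1 c2) N \<le> ((1 + bcost b) + C + C') * Suc N ^ (d + d')" for N
  proof -
    have "C * Suc N ^ d \<le> C * Suc N ^ (d + d')" "C' * Suc N ^ d' \<le> C' * Suc N ^ (d + d')"
      by (intro mult_le_mono2 power_increasing; simp)+
    moreover have "(1 + bcost b) * 1 \<le> (1 + bcost b) * Suc N ^ (d + d')"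
      by (intro mult_le_mono2) simp
    ultimately show ?thesis using *[of N] unfolding ptime.simps add_mult_distrib by linarith
  qed
  then show ?case by blast
next
  case (PFor x y c)
  then obtain C d where *: "\<And>N. ptime c N \<le> C * Suc N ^ d" by blast
  have "ptime (PFor x y c) N \<le> (C + 14) * Suc N ^ Suc d" for N
  proof -
    have "N * ptime c N \<le> Suc N * (C * Suc N ^ d)" using * by (intro mult_le_mono) auto
    then have "N * ptime c N \<le> C * Suc N ^ Suc d" by (simp only: power_Suc mult.left_commute)
    moreover have "Suc N \<le> Suc N ^ Suc d"
      using self_le_power[of "Suc N" "Suc d"] by (simp del: power_Suc)
    ultimately show ?thesis unfolding ptime.simps add_mult_distrib add_mult_distrib2 by linarith
  qed
  then show ?case by blast
next
  case PSkip
  show ?case by (intro exI[of _ 1] exI[of _ 0]) simp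
next
  case (PAssign x e)
  show ?case by (intro exI[of _ "1 + acost e"] exI[of _ 0]) simp
next
  case (PStore a e f)
  show ?case by (intro exI[of _ "1 + acost e + acost f"] exI[of _ 0]) simp
qed

lemma while_exec:
  assumes "Inv s"
    and step: "\<And>s. Inv s \<Longrightarrow> bval b s \<Longrightarrow>
      Inv (sem c s) \<and> meas (sem c s) < (meas s :: nat) \<and> (\<exists>t. exec (compile c) s t (sem c s) \<and> t \<le> B)"
  shows "\<exists>t s'. exec (While b (compile c)) s t s' \<and> Inv s' \<and> \<not> bval b s' \<and>
    t \<le> Suc (meas s) * (1 + bcost b + B)"
  using assms(1)
proof (induction "meas s" arbitrary: s rule: less_induct)
  case less
  show ?case
  proof (cases "bval b s")
    case False
    then show ?thesis using exec.WhileFalse[OF False] less.prems by fastforce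
  next
    case True
    from step[OF less.prems True] obtain t where t: "Inv (sem c s)" "meas (sem c s) < meas s"
      "exec (compile c) s t (sem c s)" "t \<le> B" by blast
    from less.hyps[OF t(2) t(1)] obtain t' s' where t': "exec (While b (compile c)) (sem c s) t' s'"
      "Inv s'" "\<not> bval b s'" "t' \<le> Suc (meas (sem c s)) * (1 + bcost b + B)" by blast
    have "Suc (meas (sem c s)) * (1 + bcost b + B) \<le> meas s * (1 + bcost b + B)"
      using t(2) by (intro mult_le_mono1) simp
    then show ?thesis using exec.WhileTrue[OF True t(3) t'(1)] t t'
      by (intro exI[of _ "1 + bcost b + t + t'"]) auto
  qed
qed

section \<open>Matrices and marks in memory\<close>

definition eqb :: "aexp \<Rightarrow> aexp \<Rightarrow> bexp" where
  "eqb e f = Conj (Neg (Less e f)) (Neg (Less f e))"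

lemma bval_eqb [simp]: "bval (eqb e f) s \<longleftrightarrow> aval e s = aval f s"
  by (auto simp: eqb_def)

abbreviation posb :: "aexp \<Rightarrow> bexp" where
  "posb \<equiv> Less (Const 0)"

abbreviation cell :: "vname \<Rightarrow> vname \<Rightarrow> aexp" where
  "cell x y \<equiv> Plus (Get ''r'' (Var x)) (Var y)"

abbreviation lab :: aexp where
  "lab \<equiv> Get ''C'' (Plus (Var ''nn'') (Var ''x''))"

abbreviation spent :: aexp where
  "spent \<equiv> Plus (Var ''nn'') (Var ''n'')"

text \<open>
  \<open>''C''\<close> holds the current node: the weights row by row, the labels from \<open>''nn'' = n * n\<close> on, and the
  weight already cut. \<open>''r''\<close> tabulates the row offsets \<open>u * n\<close>, as the machine cannot multiply.
  \<open>''R''\<close> bounds the number of augmentations: a cut of weight \<open>2 * k + 2\<close> is never of interest.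
\<close>

definition env :: "nat \<Rightarrow> nat \<Rightarrow> nat \<Rightarrow> state \<Rightarrow> bool" where
  "env n p k s \<longleftrightarrow> var s ''n'' = n \<and> var s ''p'' = p \<and> var s ''nn'' = n * n \<and>
     var s ''fs'' = n * n + n + 1 \<and> var s ''R'' = 2 * k + 2 \<and> var s ''K'' = 2 * k \<and>
     (\<forall>u<n. arr s ''r'' u = u * n)"

lemma envD:
  assumes "env n p k s"
  shows "var s ''n'' = n" "var s ''p'' = p" "var s ''nn'' = n * n"
    "var s ''fs'' = n * n + n + 1" "var s ''R'' = 2 * k + 2" "var s ''K'' = 2 * k"
    "\<And>u. u < n \<Longrightarrow> arr s ''r'' u = u * n"
  using assms by (auto simp: env_def)

abbreviation envvars :: "vname set" where
  "envvars \<equiv> {''n'', ''p'', ''nn'', ''fs'', ''R'', ''K''}"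

lemma env_cong:
  assumes "env n p k s" "\<And>z. z \<in> envvars \<Longrightarrow> var s' z = var s z" "arr s' ''r'' = arr s ''r''"
  shows "env n p k s'"
  using assms(1) assms(2)[of "''n''"] assms(2)[of "''p''"] assms(2)[of "''nn''"] assms(2)[of "''fs''"]
    assms(2)[of "''R''"] assms(2)[of "''K''"] assms(3) by (simp add: env_def)

definition keeps_env :: "prog \<Rightarrow> bool" where
  "keeps_env c \<longleftrightarrow> modv c \<inter> envvars = {} \<and> ''r'' \<notin> moda c"

lemma env_sem: "keeps_env c \<Longrightarrow> env n p k s \<Longrightarrow> env n p k (sem c s)"
  by (erule env_cong) (auto simp: keeps_env_def intro!: frame_var frame_arr)

lemma env_setv: "z \<notin> envvars \<Longrightarrow> env n p k (setv s z m) \<longleftrightarrow> env n p k s"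
  by (auto simp: env_def)

lemma env_seta: "a \<noteq> ''r'' \<Longrightarrow> env n p k (seta s a j m) \<longleftrightarrow> env n p k s"
  by (auto simp: env_def)

text \<open>Entries outside the range are set to zero so that equality of nodes is plain equality of
  functions, independent of unrelated memory cells.\<close>

definition Wt :: "nat \<Rightarrow> (nat \<Rightarrow> nat) \<Rightarrow> nat \<Rightarrow> nat \<Rightarrow> nat" where
  "Wt n g u v = (if u < n \<and> v < n then g (u * n + v) else 0)"

definition Lt :: "nat \<Rightarrow> (nat \<Rightarrow> nat) \<Rightarrow> nat \<Rightarrow> nat" where
  "Lt n g v = (if v < n then g (n * n + v) else 0)"

definition node_of :: "nat \<Rightarrow> (nat \<Rightarrow> nat) \<Rightarrow> node" where
  "node_of n g = (Wt n g, Lt n g, g (n * n + n))"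

lemma cell_less: "u < n \<Longrightarrow> v < n \<Longrightarrow> u * n + v < n * (n :: nat)"
  by (metis add_less_cancel_left less_le_trans mult.commute mult_Suc_right mult_le_mono2 Suc_leI add.commute)

lemma cell_inj:
  assumes "v < n" "v' < (n :: nat)"
  shows "u * n + v = u' * n + v' \<longleftrightarrow> u = u' \<and> v = v'"
proof
  assume "u * n + v = u' * n + v'"
  then have "(u * n + v) div n = (u' * n + v') div n" "(u * n + v) mod n = (u' * n + v') mod n" by simp_all
  then show "u = u' \<and> v = v'" using assms by simp
qed simp

lemma node_of_cong: "(\<And>q. q < n * n + n + 1 \<Longrightarrow> g q = h q) \<Longrightarrow> node_of n g = node_of n h"
  using cell_less[of _ n] by (auto simp: node_of_def Wt_def Lt_def fun_eq_iff intro!: less_SucI trans_less_add1)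

lemma Wt_upd_cell: "x < n \<Longrightarrow> y < n \<Longrightarrow>
    Wt n (g(x * n + y := m)) = (\<lambda>u v. if u = x \<and> v = y then m else Wt n g u v)"
  by (auto simp: Wt_def fun_eq_iff cell_inj)

lemma Lt_upd_cell: "x < n \<Longrightarrow> y < n \<Longrightarrow> Lt n (g(x * n + y := m)) = Lt n g"
  using cell_less[of x n y] by (auto simp: Lt_def fun_eq_iff)

lemma Wt_upd_high: "n * n \<le> q \<Longrightarrow> Wt n (g(q := m)) = Wt n g"
  using cell_less by (fastforce simp: Wt_def fun_eq_iff)

lemma Lt_upd_lab: "x < n \<Longrightarrow> Lt n (g(n * n + x := m)) = (Lt n g)(x := m)"
  by (auto simp: Lt_def fun_eq_iff)

lemma Lt_upd_spent: "Lt n (g(n * n + n := m)) = Lt n g"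
  by (auto simp: Lt_def fun_eq_iff)

definition marks :: "nat \<Rightarrow> (nat \<Rightarrow> nat) \<Rightarrow> nat set" where
  "marks n g = {x. x < n \<and> g x \<noteq> 0}"

definition mark :: "vname \<Rightarrow> bexp \<Rightarrow> prog" where
  "mark a b = PFor ''x'' ''n'' (PCond b (PStore a (Var ''x'') (Const 1)) (PStore a (Var ''x'') (Const 0)))"

lemma modv_mark [simp]: "modv (mark a b) = {''x''}"
  and moda_mark [simp]: "moda (mark a b) = {a}"
  and bounds_mark [simp]: "bounds (mark a b) = {''n''}"
  and counters_ok_mark [simp]: "counters_ok (mark a b)"
  by (auto simp: mark_def)

lemma mark:
  assumes "var s ''n'' = n"
    and "\<And>s' x. \<lbrakk>x < n; var s' ''x'' = x; \<And>z. z \<noteq> ''x'' \<Longrightarrow> var s' z = var s z;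
       \<And>a'. a' \<noteq> a \<Longrightarrow> arr s' a' = arr s a'\<rbrakk> \<Longrightarrow> bval b s' \<longleftrightarrow> G x"
  shows "marks n (arr (sem (mark a b) s) a) = {x. x < n \<and> G x}"
    and "x < n \<Longrightarrow> arr (sem (mark a b) s) a x = of_bool (G x)"
proof -
  have *: "\<forall>x<n. arr (sem (mark a b) s) a x = of_bool (G x)"
    unfolding mark_def
  proof (rule For_induct[where P = "\<lambda>i s'. \<forall>x<i. arr s' a x = of_bool (G x)"], goal_cases)
    case (2 i s')
    have "bval b (setv s' ''x'' i) \<longleftrightarrow> G i"
      using 2 assms(1) by (intro assms(2)) auto
    then show ?case using 2 by (auto simp: less_Suc_eq)
  qed (use assms(1) in auto)
  then show "marks n (arr (sem (mark a b) s) a) = {x. x < n \<and> G x}" by (auto simp: marks_def)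
  show "x < n \<Longrightarrow> arr (sem (mark a b) s) a x = of_bool (G x)" using * by blast
qed

definition dsum :: "bexp \<Rightarrow> prog" where
  "dsum b = PFor ''x'' ''n'' (PFor ''y'' ''n''
     (PCond b (PAssign ''a'' (Plus (Var ''a'') (Get ''C'' (cell ''x'' ''y'')))) PSkip))"

lemma modv_dsum [simp]: "modv (dsum b) = {''x'', ''y'', ''a''}"
  and moda_dsum [simp]: "moda (dsum b) = {}"
  and bounds_dsum [simp]: "bounds (dsum b) = {''n''}"
  and counters_ok_dsum [simp]: "counters_ok (dsum b)"
  by (auto simp: dsum_def)

lemma dsum:
  assumes env: "env n p k s"
    and b: "\<And>s' u v. \<lbrakk>u < n; v < n; var s' ''x'' = u; var s' ''y'' = v; arr s' = arr s;
       \<And>z. z \<notin> {''x'', ''y'', ''a''} \<Longrightarrow> var s' z = var s z\<rbrakk> \<Longrightarrow> bval b s' \<longleftrightarrow> G u v"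
  shows "var (sem (dsum b) s) ''a'' = var s ''a'' + wsum n (Wt n (arr s ''C'')) (\<lambda>u v. of_bool (G u v))"
proof -
  let ?t = "\<lambda>u v. of_bool (G u v) * Wt n (arr s ''C'') u v"
  note e = envD[OF env]
  show ?thesis
    unfolding dsum_def wsum_def
  proof (rule For_induct[where P = "\<lambda>i s'. var s' ''a'' = var s ''a'' + (\<Sum>u<i. \<Sum>v<n. ?t u v)"], goal_cases)
    case (2 i s')
    have arr: "arr s' = arr s" using 2(4) by (intro ext) auto
    have i: "i < n" using 2(1) e by simp
    show ?case
    proof (rule For_induct[where P = "\<lambda>j s''. var s'' ''a'' = var s ''a'' + (\<Sum>u<i. \<Sum>v<n. ?t u v) + (\<Sum>v<j. ?t i v)"], goal_cases)
      case 1
      then show ?case using 2 by simp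
    next
      case (2 j s'')
      note inner = 2
      have j: "j < n" using inner(1) \<open>\<And>z. z \<notin> insert ''x'' _ \<Longrightarrow> var s' z = _\<close> e by simp
      have arr'': "arr s'' = arr s" using inner(4) arr by (intro ext) auto
      have "bval b (setv s'' ''y'' j) \<longleftrightarrow> G i j"
        using i j arr'' inner(3) \<open>\<And>z. z \<notin> insert ''x'' _ \<Longrightarrow> var s' z = _\<close> by (intro b) auto
      then show ?case using inner(2,3) i j arr'' e by (simp add: Wt_def)
    next
      case (3 s'')
      have "var s' ''n'' = n" using 2(3) e by simp
      then show ?case using 3 by simp
    qed
  next
    case (3 s')
    then show ?case using e by simp
  qed simp
qed

definition sumw :: prog where
  "sumw = PAssign ''a'' (Const 0) ;;;
     dsum (Conj (posb (Get ''P'' (Var ''x''))) (posb (Get ''Q'' (Var ''y''))))"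

lemma modv_sumw [simp]: "modv sumw = {''x'', ''y'', ''a''}"
  and moda_sumw [simp]: "moda sumw = {}"
  and bounds_sumw [simp]: "bounds sumw = {''n''}"
  and counters_ok_sumw [simp]: "counters_ok sumw"
  by (auto simp: sumw_def)

lemma sumw:
  assumes "env n p k s"
  shows "var (sem sumw s) ''a'' =
    between n (Wt n (arr s ''C'')) (marks n (arr s ''P'')) (marks n (arr s ''Q''))"
proof -
  have "env n p k (setv s ''a'' 0)" using assms by (simp add: env_setv)
  from dsum[OF this, where G = "\<lambda>u v. u \<in> marks n (arr s ''P'') \<and> v \<in> marks n (arr s ''Q'')"]
  show ?thesis by (simp add: sumw_def between_def marks_def)
qed

definition del :: prog where
  "del = PFor ''x'' ''n'' (PFor ''y'' ''n''
     (PCond (Conj (posb (Get ''P'' (Var ''x''))) (posb (Get ''Q'' (Var ''y''))))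
       (PStore ''C'' spent (Plus (Get ''C'' spent) (Get ''C'' (cell ''x'' ''y''))) ;;;
        PStore ''C'' (cell ''x'' ''y'') (Const 0) ;;;
        PStore ''C'' (cell ''y'' ''x'') (Const 0)) PSkip))"

lemma modv_del [simp]: "modv del = {''x'', ''y''}"
  and moda_del [simp]: "moda del = {''C''}"
  and bounds_del [simp]: "bounds del = {''n''}"
  and counters_ok_del [simp]: "counters_ok del"
  by (auto simp: del_def)

lemma del:
  assumes env: "env n p k s"
    and C: "node_of n (arr s ''C'') = (W, L, c)"
    and P: "marks n (arr s ''P'') = P" and Q: "marks n (arr s ''Q'') = Q" and disj: "P \<inter> Q = {}"
  shows "node_of n (arr (sem del s) ''C'') = (delete P Q W, L, c + between n W P Q)"
proof -
  note e = envD[OF env]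
  \<comment> \<open>\<open>Z i j\<close> collects the pairs of \<open>P\<close> and \<open>Q\<close>
    treated before \<open>(i, j)\<close>; \<open>D\<close> zeroes such pairs in both directions,
    which is the matrix in memory at that moment.\<close>
  define Z where "Z i j = {(u, v). (u < i \<or> u = i \<and> v < j) \<and> u \<in> P \<and> v \<in> Q}" for i j :: nat
  define D where "D Y u v = (if (u, v) \<in> Y \<or> (v, u) \<in> Y then 0 else W u v)" for Y and u v :: nat
  define W' where "W' i j = D (Z i j)" for i j
  let ?t = "\<lambda>u v. of_bool (u \<in> P \<and> v \<in> Q) * W u v"
  have PQ: "\<And>x. x < n \<Longrightarrow> arr s ''P'' x \<noteq> 0 \<longleftrightarrow> x \<in> P" "\<And>x. x < n \<Longrightarrow> arr s ''Q'' x \<noteq> 0 \<longleftrightarrow> x \<in> Q"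
    using P Q by (auto simp: marks_def)
  have lt: "\<And>x. x \<in> P \<Longrightarrow> x < n" "\<And>x. x \<in> Q \<Longrightarrow> x < n"
    using P Q by (auto simp: marks_def)
  show ?thesis
    unfolding del_def
  proof (rule For_induct[where P = "\<lambda>i s'. node_of n (arr s' ''C'') =
      (W' i 0, L, c + (\<Sum>u<i. \<Sum>v<n. ?t u v))"], goal_cases)
    case 1
    have "Z 0 0 = {}" by (simp add: Z_def)
    then have "W' 0 0 = W" unfolding W'_def D_def by simp
    then show ?case using C by simp
  next
    case (2 i s')
    note outer = 2
    have i: "i < n" using outer(1) e by simp
    have "Z i n = Z (Suc i) 0" using lt by (auto simp: Z_def less_Suc_eq)
    then have Wn: "W' i n = W' (Suc i) 0" by (simp only: W'_def)
    show ?case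
    proof (rule For_induct[where P = "\<lambda>j s''. node_of n (arr s'' ''C'') =
      (W' i j, L, c + (\<Sum>u<i. \<Sum>v<n. ?t u v) + (\<Sum>v<j. ?t i v))"], goal_cases)
      case 1
      then show ?case using outer by simp
    next
      case (2 j s'')
      have j: "j < n" using 2(1) outer(3) e by simp
      have st: "var s'' ''x'' = i" "var s'' ''n'' = n" "var s'' ''nn'' = n * n"
        "arr s'' ''P'' = arr s ''P''" "arr s'' ''Q'' = arr s ''Q''" "arr s'' ''r'' = arr s ''r''"
        using 2(3,4) outer(3,4) e by auto
      have Wc: "Wt n (arr s'' ''C'') = W' i j" "Lt n (arr s'' ''C'') = L"
        "arr s'' ''C'' (n * n + n) = c + (\<Sum>u<i. \<Sum>v<n. ?t u v) + (\<Sum>v<j. ?t i v)"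
        using 2(2) by (simp_all add: node_of_def)
      have b: "(0 < arr s ''P'' i \<and> 0 < arr s ''Q'' j) \<longleftrightarrow> i \<in> P \<and> j \<in> Q"
        using PQ(1)[OF i] PQ(2)[OF j] by simp
      show ?case
      proof (cases "i \<in> P \<and> j \<in> Q")
        case True
        \<comment> \<open>Disjointness ensures that no earlier mirrored store has erased this cell,
          so the weight added to the total is the original one and each edge is counted
          once.\<close>
        have "j \<notin> P" using True disj by blast
        then have "(i, j) \<notin> Z i j" "(j, i) \<notin> Z i j" by (auto simp: Z_def)
        then have "W' i j i j = W i j" by (simp add: W'_def D_def)
        then have Wij: "arr s'' ''C'' (i * n + j) = W i j"
          using fun_cong[OF fun_cong[OF Wc(1)], of i j] i j by (simp add: Wt_def)
        have hi: "i * n + j \<noteq> n * n + n" "j * n + i \<noteq> n * n + n"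
          using cell_less[OF i j] cell_less[OF j i] by auto
        have WW: "(\<lambda>u v. if u = j \<and> v = i then 0 else if u = i \<and> v = j then 0 else W' i j u v) = W' i (Suc j)"
        proof -
          have "Z i (Suc j) = insert (i, j) (Z i j)" using True by (auto simp: Z_def less_Suc_eq)
          then show ?thesis by (simp only: W'_def) (auto simp only: D_def fun_eq_iff insert_iff prod.inject split: if_split)
        qed
        have "Wt n ((arr s'' ''C'')(n * n + n := m, i * n + j := 0, j * n + i := 0)) = W' i (Suc j)" for m
          by (simp add: Wt_upd_cell[OF i j] Wt_upd_cell[OF j i] Wt_upd_high Wc WW cong del: if_weak_cong)
        then show ?thesis using True b st e i j hi Wc Wij
          by (simp add: node_of_def Lt_upd_cell Lt_upd_spent)
      next
        case False
        have "Z i (Suc j) = Z i j" using False by (auto simp: Z_def less_Suc_eq)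
        then have "W' i (Suc j) = W' i j" by (simp only: W'_def)
        then show ?thesis using False b st 2(2) by (cases "i \<in> P") auto
      qed
    next
      case (3 s'')
      have "var s' ''n'' = n" using outer(3) e by simp
      then show ?case using 3 by (simp add: Wn)
    qed
  next
    case (3 s')
    have "Z n 0 = P \<times> Q" using lt by (auto simp: Z_def)
    then have "W' n 0 = delete P Q W" by (auto simp: W'_def D_def delete_def fun_eq_iff)
    then show ?case using 3 e by (simp add: between_def wsum_def)
  qed
qed

section \<open>Minimum cuts by augmenting paths\<close>

lemma sum_remove_lessThan: "x < n \<Longrightarrow> (\<Sum>u<n. R u) = R x + (\<Sum>u\<in>{..<n} - {x}. R u :: nat)" for x n :: nat
  by (rule sum.remove) auto

lemma wsum_upd:
  assumes "x < n" "y < n"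
  shows "wsum n (\<lambda>u v. if u = x \<and> v = y then m else W u v) g + g x y * W x y = wsum n W g + g x y * m"
proof -
  let ?W = "\<lambda>u v. if u = x \<and> v = y then m else W u v"
  have "(\<Sum>v\<in>{..<n} - {y}. g x v * ?W x v) = (\<Sum>v\<in>{..<n} - {y}. g x v * W x v)"
    by (rule sum.cong) auto
  then have row: "(\<Sum>v<n. g x v * ?W x v) + g x y * W x y = (\<Sum>v<n. g x v * W x v) + g x y * m"
    using sum_remove_lessThan[OF assms(2), of "\<lambda>v. g x v * ?W x v"]
      sum_remove_lessThan[OF assms(2), of "\<lambda>v. g x v * W x v"] by simp
  have "(\<Sum>u\<in>{..<n} - {x}. \<Sum>v<n. g u v * ?W u v) = (\<Sum>u\<in>{..<n} - {x}. \<Sum>v<n. g u v * W u v)"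
    by (intro sum.cong) auto
  then show ?thesis
    unfolding wsum_def using row sum_remove_lessThan[OF assms(1), of "\<lambda>u. \<Sum>v<n. g u v * ?W u v"]
      sum_remove_lessThan[OF assms(1), of "\<lambda>u. \<Sum>v<n. g u v * W u v"] by linarith
qed

definition push :: "nat \<Rightarrow> nat \<Rightarrow> (nat \<Rightarrow> nat \<Rightarrow> nat) \<Rightarrow> nat \<Rightarrow> nat \<Rightarrow> nat" where
  "push x y W u v = (if u = x \<and> v = y then W x y - 1 else if u = y \<and> v = x then Suc (W y x) else W u v)"

text \<open>Pushing changes a residual cut only by its membership of the two ends. Along a path the
  changes telescope, so max-flow min-cut can be argued with residual cuts alone and without a flow
  function.\<close>

lemma cut_push:
  assumes "x < n" "y < n" "x \<noteq> y" "0 < W x y"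
  shows "cut n (push x y W) X + of_bool (x \<in> X) = cut n W X + of_bool (y \<in> X)"
proof -
  let ?W = "\<lambda>u v. if u = x \<and> v = y then W x y - 1 else W u v"
  have 1: "push x y W = (\<lambda>u v. if u = y \<and> v = x then Suc (W y x) else ?W u v)"
    using assms(3) by (auto simp: push_def fun_eq_iff)
  let ?g = "\<lambda>u v. of_bool (u \<in> X \<and> v \<notin> X) :: nat"
  have "wsum n (push x y W) ?g + ?g y x * W y x = wsum n ?W ?g + ?g y x * Suc (W y x)"
    using wsum_upd[of y n x "Suc (W y x)" ?W ?g] assms unfolding 1 by simp
  moreover have "wsum n ?W ?g + ?g x y * W x y = wsum n W ?g + ?g x y * (W x y - 1)"
    using wsum_upd[of x n y "W x y - 1" W ?g] assms by simp
  ultimately show ?thesis using assms(4) unfolding cut_def by (auto simp: of_bool_def split: if_splits)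
qed

text \<open>Backward breadth-first search from the sink set \<open>B\<close>: \<open>M\<close> is
  one plus the number of arcs to \<open>B\<close> along \<open>nx\<close>, and \<open>0\<close>
  means unreached. Layers start at one to keep \<open>0\<close> free.\<close>

definition layered :: "nat \<Rightarrow> nat set \<Rightarrow> (nat \<Rightarrow> nat \<Rightarrow> nat) \<Rightarrow> (nat \<Rightarrow> nat) \<Rightarrow> (nat \<Rightarrow> nat) \<Rightarrow> bool" where
  "layered n B W M nx \<longleftrightarrow> (\<forall>x<n. (x \<in> B \<longrightarrow> M x = 1) \<and> (x \<notin> B \<longrightarrow> M x \<noteq> 0 \<longrightarrow>
     nx x < n \<and> M (nx x) \<noteq> 0 \<and> M x = Suc (M (nx x)) \<and> 0 < W x (nx x)))"

text \<open>Following \<open>nx\<close> passes through every smaller layer, so \<open>M x\<close>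
  many different vertices are present. Hence \<open>n\<close> rounds of search and \<open>n\<close>
  steps of a walk suffice.\<close>

lemma layered_le:
  assumes lay: "layered n B W M nx" and "x < n"
  shows "M x \<le> n"
proof -
  have "\<exists>y<n. M y = m" if "1 \<le> m" "m \<le> M x" for m
    using that
  proof (induction "M x - m" arbitrary: m)
    case 0
    then show ?case using \<open>x < n\<close> by (intro exI[of _ x]) auto
  next
    case (Suc d)
    then have "d = M x - Suc m" "1 \<le> Suc m" "Suc m \<le> M x" by auto
    from Suc.hyps(1)[OF this] obtain y where y: "y < n" "M y = Suc m" by blast
    then have "y \<notin> B" using lay Suc.prems by (auto simp: layered_def)
    then show ?case using lay y by (intro exI[of _ "nx y"]) (auto simp: layered_def)
  qed
  then have "{1..M x} \<subseteq> M ` {..<n}" by fastforce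
  then show ?thesis using surj_card_le[of "{..<n}" "{1..M x}" M] by simp
qed

lemma cut_zero_iff: "cut n W Y = 0 \<longleftrightarrow> (\<forall>u<n. \<forall>v<n. u \<in> Y \<longrightarrow> v \<notin> Y \<longrightarrow> W u v = 0)"
  unfolding cut_def wsum_def by (auto simp: of_bool_def)

text \<open>A set with residual cut zero cannot be left along \<open>nx\<close>, while the layer
  drops with every step; such a descent could end only in \<open>B\<close>, which the set
  avoids.\<close>

lemma layered_blocked:
  assumes lay: "layered n B W M nx" and Y: "Y \<subseteq> {..<n}" "Y \<inter> B = {}" "cut n W Y = 0"
  shows "z \<in> Y \<Longrightarrow> M z = 0"
proof (induction "M z" arbitrary: z rule: less_induct)
  case less
  show ?case
  proof (rule ccontr)
    assume "M z \<noteq> 0"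
    moreover have "z < n" "z \<notin> B" using less.prems Y by auto
    ultimately have *: "nx z < n" "M (nx z) \<noteq> 0" "M z = Suc (M (nx z))" "0 < W z (nx z)"
      using lay by (auto simp: layered_def)
    then have "nx z \<in> Y" using Y(3) \<open>z < n\<close> less.prems unfolding cut_zero_iff by (metis less_irrefl)
    then show False using less.hyps[of "nx z"] * by simp
  qed
qed

lemma cut_unreached:
  assumes "\<And>x y. \<lbrakk>x < n; y < n; M y \<noteq> 0; 0 < W x y\<rbrakk> \<Longrightarrow> M x \<noteq> (0 :: nat)"
  shows "cut n W {x. x < n \<and> M x = 0} = 0"
  unfolding cut_zero_iff using assms by (metis (mono_tags, lifting) mem_Collect_eq neq0_conv)

text \<open>The invariant of the level loop: \<open>i\<close> levels are done, and of level \<open>Suc i\<close> all pairs before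
  \<open>(j, m)\<close>.\<close>

definition level_inv ::
  "nat \<Rightarrow> nat set \<Rightarrow> (nat \<Rightarrow> nat \<Rightarrow> nat) \<Rightarrow> nat \<Rightarrow> nat \<Rightarrow> nat \<Rightarrow> (nat \<Rightarrow> nat) \<Rightarrow> (nat \<Rightarrow> nat) \<Rightarrow> bool" where
  "level_inv n B W i j m M nx \<longleftrightarrow> layered n B W M nx \<and> (\<forall>x<n. \<forall>y<n. M y \<noteq> 0 \<longrightarrow> 0 < W x y \<longrightarrow>
     M y \<le> i \<or> M y = Suc i \<and> (x < j \<or> x = j \<and> y < m) \<longrightarrow> M x \<noteq> 0)"

lemma level_invD:
  "level_inv n B W i j m M nx \<Longrightarrow> x < n \<Longrightarrow> y < n \<Longrightarrow> M y \<noteq> 0 \<Longrightarrow> 0 < W x y \<Longrightarrow>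
    M y \<le> i \<or> M y = Suc i \<and> (x < j \<or> x = j \<and> y < m) \<Longrightarrow> M x \<noteq> 0"
  unfolding level_inv_def by blast

lemma level_inv_mark:
  assumes inv: "level_inv n B W i j m M nx" and jm: "j < n" "m < n" "M j = 0" "M m = Suc i" "0 < W j m"
  shows "level_inv n B W i j (Suc m) (M(j := Suc (Suc i))) (nx(j := m))"
proof -
  let ?M = "M(j := Suc (Suc i))" and ?nx = "nx(j := m)"
  have lay: "layered n B W M nx" using inv by (simp add: level_inv_def)
  have "j \<notin> B" using lay jm by (auto simp: layered_def)
  moreover have "nx x \<noteq> j" if "x < n" "x \<notin> B" "M x \<noteq> 0" for x
    using lay that jm(3) unfolding layered_def by metis
  moreover have "m \<noteq> j" using jm by auto
  ultimately have "layered n B W ?M ?nx"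
    using lay jm unfolding layered_def by simp
  moreover have "?M x \<noteq> 0" if "x < n" "y < n" "?M y \<noteq> 0" "0 < W x y"
    "?M y \<le> i \<or> ?M y = Suc i \<and> (x < j \<or> x = j \<and> y < Suc m)" for x y
  proof (cases "x = j")
    case False
    have "y \<noteq> j" using that(5) by auto
    then have "M x \<noteq> 0" using that False by (intro level_invD[OF inv that(1,2)]) auto
    then show ?thesis using False by simp
  qed simp
  ultimately show ?thesis unfolding level_inv_def by blast
qed

lemma level_inv_skip:
  assumes inv: "level_inv n B W i j m M nx" and no: "\<not> (M j = 0 \<and> M m = Suc i \<and> 0 < W j m)"
  shows "level_inv n B W i j (Suc m) M nx"
proof -
  have "M x \<noteq> 0" if "x < n" "y < n" "M y \<noteq> 0" "0 < W x y"
    "M y \<le> i \<or> M y = Suc i \<and> (x < j \<or> x = j \<and> y < Suc m)" for x y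
  proof (cases "x = j \<and> y = m \<and> M y = Suc i")
    case False
    then show ?thesis using that(5) by (intro level_invD[OF inv that(1-4)]) (auto simp: less_Suc_eq)
  qed (use no that in auto)
  then show ?thesis using inv unfolding level_inv_def by blast
qed

lemma level_inv_row:
  assumes inv: "level_inv n B W i j n M nx"
  shows "level_inv n B W i (Suc j) 0 M nx"
proof -
  have "M x \<noteq> 0" if "x < n" "y < n" "M y \<noteq> 0" "0 < W x y"
    "M y \<le> i \<or> M y = Suc i \<and> (x < Suc j \<or> x = Suc j \<and> y < 0)" for x y
    using that(2,5) by (intro level_invD[OF inv that(1-4)]) (auto simp: less_Suc_eq)
  then show ?thesis using inv unfolding level_inv_def by blast
qed

lemma level_inv_level:
  assumes inv: "level_inv n B W i n 0 M nx"
  shows "level_inv n B W (Suc i) 0 0 M nx"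
proof -
  have "M x \<noteq> 0" if "x < n" "y < n" "M y \<noteq> 0" "0 < W x y"
    "M y \<le> Suc i \<or> M y = Suc (Suc i) \<and> (x < 0 \<or> x = 0 \<and> y < 0)" for x y
    using that(1,5) by (intro level_invD[OF inv that(1-4)]) (auto simp: le_Suc_eq)
  then show ?thesis using inv unfolding level_inv_def by blast
qed

text \<open>Breadth-first search without a queue: round \<open>l\<close> scans all pairs for arcs
  into layer \<open>l + 1\<close> and puts new tails into layer \<open>l + 2\<close>.\<close>

definition levels :: prog where
  "levels = PFor ''l'' ''n'' (PFor ''x'' ''n'' (PFor ''y'' ''n''
     (PCond (Conj (eqb (Get ''M'' (Var ''x'')) (Const 0))
         (Conj (eqb (Get ''M'' (Var ''y'')) (Plus (Var ''l'') (Const 1))) (posb (Get ''F'' (cell ''x'' ''y'')))))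
       (PStore ''M'' (Var ''x'') (Plus (Var ''l'') (Const 2)) ;;; PStore ''X'' (Var ''x'') (Var ''y''))
       PSkip)))"

lemma modv_levels [simp]: "modv levels = {''x'', ''l'', ''y''}"
  and moda_levels [simp]: "moda levels = {''M'', ''X''}"
  and bounds_levels [simp]: "bounds levels = {''n''}"
  and counters_ok_levels [simp]: "counters_ok levels"
  by (auto simp: levels_def)

lemma levels:
  assumes env: "env n p k s" and F: "Wt n (arr s ''F'') = W"
    and init: "\<And>x. x < n \<Longrightarrow> arr s ''M'' x = of_bool (x \<in> B)"
  shows "layered n B W (arr (sem levels s) ''M'') (arr (sem levels s) ''X'')"
    and "\<And>x y. \<lbrakk>x < n; y < n; arr (sem levels s) ''M'' y \<noteq> 0; 0 < W x y\<rbrakk> \<Longrightarrow> arr (sem levels s) ''M'' x \<noteq> 0"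
proof -
  note e = envD[OF env]
  let ?I = "\<lambda>i j m t. level_inv n B W i j m (arr t ''M'') (arr t ''X'')"
  have "?I n 0 0 (sem levels s)"
    unfolding levels_def
  proof (rule For_induct[where P = "\<lambda>i. ?I i 0 0"], goal_cases)
    case 1
    show ?case using init by (auto simp: level_inv_def layered_def)
  next
    case (2 i s1)
    note l1 = 2
    show ?case
    proof (rule For_induct[where P = "\<lambda>j. ?I i j 0"], goal_cases)
      case 1
      show ?case using l1(2) by simp
    next
      case (2 j s2)
      note l2 = 2
      have j: "j < n" using l2(1) l1(3) e by simp
      show ?case
      proof (rule For_induct[where P = "\<lambda>m. ?I i j m"], goal_cases)
        case 1
        show ?case using l2(2) by simp
      next
        case (2 m s3)
        have m: "m < n" using 2(1) l1(3) l2(3) e by simp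
        have st: "var s3 ''x'' = j" "var s3 ''l'' = i" "arr s3 ''r'' = arr s ''r''" "arr s3 ''F'' = arr s ''F''"
          using 2(3,4) l2(3,4) l1(3,4) by auto
        have Fjm: "arr s ''F'' (j * n + m) = W j m" using F j m by (auto simp: Wt_def)
        let ?M = "arr s3 ''M''" and ?X = "arr s3 ''X''"
        show ?case
        proof (cases "?M j = 0 \<and> ?M m = Suc i \<and> 0 < W j m")
          case True
          then show ?thesis using level_inv_mark[OF 2(2) j m] st e(7)[OF j] j Fjm by simp
        next
          case False
          then show ?thesis using level_inv_skip[OF 2(2) False] st e(7)[OF j] Fjm by auto
        qed
      next
        case (3 s3)
        have "var s2 ''n'' = n" using l1(3) l2(3) e by simp
        then show ?case using level_inv_row[of n B W i j "arr s3 ''M''" "arr s3 ''X''"] 3(1) by simp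
      qed
    next
      case (3 s2)
      have "var s1 ''n'' = n" using l1(3) e by simp
      then show ?case using level_inv_level[of n B W i "arr s2 ''M''" "arr s2 ''X''"] 3(1) by simp
    qed
  next
    case (3 s1)
    then show ?case using e by simp
  qed
  then show lay: "layered n B W (arr (sem levels s) ''M'') (arr (sem levels s) ''X'')"
    by (simp only: level_inv_def)
  \<comment> \<open>No layer exceeds \<open>n\<close>, so the layer of \<open>y\<close> has been
    fully processed after \<open>n\<close> rounds.\<close>
  show "arr (sem levels s) ''M'' x \<noteq> 0"
    if "x < n" "y < n" "arr (sem levels s) ''M'' y \<noteq> 0" "0 < W x y" for x y
    using level_invD[OF \<open>?I n 0 0 (sem levels s)\<close> that] layered_le[OF lay that(2)] by simp
qed

text \<open>The value \<open>n\<close> of \<open>''u''\<close>, which is not a vertex, reports that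
  no source vertex reaches \<open>B\<close>.\<close>

definition search :: prog where
  "search = mark ''M'' (posb (Get ''B'' (Var ''x''))) ;;; levels ;;; PAssign ''u'' (Var ''n'') ;;;
     PFor ''x'' ''n'' (PCond (Conj (posb (Get ''A'' (Var ''x''))) (posb (Get ''M'' (Var ''x''))))
       (PAssign ''u'' (Var ''x'')) PSkip)"

lemma modv_search [simp]: "modv search = {''x'', ''l'', ''y'', ''u''}"
  and moda_search [simp]: "moda search = {''M'', ''X''}"
  and bounds_search [simp]: "bounds search = {''n''}"
  and counters_ok_search [simp]: "counters_ok search"
  by (auto simp: search_def)

lemma search:
  assumes env: "env n p k s" and F: "Wt n (arr s ''F'') = W"
    and A: "marks n (arr s ''A'') = A" and B: "marks n (arr s ''B'') = B"
  defines "s' \<equiv> sem search s"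
  defines "M \<equiv> arr s' ''M''"
  shows "layered n B W M (arr s' ''X'')"
    and "\<And>x y. \<lbrakk>x < n; y < n; M y \<noteq> 0; 0 < W x y\<rbrakk> \<Longrightarrow> M x \<noteq> 0"
    and "var s' ''u'' < n \<and> var s' ''u'' \<in> A \<and> M (var s' ''u'') \<noteq> 0 \<or>
      var s' ''u'' = n \<and> (\<forall>x\<in>A. M x = 0)"
proof -
  define s1 where "s1 = sem (mark ''M'' (posb (Get ''B'' (Var ''x'')))) s"
  define s2 where "s2 = sem levels s1"
  have env1: "env n p k s1" unfolding s1_def by (rule env_sem[OF _ env]) (simp add: keeps_env_def)
  have env2: "env n p k s2" unfolding s2_def by (rule env_sem[OF _ env1]) (simp add: keeps_env_def)
  have F1: "Wt n (arr s1 ''F'') = W" unfolding s1_def using F by (simp add: frame_arr)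
  have M1: "arr s1 ''M'' x = of_bool (x \<in> B)" if "x < n" for x
    unfolding s1_def using envD(1)[OF env] that B
    by (subst mark(2)[where n = n and G = "\<lambda>x. x \<in> B"]) (auto simp: marks_def)
  note lev = levels[OF env1 F1 M1, folded s2_def]
  have fr2: "arr s2 ''A'' = arr s ''A''" unfolding s2_def s1_def by (simp add: frame_arr)
  let ?l = "PFor ''x'' ''n'' (PCond (Conj (posb (Get ''A'' (Var ''x''))) (posb (Get ''M'' (Var ''x''))))
       (PAssign ''u'' (Var ''x'')) PSkip)"
  have s': "s' = sem ?l (setv s2 ''u'' n)"
    using envD(1)[OF env2] unfolding s'_def search_def s2_def s1_def by (simp del: sem.simps(6))
  have same: "arr s' ''M'' = arr s2 ''M''" "arr s' ''X'' = arr s2 ''X''"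
    unfolding s' by (simp_all add: frame_arr del: sem.simps(6))
  show "layered n B W M (arr s' ''X'')"
    unfolding M_def same by (rule lev(1))
  show "M x \<noteq> 0" if "x < n" "y < n" "M y \<noteq> 0" "0 < W x y" for x y
    using lev(2)[of x y] that unfolding M_def same by simp
  let ?Q = "\<lambda>i t. var t ''u'' < n \<and> var t ''u'' \<in> A \<and> M (var t ''u'') \<noteq> 0 \<or>
      var t ''u'' = n \<and> (\<forall>x<i. x \<in> A \<longrightarrow> M x = 0)"
  have "?Q n s'"
    unfolding s'
  proof (rule For_induct[where P = ?Q], goal_cases)
    case (2 i t)
    have i: "i < n" using 2(1) envD(1)[OF env2] by simp
    have t: "arr t ''A'' = arr s ''A''" "arr t ''M'' = M"
      using 2(4)[of "''A''"] 2(4)[of "''M''"] fr2 same(1) by (simp_all add: M_def)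
    have "0 < arr s ''A'' i \<longleftrightarrow> i \<in> A" using A i by (auto simp: marks_def)
    then show ?case using 2(2) i t by (auto simp: less_Suc_eq)
  next
    case (3 t)
    then show ?case using envD(1)[OF env2] by simp
  qed simp
  then show "var s' ''u'' < n \<and> var s' ''u'' \<in> A \<and> M (var s' ''u'') \<noteq> 0 \<or>
      var s' ''u'' = n \<and> (\<forall>x\<in>A. M x = 0)"
    using A by (auto simp: marks_def)
qed

text \<open>After \<open>q\<close> steps the walk stands at \<open>u\<close>. The bound
  \<open>M u + q \<le> n\<close> guarantees arrival in time, arcs of layers not above that of
  \<open>u\<close> are still usable, and the last conjunct is the telescoped effect of all pushes
  since \<open>a\<close>.\<close>

definition walk_inv ::
  "nat \<Rightarrow> nat set \<Rightarrow> (nat \<Rightarrow> nat) \<Rightarrow> (nat \<Rightarrow> nat) \<Rightarrow> (nat \<Rightarrow> nat \<Rightarrow> nat) \<Rightarrow> nat \<Rightarrow> nat \<Rightarrow>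
    (nat \<Rightarrow> nat \<Rightarrow> nat) \<Rightarrow> nat \<Rightarrow> bool" where
  "walk_inv n B M nx W\<^sub>0 a q W u \<longleftrightarrow> u < n \<and> M u \<noteq> 0 \<and> (u \<in> B \<or> M u + q \<le> n) \<and>
     (\<forall>z<n. z \<notin> B \<longrightarrow> M z \<noteq> 0 \<longrightarrow> M z \<le> M u \<longrightarrow> 0 < W z (nx z)) \<and>
     (\<forall>X. cut n W X + of_bool (a \<in> X) = cut n W\<^sub>0 X + of_bool (u \<in> X))"

lemma walk_inv_init:
  assumes "layered n B W M nx" "a < n" "M a \<noteq> 0"
  shows "walk_inv n B M nx W a 0 W a"
  using assms layered_le[OF assms(1,2)] unfolding walk_inv_def layered_def by simp

lemma walk_inv_step:
  assumes inv: "walk_inv n B M nx W\<^sub>0 a q W u" and lay: "layered n B W\<^sub>1 M nx" and "u \<notin> B"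
  shows "nx u < n" "nx u \<noteq> u" "0 < W u (nx u)"
    "walk_inv n B M nx W\<^sub>0 a (Suc q) (push u (nx u) W) (nx u)"
proof -
  have u: "u < n" "M u \<noteq> 0" "M u + q \<le> n"
    and edges: "\<forall>z<n. z \<notin> B \<longrightarrow> M z \<noteq> 0 \<longrightarrow> M z \<le> M u \<longrightarrow> 0 < W z (nx z)"
    and cuts: "\<forall>X. cut n W X + of_bool (a \<in> X) = cut n W\<^sub>0 X + of_bool (u \<in> X)"
    using inv \<open>u \<notin> B\<close> unfolding walk_inv_def by blast+
  have nx: "nx u < n" "M (nx u) \<noteq> 0" "M u = Suc (M (nx u))"
    using lay u(1,2) \<open>u \<notin> B\<close> unfolding layered_def by blast+
  show "nx u < n" by fact
  show ne: "nx u \<noteq> u"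
  proof
    assume "nx u = u"
    with nx(3) show False by (metis n_not_Suc_n)
  qed
  show W: "0 < W u (nx u)" using edges u(1,2) \<open>u \<notin> B\<close> by blast
  \<comment> \<open>Only the arc from \<open>u\<close> to \<open>nx u\<close> loses capacity, and
    \<open>z\<close> lies in a strictly lower layer than \<open>u\<close>.\<close>
  have "0 < push u (nx u) W z (nx z)" if z: "z < n" "z \<notin> B" "M z \<noteq> 0" "M z \<le> M (nx u)" for z
  proof -
    have le: "M z \<le> M u" using z(4) nx(3) by linarith
    have "z \<noteq> u"
    proof
      assume "z = u"
      with z(4) nx(3) show False by (metis Suc_n_not_le_n)
    qed
    moreover have "0 < W z (nx z)" using edges z le by blast
    ultimately show ?thesis by (simp add: push_def)
  qed
  moreover have "cut n (push u (nx u) W) X + of_bool (a \<in> X) = cut n W\<^sub>0 X + of_bool (nx u \<in> X)" for X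
    using cut_push[of u n "nx u" W X, OF u(1) nx(1) ne[symmetric] W] cuts[rule_format, of X] by linarith
  moreover have "M (nx u) + Suc q \<le> n" using u(3) nx(3) by linarith
  ultimately show "walk_inv n B M nx W\<^sub>0 a (Suc q) (push u (nx u) W) (nx u)"
    using nx(1,2) unfolding walk_inv_def by blast
qed

lemma walk_inv_skip:
  "walk_inv n B M nx W\<^sub>0 a q W u \<Longrightarrow> u \<in> B \<Longrightarrow> walk_inv n B M nx W\<^sub>0 a (Suc q) W u"
  by (simp add: walk_inv_def)

lemma Wt_push:
  assumes "x < n" "y < n" "x \<noteq> y"
  shows "Wt n (g(x * n + y := g (x * n + y) - 1, y * n + x := Suc (g (y * n + x)))) = push x y (Wt n g)"
  unfolding Wt_upd_cell[OF assms(1,2)] Wt_upd_cell[OF assms(2,1)]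
  using assms by (auto simp: push_def fun_eq_iff Wt_def)

definition walk :: prog where
  "walk = PFor ''q'' ''n'' (PCond (eqb (Get ''B'' (Var ''u'')) (Const 0))
     (PAssign ''y'' (Get ''X'' (Var ''u'')) ;;;
      PStore ''F'' (cell ''u'' ''y'') (Minus (Get ''F'' (cell ''u'' ''y'')) (Const 1)) ;;;
      PStore ''F'' (cell ''y'' ''u'') (Plus (Get ''F'' (cell ''y'' ''u'')) (Const 1)) ;;;
      PAssign ''u'' (Var ''y'')) PSkip)"

lemma modv_walk [simp]: "modv walk = {''q'', ''y'', ''u''}"
  and moda_walk [simp]: "moda walk = {''F''}"
  and bounds_walk [simp]: "bounds walk = {''n''}"
  and counters_ok_walk [simp]: "counters_ok walk"
  by (auto simp: walk_def)

lemma walk: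
  assumes env: "env n p k s" and B: "marks n (arr s ''B'') = B"
    and lay: "layered n B (Wt n (arr s ''F'')) (arr s ''M'') (arr s ''X'')"
    and a: "var s ''u'' < n" "arr s ''M'' (var s ''u'') \<noteq> 0"
    and X: "var s ''u'' \<in> X" "X \<inter> B = {}"
  shows "cut n (Wt n (arr (sem walk s) ''F'')) X + 1 = cut n (Wt n (arr s ''F'')) X"
proof -
  note e = envD[OF env]
  let ?M = "arr s ''M''" and ?X = "arr s ''X''" and ?W = "Wt n (arr s ''F'')" and ?a = "var s ''u''"
  let ?I = "\<lambda>q t. walk_inv n B ?M ?X ?W ?a q (Wt n (arr t ''F'')) (var t ''u'')"
  have "?I n (sem walk s)"
    unfolding walk_def
  proof (rule For_induct[where P = ?I], goal_cases)
    case 1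
    show ?case by (rule walk_inv_init[OF lay a])
  next
    case (2 q t)
    let ?u = "var t ''u''"
    have u: "?u < n" using 2(2) by (simp add: walk_inv_def)
    have t: "arr t ''B'' = arr s ''B''" "arr t ''X'' = ?X" "arr t ''r'' = arr s ''r''" using 2(4) by auto
    have b: "arr s ''B'' ?u = 0 \<longleftrightarrow> ?u \<notin> B" using B u by (auto simp: marks_def)
    show ?case
    proof (cases "?u \<in> B")
      case True
      then show ?thesis using walk_inv_skip[OF 2(2) True] b t by simp
    next
      case False
      note st = walk_inv_step[OF 2(2) lay False]
      have "?X ?u * n + ?u \<noteq> ?u * n + ?X ?u" using st(1,2) u by (simp add: cell_inj)
      then show ?thesis using st b False t e(7)[OF u] e(7)[OF st(1)] Wt_push[OF u st(1) st(2)[symmetric], of "arr t ''F''"]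
        by simp
    qed
  next
    case (3 t)
    then show ?case using e by simp
  qed
  then have I: "var (sem walk s) ''u'' \<in> B" "cut n (Wt n (arr (sem walk s) ''F'')) X + of_bool (?a \<in> X)
      = cut n ?W X + of_bool (var (sem walk s) ''u'' \<in> X)"
    by (auto simp: walk_inv_def)
  moreover have "var (sem walk s) ''u'' \<notin> X" using I(1) X(2) by blast
  ultimately show ?thesis using X(1) by simp
qed

definition copy_matrix :: "vname \<Rightarrow> vname \<Rightarrow> prog" where
  "copy_matrix a b = PFor ''x'' ''n'' (PFor ''y'' ''n'' (PStore a (cell ''x'' ''y'') (Get b (cell ''x'' ''y''))))"

lemma meta_copy_matrix [simp]: "modv (copy_matrix a b) = {''x'', ''y''}" "moda (copy_matrix a b) = {a}"
    "bounds (copy_matrix a b) = {''n''}" "counters_ok (copy_matrix a b)"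
  by (auto simp: copy_matrix_def)

lemma copy_matrix:
  assumes n: "var s ''n'' = n" and r: "\<And>u. u < n \<Longrightarrow> arr s ''r'' u = u * n"
    and ab: "a \<noteq> b" "a \<noteq> ''r''"
  shows "Wt n (arr (sem (copy_matrix a b) s) a) = Wt n (arr s b)"
    and "n * n \<le> q \<Longrightarrow> arr (sem (copy_matrix a b) s) a q = arr s a q"
proof -
  let ?P = "\<lambda>i j t. (\<forall>x<n. \<forall>y<n. x < i \<or> x = i \<and> y < j \<longrightarrow> arr t a (x * n + y) = arr s b (x * n + y)) \<and>
    (\<forall>q\<ge>n * n. arr t a q = arr s a q)"
  have *: "?P n 0 (sem (copy_matrix a b) s)"
    unfolding copy_matrix_def
  proof (rule For_induct[where P = "\<lambda>i. ?P i 0"], goal_cases)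
    case (2 i t)
    note o2 = 2
    have i: "i < n" using 2(1) n by simp
    show ?case
    proof (rule For_induct[where P = "?P i"], goal_cases)
      case 1
      then show ?case using o2(2) by simp
    next
      case (2 j t')
      have j: "j < n" using 2(1) o2(3) n by simp
      have t': "var t' ''x'' = i" "arr t' b = arr s b" "arr t' ''r'' = arr s ''r''"
        using 2(3,4) o2(3,4) ab by auto
      let ?g = "(arr t' a)(i * n + j := arr s b (i * n + j))"
      have "?g (x * n + y) = arr s b (x * n + y)"
        if "x < n" "y < n" "x < i \<or> x = i \<and> y < Suc j" for x y
        using 2(2) that cell_inj[OF that(2) j, of x i] by (auto simp: less_Suc_eq)
      moreover have "?g q = arr s a q" if "n * n \<le> q" for q
        using 2(2) that cell_less[OF i j] by auto
      ultimately show ?case using t' r[OF i] by simp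
    next
      case (3 t')
      have "var t ''n'' = n" using o2(3) n by simp
      then show ?case using 3(1) i by (auto simp: less_Suc_eq)
    qed
  next
    case (3 t)
    then show ?case using n by simp
  qed simp
  then show "Wt n (arr (sem (copy_matrix a b) s) a) = Wt n (arr s b)"
    by (auto simp: Wt_def fun_eq_iff)
  show "n * n \<le> q \<Longrightarrow> arr (sem (copy_matrix a b) s) a q = arr s a q" using * by blast
qed

text \<open>Unit augmentations are repeated a fixed number of times. The final search tells a
  maximum flow from one that was stopped by the limit \<open>''R''\<close>.\<close>

definition flow :: prog where
  "flow = copy_matrix ''F'' ''C'' ;;; PAssign ''val'' (Const 0) ;;;
     PFor ''h'' ''R'' (search ;;;
       PCond (Less (Var ''u'') (Var ''n'')) (PAssign ''val'' (Plus (Var ''val'') (Const 1)) ;;; walk) PSkip) ;;;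
     search"

lemma modv_flow [simp]: "modv flow = {''x'', ''l'', ''y'', ''u'', ''val'', ''h'', ''q''}"
  and moda_flow [simp]: "moda flow = {''F'', ''M'', ''X''}"
  and bounds_flow [simp]: "bounds flow = {''n'', ''R''}"
  and counters_ok_flow [simp]: "counters_ok flow"
  by (auto simp: flow_def)

text \<open>This is why the search runs backwards: the vertices that cannot reach \<open>B\<close>
  form the largest minimum cut on the source side, while those reachable from \<open>A\<close> would
  form the smallest.\<close>

definition largest_min_cut ::
  "nat \<Rightarrow> (nat \<Rightarrow> nat \<Rightarrow> nat) \<Rightarrow> nat set \<Rightarrow> nat set \<Rightarrow> nat set \<Rightarrow> nat \<Rightarrow> bool" where
  "largest_min_cut n W A B X m \<longleftrightarrow> A \<subseteq> X \<and> X \<subseteq> {..<n} \<and> X \<inter> B = {} \<and> cut n W X = m \<and>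
     (\<forall>Y. A \<subseteq> Y \<longrightarrow> Y \<subseteq> {..<n} \<longrightarrow> Y \<inter> B = {} \<longrightarrow> m \<le> cut n W Y \<and> (cut n W Y = m \<longrightarrow> Y \<subseteq> X))"

text \<open>The flow is visible only through its value \<open>m\<close>: every separating cut has
  dropped by exactly \<open>m\<close>. A round can fail only because a residual cut of zero exists,
  and that blocks all later rounds as well.\<close>

definition flow_inv ::
  "nat \<Rightarrow> nat set \<Rightarrow> nat set \<Rightarrow> (nat \<Rightarrow> nat \<Rightarrow> nat) \<Rightarrow> nat \<Rightarrow> (nat \<Rightarrow> nat \<Rightarrow> nat) \<Rightarrow> nat \<Rightarrow> bool" where
  "flow_inv n A B W\<^sub>0 h W m \<longleftrightarrow>
     (\<forall>X. A \<subseteq> X \<longrightarrow> X \<subseteq> {..<n} \<longrightarrow> X \<inter> B = {} \<longrightarrow> cut n W X + m = cut n W\<^sub>0 X) \<and>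
     (m = h \<or> (\<exists>X. A \<subseteq> X \<and> X \<subseteq> {..<n} \<and> X \<inter> B = {} \<and> cut n W X = 0))"

lemma unreached_feasible:
  assumes lay: "layered n B W M nx" and AB: "A \<subseteq> {..<n}" "B \<subseteq> {..<n}" and un: "\<forall>x\<in>A. M x = 0"
  shows "A \<subseteq> {x. x < n \<and> M x = 0}" "{x. x < n \<and> M x = 0} \<inter> B = {}"
  using assms by (auto simp: layered_def)

lemma flow_inv_unblocked:
  assumes inv: "flow_inv n A B W\<^sub>0 h W m" and lay: "layered n B W M nx" and a: "a \<in> A" "M a \<noteq> 0"
  shows "m = h"
proof (rule ccontr)
  assume "m \<noteq> h"
  then obtain X where "A \<subseteq> X" "X \<subseteq> {..<n}" "X \<inter> B = {}" "cut n W X = 0"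
    using inv by (auto simp: flow_inv_def)
  then show False using layered_blocked[OF lay, of X a] a by blast
qed

lemma flow:
  assumes env: "env n p k s" and A: "marks n (arr s ''A'') = A" and B: "marks n (arr s ''B'') = B"
  defines "s' \<equiv> sem flow s"
  defines "W \<equiv> Wt n (arr s ''C'')"
  shows "var s' ''u'' = n \<Longrightarrow>
      largest_min_cut n W A B {x. x < n \<and> arr s' ''M'' x = 0} (var s' ''val'')"
    and "var s' ''u'' \<noteq> n \<Longrightarrow> A \<subseteq> Y \<Longrightarrow> Y \<subseteq> {..<n} \<Longrightarrow> Y \<inter> B = {} \<Longrightarrow> 2 * k + 2 \<le> cut n W Y"
    and "var s' ''u'' \<le> n"
proof -
  note e = envD[OF env]
  let ?round = "search ;;;
       PCond (Less (Var ''u'') (Var ''n'')) (PAssign ''val'' (Plus (Var ''val'') (Const 1)) ;;; walk) PSkip"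
  define s1 where "s1 = setv (sem (copy_matrix ''F'' ''C'') s) ''val'' 0"
  define s2 where "s2 = sem (PFor ''h'' ''R'' ?round) s1"
  have s': "s' = sem search s2"
    unfolding s'_def flow_def s2_def s1_def by (simp del: sem.simps(6))
  have sub: "A \<subseteq> {..<n}" "B \<subseteq> {..<n}" using A B by (auto simp: marks_def)
  have env1: "env n p k s1"
    unfolding s1_def by (subst env_setv) (auto intro!: env_sem[OF _ env] simp: keeps_env_def simp del: sem.simps(6))
  have fr1: "arr s1 ''A'' = arr s ''A''" "arr s1 ''B'' = arr s ''B''" "arr s1 ''C'' = arr s ''C''"
    unfolding s1_def by (simp_all add: frame_arr del: sem.simps(6))
  have F1: "Wt n (arr s1 ''F'') = W"
    using copy_matrix(1)[OF e(1,7), of "''F''" "''C''"] by (simp add: s1_def W_def)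
  let ?I = "\<lambda>h t. flow_inv n A B W h (Wt n (arr t ''F'')) (var t ''val'')"
  have rounds: "?I (2 * k + 2) s2"
    unfolding s2_def
  proof (rule For_induct[where P = ?I], goal_cases)
    case 1
    show ?case using F1 by (simp add: flow_inv_def s1_def del: sem.simps(6))
  next
    case (2 h t)
    have envt: "env n p k (setv t ''h'' h)"
    proof (rule env_cong[OF env1])
      show "var (setv t ''h'' h) z = var s1 z" if "z \<in> envvars" for z
        using 2(3)[of z] that by auto
      show "arr (setv t ''h'' h) ''r'' = arr s1 ''r''" using 2(4)[of "''r''"] by simp
    qed
    have AB: "marks n (arr (setv t ''h'' h) ''A'') = A" "marks n (arr (setv t ''h'' h) ''B'') = B"
      using 2(4)[of "''A''"] 2(4)[of "''B''"] fr1 A B by auto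
    define t1 where "t1 = sem search (setv t ''h'' h)"
    have env1: "env n p k t1" unfolding t1_def by (rule env_sem[OF _ envt]) (simp add: keeps_env_def)
    have Ft1: "arr t1 ''F'' = arr t ''F''" "var t1 ''val'' = var t ''val''" "arr t1 ''B'' = arr (setv t ''h'' h) ''B''"
      unfolding t1_def by (simp_all add: frame_arr frame_var)
    have Ft: "Wt n (arr (setv t ''h'' h) ''F'') = Wt n (arr t ''F'')" by simp
    note se = search[OF envt Ft AB, folded t1_def]
    show ?case
    proof (cases "var t1 ''u'' < n")
      case True
      then have u: "var t1 ''u'' \<in> A" "arr t1 ''M'' (var t1 ''u'') \<noteq> 0" using se(3) by auto
      let ?t = "setv t1 ''val'' (Suc (var t1 ''val''))"
      have envv: "env n p k ?t" using env1 by (simp add: env_setv)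
      have lay: "layered n B (Wt n (arr t ''F'')) (arr t1 ''M'') (arr t1 ''X'')" using se(1) by simp
      have w: "cut n (Wt n (arr (sem walk ?t) ''F'')) X + 1 = cut n (Wt n (arr t ''F'')) X"
        if "A \<subseteq> X" "X \<inter> B = {}" for X
        using walk[OF envv, of B X] AB(2) Ft1 lay True u that by auto
      have m: "var t ''val'' = h" by (rule flow_inv_unblocked[OF 2(2) lay u])
      have "flow_inv n A B W (Suc h) (Wt n (arr (sem walk ?t) ''F'')) (Suc (var t ''val''))"
        unfolding flow_inv_def
      proof (intro conjI allI impI)
        fix X assume X: "A \<subseteq> X" "X \<subseteq> {..<n}" "X \<inter> B = {}"
        then have "cut n (Wt n (arr t ''F'')) X + var t ''val'' = cut n W X"
          using 2(2) by (simp add: flow_inv_def)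
        then show "cut n (Wt n (arr (sem walk ?t) ''F'')) X + Suc (var t ''val'') = cut n W X"
          using w[OF X(1,3)] by linarith
      qed (simp add: m)
      moreover have "sem ?round (setv t ''h'' h) = sem walk ?t"
        using True envD(1)[OF env1] by (simp add: t1_def[symmetric])
      ultimately show ?thesis using Ft1 by (simp add: frame_var)
    next
      case False
      then have un: "\<forall>x\<in>A. arr t1 ''M'' x = 0" using se(3) by auto
      let ?X = "{x. x < n \<and> arr t1 ''M'' x = 0}"
      note fe = unreached_feasible[OF se(1) sub un]
      have "cut n (Wt n (arr t ''F'')) ?X = 0"
        by (rule cut_unreached) (erule (3) se(2))
      with fe have "\<exists>X. A \<subseteq> X \<and> X \<subseteq> {..<n} \<and> X \<inter> B = {} \<and> cut n (Wt n (arr t ''F'')) X = 0"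
        by (intro exI[of _ ?X] conjI) blast+
      then have "flow_inv n A B W (Suc h) (Wt n (arr t ''F'')) (var t ''val'')"
        using 2(2) unfolding flow_inv_def by blast
      moreover have "sem ?round (setv t ''h'' h) = t1"
        using False envD(1)[OF env1] by (simp add: t1_def[symmetric])
      ultimately show ?thesis using Ft1 by simp
    qed
  next
    case (3 t)
    then show ?case using envD(5)[OF env1] by simp
  qed
  have env2: "env n p k s2"
    unfolding s2_def by (rule env_sem[OF _ env1]) (simp add: keeps_env_def)
  have AB2: "marks n (arr s2 ''A'') = A" "marks n (arr s2 ''B'') = B"
    using A B fr1 unfolding s2_def by (simp_all add: frame_arr del: sem.simps(6))
  have val: "var s' ''val'' = var s2 ''val''" unfolding s' by (simp add: frame_var)
  note se = search[OF env2 refl AB2, folded s']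
  show "var s' ''u'' \<le> n" using se(3) by auto
  show "largest_min_cut n W A B {x. x < n \<and> arr s' ''M'' x = 0} (var s' ''val'')" if "var s' ''u'' = n"
  proof -
    have un: "\<forall>x\<in>A. arr s' ''M'' x = 0" using se(3) that by auto
    let ?X = "{x. x < n \<and> arr s' ''M'' x = 0}"
    note fe = unreached_feasible[OF se(1) sub un]
    have eq: "cut n (Wt n (arr s2 ''F'')) Y + var s' ''val'' = cut n W Y"
      if "A \<subseteq> Y" "Y \<subseteq> {..<n}" "Y \<inter> B = {}" for Y
      using rounds that val by (simp add: flow_inv_def)
    have "cut n (Wt n (arr s2 ''F'')) ?X = 0"
      by (rule cut_unreached) (erule (3) se(2))
    moreover have "?X \<subseteq> {..<n}" by blast
    ultimately have X: "cut n W ?X = var s' ''val''" using eq[OF fe(1) _ fe(2)] by linarith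
    \<comment> \<open>A second minimum cut also has residual cut zero, so none of its vertices
      reaches \<open>B\<close>; this gives maximality of \<open>?X\<close>.\<close>
    have "Y \<subseteq> ?X" if Y: "A \<subseteq> Y" "Y \<subseteq> {..<n}" "Y \<inter> B = {}" "cut n W Y = var s' ''val''" for Y
    proof
      fix z assume "z \<in> Y"
      have "cut n (Wt n (arr s2 ''F'')) Y = 0" using eq[OF Y(1-3)] Y(4) by linarith
      from layered_blocked[OF se(1) Y(2,3) this \<open>z \<in> Y\<close>] show "z \<in> ?X" using Y(2) \<open>z \<in> Y\<close> by blast
    qed
    moreover have "var s' ''val'' \<le> cut n W Y" if "A \<subseteq> Y" "Y \<subseteq> {..<n}" "Y \<inter> B = {}" for Y
      using eq[OF that] by linarith
    moreover have "?X \<subseteq> {..<n}" by blast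
    ultimately show ?thesis using X fe unfolding largest_min_cut_def by blast
  qed
  show "2 * k + 2 \<le> cut n W Y" if "var s' ''u'' \<noteq> n" "A \<subseteq> Y" "Y \<subseteq> {..<n}" "Y \<inter> B = {}"
  proof -
    have u: "var s' ''u'' \<in> A" "arr s' ''M'' (var s' ''u'') \<noteq> 0" using se(3) that(1) by auto
    \<comment> \<open>An augmenting path remains, hence no residual cut is zero and every one of the
      \<open>2 * k + 2\<close> rounds must have succeeded.\<close>
    have "var s2 ''val'' = 2 * k + 2" by (rule flow_inv_unblocked[OF rounds se(1) u])
    moreover have "cut n (Wt n (arr s2 ''F'')) Y + var s2 ''val'' = cut n W Y"
      using rounds that by (simp add: flow_inv_def)
    ultimately show ?thesis by linarith
  qed
qed

section \<open>The stack of open nodes and the closure of a node\<close>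

abbreviation fsize :: "nat \<Rightarrow> nat" where
  "fsize n \<equiv> n * n + n + 1"

definition frame :: "nat \<Rightarrow> (nat \<Rightarrow> nat) \<Rightarrow> nat \<Rightarrow> node" where
  "frame n g j = node_of n (\<lambda>q. g (j * fsize n + q))"

text \<open>Register \<open>''o''\<close> is the offset of the first free frame, so the search ends when it is \<open>0\<close>.\<close>

definition stack :: "nat \<Rightarrow> state \<Rightarrow> node list \<Rightarrow> bool" where
  "stack n s Ns \<longleftrightarrow> var s ''o'' = length Ns * fsize n \<and>
     (\<forall>j<length Ns. frame n (arr s ''S'') j = Ns ! j)"

lemma stack_cong: "stack n s Ns \<Longrightarrow> var s' ''o'' = var s ''o'' \<Longrightarrow> arr s' ''S'' = arr s ''S'' \<Longrightarrow> stack n s' Ns"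
  by (simp add: stack_def)

definition load :: "vname \<Rightarrow> prog" where
  "load z = PFor ''x'' ''fs'' (PStore ''C'' (Var ''x'') (Get ''S'' (Plus (Var z) (Var ''x''))))"

definition save :: "vname \<Rightarrow> prog" where
  "save z = PFor ''x'' ''fs'' (PStore ''S'' (Plus (Var z) (Var ''x'')) (Get ''C'' (Var ''x'')))"

lemma meta_load [simp]: "modv (load z) = {''x''}" "moda (load z) = {''C''}" "bounds (load z) = {''fs''}"
    "counters_ok (load z)"
  and meta_save [simp]: "modv (save z) = {''x''}" "moda (save z) = {''S''}" "bounds (save z) = {''fs''}"
    "counters_ok (save z)"
  by (auto simp: load_def save_def)

lemma load:
  assumes env: "env n p k s" and z: "var s z = j * fsize n" "z \<noteq> ''x''"
  shows "node_of n (arr (sem (load z) s) ''C'') = frame n (arr s ''S'') j"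
proof -
  have "\<forall>q<fsize n. arr (sem (load z) s) ''C'' q = arr s ''S'' (j * fsize n + q)"
    unfolding load_def
  proof (rule For_induct[where P = "\<lambda>i t. \<forall>q<i. arr t ''C'' q = arr s ''S'' (j * fsize n + q)"], goal_cases)
    case (2 i t)
    have "var t z = j * fsize n" using 2(3)[of z] z by simp
    then show ?case using 2(2) 2(4)[of "''S''"] z by (auto simp: less_Suc_eq)
  qed (use envD(4)[OF env] in auto)
  then show ?thesis unfolding frame_def by (intro node_of_cong) simp
qed

lemma save:
  assumes env: "env n p k s" and z: "var s z = j * fsize n" "z \<noteq> ''x''"
  shows "frame n (arr (sem (save z) s) ''S'') j = node_of n (arr s ''C'')"
    and "l \<noteq> j \<Longrightarrow> frame n (arr (sem (save z) s) ''S'') l = frame n (arr s ''S'') l"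
proof -
  have *: "(\<forall>q<fsize n. arr (sem (save z) s) ''S'' (j * fsize n + q) = arr s ''C'' q) \<and>
     (\<forall>l q. l \<noteq> j \<longrightarrow> q < fsize n \<longrightarrow> arr (sem (save z) s) ''S'' (l * fsize n + q) = arr s ''S'' (l * fsize n + q))"
    unfolding save_def
  proof (rule For_induct[where P = "\<lambda>i t. (\<forall>q<i. arr t ''S'' (j * fsize n + q) = arr s ''C'' q) \<and>
     (\<forall>l q. l \<noteq> j \<longrightarrow> q < fsize n \<longrightarrow> arr t ''S'' (l * fsize n + q) = arr s ''S'' (l * fsize n + q))"], goal_cases)
    case (2 i t)
    have i: "i < fsize n" using 2(1) envD(4)[OF env] by simp
    have t: "var t z = j * fsize n" "arr t ''C'' = arr s ''C''" using 2(3)[of z] 2(4)[of "''C''"] z by simp_all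
    let ?g = "(arr t ''S'')(j * fsize n + i := arr s ''C'' i)"
    have "?g (j * fsize n + q) = arr s ''C'' q" if "q < Suc i" for q
      using 2(2) that by (auto simp: less_Suc_eq)
    moreover have "?g (l * fsize n + q) = arr s ''S'' (l * fsize n + q)" if "l \<noteq> j" "q < fsize n" for l q
      using 2(2) that cell_inj[OF that(2) i, of l j] by auto
    ultimately show ?case using t z by simp
  qed (use envD(4)[OF env] in auto)
  then show "frame n (arr (sem (save z) s) ''S'') j = node_of n (arr s ''C'')"
    unfolding frame_def by (intro node_of_cong) simp
  show "frame n (arr (sem (save z) s) ''S'') l = frame n (arr s ''S'') l" if "l \<noteq> j"
    unfolding frame_def using * that by (intro node_of_cong) simp
qed

definition push_frame :: prog where
  "push_frame = save ''o'' ;;; PAssign ''o'' (Plus (Var ''o'') (Var ''fs''))"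

definition pop_frame :: prog where
  "pop_frame = PAssign ''o'' (Minus (Var ''o'') (Var ''fs'')) ;;; load ''o''"

lemma meta_push_frame [simp]: "modv push_frame = {''x'', ''o''}" "moda push_frame = {''S''}"
    "bounds push_frame = {''fs''}" "counters_ok push_frame"
  and meta_pop_frame [simp]: "modv pop_frame = {''x'', ''o''}" "moda pop_frame = {''C''}"
    "bounds pop_frame = {''fs''}" "counters_ok pop_frame"
  by (auto simp: push_frame_def pop_frame_def)

lemma push_frame:
  assumes env: "env n p k s" and st: "stack n s Ns"
  shows "stack n (sem push_frame s) (Ns @ [node_of n (arr s ''C'')])"
proof -
  have o: "var s ''o'' = length Ns * fsize n" using st by (simp add: stack_def)
  note sv = save[OF env o]
  show ?thesis
    using st sv(1) sv(2) envD(4)[OF env] unfolding stack_def push_frame_def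
    by (auto simp: frame_var nth_append less_Suc_eq)
qed

lemma pop_frame:
  assumes env: "env n p k s" and st: "stack n s (Ns @ [N])"
  shows "stack n (sem pop_frame s) Ns" "node_of n (arr (sem pop_frame s) ''C'') = N"
proof -
  have o: "var s ''o'' - var s ''fs'' = length Ns * fsize n"
    using st envD(4)[OF env] by (simp add: stack_def)
  let ?s = "setv s ''o'' (length Ns * fsize n)"
  have s: "sem pop_frame s = sem (load ''o'') ?s" by (simp add: pop_frame_def o)
  have "env n p k ?s" using env by (simp add: env_setv)
  from load[OF this, of "''o''" "length Ns"]
  show "node_of n (arr (sem pop_frame s) ''C'') = N"
    using st unfolding s by (simp add: stack_def nth_append)
  show "stack n (sem pop_frame s) Ns"
    unfolding s stack_def
  proof (intro conjI allI impI)
    show "var (sem (load ''o'') ?s) ''o'' = length Ns * fsize n" by (simp add: frame_var)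
    fix j assume j: "j < length Ns"
    have "frame n (arr s ''S'') j = (Ns @ [N]) ! j" using st j by (simp add: stack_def)
    then show "frame n (arr (sem (load ''o'') ?s) ''S'') j = Ns ! j"
      using j by (simp add: frame_arr nth_append)
  qed
qed

text \<open>Overwriting an inner frame: the expanded node stays below its other successors until it
  is replaced by \<open>out\<close>.\<close>

lemma save_stack:
  assumes env: "env n p k s" and st: "stack n s (Ns @ N # Ms)"
    and z: "var s z = length Ns * fsize n" "z \<notin> {''x'', ''o''}"
  shows "stack n (sem (save z) s) (Ns @ node_of n (arr s ''C'') # Ms)"
proof -
  note sv = save[OF env z(1)]
  show ?thesis
    unfolding stack_def
  proof (intro conjI allI impI)
    show "var (sem (save z) s) ''o'' = length (Ns @ node_of n (arr s ''C'') # Ms) * fsize n"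
      using st by (simp add: frame_var stack_def)
    fix j assume j: "j < length (Ns @ node_of n (arr s ''C'') # Ms)"
    show "frame n (arr (sem (save z) s) ''S'') j = (Ns @ node_of n (arr s ''C'') # Ms) ! j"
    proof (cases "j = length Ns")
      case True
      then show ?thesis using sv(1) z(2) by simp
    next
      case False
      have "frame n (arr s ''S'') j = (Ns @ N # Ms) ! j" using st j by (simp add: stack_def)
      then show ?thesis using sv(2)[OF _ False] z(2) False by (simp add: nth_append nth_Cons')
    qed
  qed
qed

lemma load_stack:
  assumes env: "env n p k s" and st: "stack n s (Ns @ N # Ms)"
    and z: "var s z = length Ns * fsize n" "z \<noteq> ''x''"
  shows "node_of n (arr (sem (load z) s) ''C'') = N"
proof -
  have "frame n (arr s ''S'') (length Ns) = (Ns @ N # Ms) ! length Ns"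
    using st by (simp add: stack_def del: nth_append_length)
  then show ?thesis using load[OF env z] by simp
qed

section \<open>Relabelling and the closure of a node\<close>

definition relabel :: "bexp \<Rightarrow> aexp \<Rightarrow> prog" where
  "relabel b e = PFor ''x'' ''n'' (PCond b (PStore ''C'' (Plus (Var ''nn'') (Var ''x'')) e) PSkip)"

lemma meta_relabel [simp]: "modv (relabel b e) = {''x''}" "moda (relabel b e) = {''C''}"
    "bounds (relabel b e) = {''n''}" "counters_ok (relabel b e)"
  by (auto simp: relabel_def)

lemma node_of_store_label:
  assumes "node_of n g = (W, L, c)" "x < n"
  shows "node_of n (g(n * n + x := m)) = (W, L(x := m), c)"
  using assms by (auto simp: node_of_def Wt_upd_high Lt_upd_lab)

lemma relabel:
  assumes env: "env n p k s" and C: "node_of n (arr s ''C'') = (W, L, c)"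
    and X: "X \<subseteq> {..<n}"
    and b: "\<And>t x. \<lbrakk>x < n; var t ''x'' = x; \<And>z. z \<noteq> ''x'' \<Longrightarrow> var t z = var s z;
       \<And>a. a \<noteq> ''C'' \<Longrightarrow> arr t a = arr s a\<rbrakk> \<Longrightarrow> (bval b t \<longleftrightarrow> x \<in> X) \<and> aval e t = Suc i"
  shows "node_of n (arr (sem (relabel b e) s) ''C'') = (W, label X i L, c)"
proof -
  note ev = envD[OF env]
  have "node_of n (arr (sem (relabel b e) s) ''C'') = (W, label (X \<inter> {..<n}) i L, c)"
    unfolding relabel_def
  proof (rule For_induct[where P = "\<lambda>m t. node_of n (arr t ''C'') = (W, label (X \<inter> {..<m}) i L, c)"], goal_cases)
    case 1
    have "label (X \<inter> {..<0}) i L = L" by (simp add: label_def fun_eq_iff)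
    then show ?case using C by simp
  next
    case (2 m t)
    have m: "m < n" using 2(1) ev by simp
    have bm: "(bval b (setv t ''x'' m) \<longleftrightarrow> m \<in> X) \<and> aval e (setv t ''x'' m) = Suc i"
      using 2(3,4) by (intro b[OF m]) auto
    have nn: "var t ''nn'' = n * n" using 2(3)[of "''nn''"] ev by simp
    show ?case
    proof (cases "m \<in> X")
      case True
      have "(label (X \<inter> {..<m}) i L)(m := Suc i) = label (X \<inter> {..<Suc m}) i L"
        using True by (auto simp: label_def fun_eq_iff less_Suc_eq)
      then show ?thesis using node_of_store_label[OF 2(2) m, of "Suc i"] bm nn True by simp
    next
      case False
      have "X \<inter> {..<Suc m} = X \<inter> {..<m}" using False by (auto simp: less_Suc_eq)
      then show ?thesis using 2(2) bm False by simp
    qed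
  next
    case (3 t)
    then show ?case using ev by simp
  qed
  moreover have "X \<inter> {..<n} = X" using X by blast
  ultimately show ?thesis by simp
qed

abbreviation in_class :: "vname \<Rightarrow> bexp" where
  "in_class i \<equiv> eqb lab (Plus (Var i) (Const 1))"

abbreviation in_other :: "vname \<Rightarrow> bexp" where
  "in_other i \<equiv> Conj (posb lab) (Neg (in_class i))"

text \<open>\<open>''tot''\<close> accumulates the lower bound of the closed node. If a flow hits
  its limit, the exact minimum is unknown but above \<open>2 * k\<close>; adding
  \<open>2 * k + 1\<close> then marks the node as hopeless for good.\<close>

definition close :: prog where
  "close = PAssign ''tot'' (Plus (Get ''C'' spent) (Get ''C'' spent)) ;;;
     PFor ''i'' ''p'' (mark ''A'' (in_class ''i'') ;;; mark ''B'' (in_other ''i'') ;;; flow ;;;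
       PCond (Less (Var ''u'') (Var ''n''))
         (PAssign ''tot'' (Plus (Var ''tot'') (Plus (Var ''K'') (Const 1))))
         (PAssign ''tot'' (Plus (Var ''tot'') (Var ''val'')) ;;; PStore ''l'' (Var ''i'') (Var ''val'') ;;;
          relabel (eqb (Get ''M'' (Var ''x'')) (Const 0)) (Plus (Var ''i'') (Const 1))))"

lemma meta_close [simp]:
  "modv close = {''tot'', ''i'', ''x'', ''l'', ''y'', ''u'', ''val'', ''h'', ''q''}"
  "moda close = {''A'', ''B'', ''F'', ''M'', ''X'', ''l'', ''C''}"
  "bounds close = {''n'', ''p'', ''R''}" "counters_ok close"
  by (auto simp: close_def)

definition others :: "nat \<Rightarrow> (nat \<Rightarrow> nat) \<Rightarrow> nat \<Rightarrow> nat set" where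
  "others n L i = {v. v < n \<and> L v \<noteq> 0 \<and> L v \<noteq> Suc i}"

lemma feas_others: "Y \<in> feas n L i \<longleftrightarrow> cls n L i \<subseteq> Y \<and> Y \<subseteq> {..<n} \<and> Y \<inter> others n L i = {}"
  by (auto simp: feas_def others_def)

lemma label_restrict:
  assumes "X \<in> feas n L i"
  shows "label X i L = label {v \<in> X. L v = 0} i L"
proof
  fix v
  show "label X i L v = label {v \<in> X. L v = 0} i L v"
    using assms by (auto simp: label_def feas_def)
qed

lemma lam_label_mono': "X \<in> feas n L i \<Longrightarrow> lam n W L j \<le> lam n W (label X i L) j"
  unfolding label_restrict[of X n L i] by (rule lam_label_mono) simp

text \<open>Solutions are transported only forwards from the initial node, since the converse is
  covered by \<open>valid\<close>. In the hopeless alternative both the register and the true lower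
  bound exceed \<open>2 * k\<close>.\<close>

definition close_inv ::
  "nat \<Rightarrow> nat \<Rightarrow> nat \<Rightarrow> nat list \<Rightarrow> (nat \<Rightarrow> nat \<Rightarrow> nat) \<Rightarrow> node \<Rightarrow> nat \<Rightarrow> node \<Rightarrow> nat \<Rightarrow> (nat \<Rightarrow> nat) \<Rightarrow> bool" where
  "close_inv n p k ts W\<^sub>0 N\<^sub>0 i = (\<lambda>(W, L, c) tot l. valid n ts W\<^sub>0 (W, L, c) \<and>
     ((\<exists>f. solution n p k N\<^sub>0 f) \<longrightarrow> (\<exists>f. solution n p k (W, L, c) f)) \<and>
     lower n p N\<^sub>0 \<le> lower n p (W, L, c) \<and>
     (2 * k < tot \<and> 2 * k < lower n p (W, L, c) \<or>
      tot = 2 * c + (\<Sum>j<i. lam n W L j) \<and> (\<forall>j<i. closed_at n W L j \<and> l j = lam n W L j)))"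

lemma close_inv_stuck:
  assumes inv: "close_inv n p k ts W\<^sub>0 N\<^sub>0 i (W, L, c) tot l" and "i < p"
    and big: "\<And>Y. Y \<in> feas n L i \<Longrightarrow> 2 * k + 2 \<le> cut n W Y"
  shows "close_inv n p k ts W\<^sub>0 N\<^sub>0 (Suc i) (W, L, c) (tot + (2 * k + 1)) l"
proof -
  have "2 * k + 2 \<le> lam n W L i" by (rule lam_greatest[OF big])
  also have "\<dots> \<le> (\<Sum>j<p. lam n W L j)" using \<open>i < p\<close> by (intro member_le_sum) auto
  finally have "2 * k < lower n p (W, L, c)" by simp
  then show ?thesis using inv by (simp add: close_inv_def)
qed

text \<open>One pass over the terminals suffices: enlarging class \<open>i\<close> leaves the other
  classes unchanged and only shrinks their families of feasible sets, so classes closed earlier stay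
  closed with the same minimum.\<close>

lemma close_inv_grow:
  assumes inv: "close_inv n p k ts W\<^sub>0 N\<^sub>0 i (W, L, c) tot l" and "i < p" "p = length ts"
    and X: "largest_min_cut n W (cls n L i) (others n L i) X m"
  shows "close_inv n p k ts W\<^sub>0 N\<^sub>0 (Suc i) (W, label X i L, c) (tot + m) (l(i := m))"
proof -
  let ?L = "label X i L"
  have val: "valid n ts W\<^sub>0 (W, L, c)" and sym: "symmetric W"
    using inv by (auto simp: close_inv_def valid_def)
  have fX: "X \<in> feas n L i" using X by (simp add: feas_others largest_min_cut_def)
  have cX: "cut n W X = m" using X by (simp add: largest_min_cut_def)
  have min: "m \<le> cut n W Y" "cut n W Y = m \<Longrightarrow> Y \<subseteq> X" if "Y \<in> feas n L i" for Y
    using X that by (simp_all add: feas_others largest_min_cut_def)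
  have lamX: "lam n W L i = m"
    using lam_greatest[of n L i m W] min(1) lam_le[OF fX, of W] cX by auto
  have cls_i: "cls n ?L i = X" using fX by (auto simp: cls_def label_def feas_def)
  have sub: "feas n ?L j \<subseteq> feas n L j" for j
  proof
    fix Y assume Y: "Y \<in> feas n ?L j"
    have 1: "L v = 0 \<or> L v = Suc j" if "v \<in> Y" for v
    proof -
      have "?L v = 0 \<or> ?L v = Suc j" using Y that by (simp add: feas_def)
      moreover have "v \<in> X \<Longrightarrow> L v = 0 \<or> L v = Suc i" using fX by (simp add: feas_def)
      ultimately show ?thesis by (auto simp: label_def split: if_splits)
    qed
    have "cls n L j \<subseteq> cls n ?L j"
    proof
      fix v assume v: "v \<in> cls n L j"
      moreover have "v \<in> X \<Longrightarrow> L v = 0 \<or> L v = Suc i" using fX by (simp add: feas_def)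
      ultimately show "v \<in> cls n ?L j" by (auto simp: cls_def label_def)
    qed
    with Y 1 show "Y \<in> feas n L j" by (auto simp: feas_def)
  qed
  have closed_i: "closed_at n W ?L i"
    unfolding closed_at_def cls_i
  proof (intro ballI impI)
    fix Y assume Y: "Y \<in> feas n ?L i" "Y \<noteq> X"
    have "cls n ?L i \<subseteq> Y" using Y(1) by (simp add: feas_def)
    then have "X \<subseteq> Y" by (simp only: cls_i)
    have fY: "Y \<in> feas n L i" using Y(1) sub by blast
    have "cut n W Y \<noteq> m" using min(2)[OF fY] \<open>X \<subseteq> Y\<close> Y(2) by blast
    then show "cut n W X < cut n W Y" using min(1)[OF fY] cX by linarith
  qed
  have lam_i: "lam n W ?L i = m" using closed_at_lam[OF closed_i] cls_i cX by simp
  have other: "closed_at n W ?L j \<and> lam n W ?L j = lam n W L j" if "closed_at n W L j" "j \<noteq> i" for j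
  proof -
    have "?L v = Suc j \<longleftrightarrow> L v = Suc j" for v
    proof (cases "v \<in> X")
      case True
      then have "L v = 0 \<or> L v = Suc i" using fX by (simp add: feas_def)
      then show ?thesis using True that(2) by (auto simp: label_def)
    qed (simp add: label_def)
    then have c: "cls n ?L j = cls n L j" by (simp add: cls_def)
    then have cl: "closed_at n W ?L j" using that(1) sub[of j] unfolding closed_at_def c by blast
    show ?thesis using cl closed_at_lam[OF cl] closed_at_lam[OF that(1)] c by simp
  qed
  have lo: "lower n p (W, L, c) \<le> lower n p (W, ?L, c)"
    using sum_mono[of "{..<p}" "lam n W L" "lam n W ?L"] lam_label_mono'[OF fX] by simp
  have sol: "(\<exists>f. solution n p k (W, ?L, c) f)" if "\<exists>f. solution n p k N\<^sub>0 f"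
  proof -
    from that obtain f where "solution n p k (W, L, c) f" using inv by (auto simp: close_inv_def)
    then show ?thesis by (rule solution_closure[OF sym fX \<open>i < p\<close> trans[OF cX lamX[symmetric]]])
  qed
  have v: "valid n ts W\<^sub>0 (W, ?L, c)"
    using fX \<open>i < p\<close> \<open>p = length ts\<close> by (intro valid_label[OF val]) (auto simp: feas_def)
  have lo0: "lower n p N\<^sub>0 \<le> lower n p (W, ?L, c)" using inv lo by (auto simp: close_inv_def)
  from inv consider "2 * k < tot" "2 * k < lower n p (W, L, c)"
    | "tot = 2 * c + (\<Sum>j<i. lam n W L j)" "\<forall>j<i. closed_at n W L j \<and> l j = lam n W L j"
    unfolding close_inv_def by auto
  then show ?thesis
  proof cases
    case 1
    then have "2 * k < tot + m" "2 * k < lower n p (W, ?L, c)" using lo by linarith+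
    then show ?thesis using v sol lo0 unfolding close_inv_def prod.case by blast
  next
    case 2
    have l': "\<forall>j<Suc i. closed_at n W ?L j \<and> (l(i := m)) j = lam n W ?L j"
      using 2(2) other closed_i lam_i by (auto simp: less_Suc_eq)
    have "(\<Sum>j<i. lam n W ?L j) = (\<Sum>j<i. lam n W L j)"
      using 2(2) other by (intro sum.cong) auto
    then have "tot + m = 2 * c + (\<Sum>j<Suc i. lam n W ?L j)" using 2(1) lam_i by simp
    then show ?thesis using v sol lo0 l' unfolding close_inv_def prod.case by blast
  qed
qed


lemma mark_class:
  assumes env: "env n p k s" and C: "node_of n (arr s ''C'') = (W, L, c)"
    and a: "a \<noteq> ''C''" and z: "var s z = i" "z \<noteq> ''x''"
  shows "marks n (arr (sem (mark a (in_class z)) s) a) = cls n L i"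
    and "marks n (arr (sem (mark a (in_other z)) s) a) = others n L i"
proof -
  note e = envD[OF env]
  have L: "arr s ''C'' (n * n + v) = L v" if "v < n" for v
    using C that by (auto simp: node_of_def Lt_def)
  show "marks n (arr (sem (mark a (in_class z)) s) a) = cls n L i"
    using e a z L by (subst mark(1)[where G = "\<lambda>v. L v = Suc i"]) (auto simp: cls_def)
  show "marks n (arr (sem (mark a (in_other z)) s) a) = others n L i"
    using e a z L by (subst mark(1)[where G = "\<lambda>v. L v \<noteq> 0 \<and> L v \<noteq> Suc i"]) (auto simp: others_def)
qed

lemma close:
  assumes env: "env n p k s" and p: "p = length ts" and C: "node_of n (arr s ''C'') = N\<^sub>0"
    and val: "valid n ts W\<^sub>0 N\<^sub>0"
  defines "s' \<equiv> sem close s"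
  obtains W L c where "node_of n (arr s' ''C'') = (W, L, c)"
    "close_inv n p k ts W\<^sub>0 N\<^sub>0 p (W, L, c) (var s' ''tot'') (arr s' ''l'')"
proof -
  note e = envD[OF env]
  obtain W L\<^sub>0 c where N: "N\<^sub>0 = (W, L\<^sub>0, c)" by (cases N\<^sub>0)
  have spent: "arr s ''C'' (n * n + n) = c" using C N by (simp add: node_of_def)
  let ?s = "setv s ''tot'' (c + c)"
  let ?c = "PCond (Less (Var ''u'') (Var ''n''))
         (PAssign ''tot'' (Plus (Var ''tot'') (Plus (Var ''K'') (Const 1))))
         (PAssign ''tot'' (Plus (Var ''tot'') (Var ''val'')) ;;; PStore ''l'' (Var ''i'') (Var ''val'') ;;;
          relabel (eqb (Get ''M'' (Var ''x'')) (Const 0)) (Plus (Var ''i'') (Const 1)))"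
  let ?b = "mark ''A'' (in_class ''i'') ;;; mark ''B'' (in_other ''i'') ;;; flow ;;; ?c"
  let ?I = "\<lambda>i t. \<exists>L. node_of n (arr t ''C'') = (W, L, c) \<and>
      close_inv n p k ts W\<^sub>0 N\<^sub>0 i (W, L, c) (var t ''tot'') (arr t ''l'')"
  have s': "s' = sem (PFor ''i'' ''p'' ?b) ?s"
    unfolding s'_def close_def using spent e by (simp del: sem.simps(6))
  have "?I p s'"
    unfolding s'
  proof (rule For_induct[where P = ?I], goal_cases)
    case 1
    have "close_inv n p k ts W\<^sub>0 N\<^sub>0 0 (W, L\<^sub>0, c) (c + c) (arr s ''l'')"
      using val by (simp add: close_inv_def N)
    then show ?case using C N by auto
  next
    case (2 i t)
    have i: "i < p" using 2(1) e by simp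
    from 2(2) obtain L where L: "node_of n (arr t ''C'') = (W, L, c)"
      and inv: "close_inv n p k ts W\<^sub>0 N\<^sub>0 i (W, L, c) (var t ''tot'') (arr t ''l'')" by blast
    define t0 where "t0 = setv t ''i'' i"
    define t1 where "t1 = sem (mark ''A'' (in_class ''i'')) t0"
    define t2 where "t2 = sem (mark ''B'' (in_other ''i'')) t1"
    define t3 where "t3 = sem flow t2"
    have env0: "env n p k t0"
    proof (rule env_cong[OF env])
      show "var t0 z = var s z" if "z \<in> envvars" for z
        using 2(3)[of z] that by (auto simp: t0_def)
      show "arr t0 ''r'' = arr s ''r''" using 2(4)[of "''r''"] by (simp add: t0_def)
    qed
    have env1: "env n p k t1" unfolding t1_def by (rule env_sem[OF _ env0]) (simp add: keeps_env_def)
    have env2: "env n p k t2" unfolding t2_def by (rule env_sem[OF _ env1]) (simp add: keeps_env_def)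
    have env3: "env n p k t3" unfolding t3_def by (rule env_sem[OF _ env2]) (simp add: keeps_env_def)
    have C0: "node_of n (arr t0 ''C'') = (W, L, c)" "var t0 ''i'' = i" using L by (simp_all add: t0_def)
    have C1: "node_of n (arr t1 ''C'') = (W, L, c)" "var t1 ''i'' = i"
      using C0 unfolding t1_def by (simp_all add: frame_arr frame_var)
    have C2: "arr t2 ''C'' = arr t ''C''" "arr t2 ''A'' = arr t1 ''A''"
      unfolding t2_def t1_def t0_def by (simp_all add: frame_arr)
    have A: "marks n (arr t2 ''A'') = cls n L i"
      unfolding C2(2) t1_def by (rule mark_class(1)[OF env0 C0(1) _ C0(2)]) simp_all
    have B: "marks n (arr t2 ''B'') = others n L i"
      unfolding t2_def by (rule mark_class(2)[OF env1 C1(1) _ C1(2)]) simp_all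
    have W: "Wt n (arr t2 ''C'') = W" using L C2(1) by (simp add: node_of_def)
    note fl = flow[OF env2 A B, folded t3_def, unfolded W]
    have C3: "arr t3 ''C'' = arr t ''C''" "arr t3 ''l'' = arr t ''l''"
        "var t3 ''tot'' = var t ''tot''" "var t3 ''i'' = i"
      unfolding t3_def t2_def t1_def t0_def by (simp_all add: frame_arr frame_var)
    have e3: "var t3 ''n'' = n" "var t3 ''K'' = 2 * k" "var t3 ''nn'' = n * n" using envD[OF env3] by simp_all
    have run: "sem ?b (setv t ''i'' i) = sem ?c t3"
      by (simp only: sem.simps(4) t0_def t1_def t2_def t3_def)
    show ?case
    proof (cases "var t3 ''u'' = n")
      case False
      have big: "2 * k + 2 \<le> cut n W Y" if "Y \<in> feas n L i" for Y
        using fl(2)[OF False] that by (simp add: feas_others)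
      have "sem ?b (setv t ''i'' i) = setv t3 ''tot'' (var t ''tot'' + (2 * k + 1))"
        unfolding run using fl(3) False e3 C3 by simp
      then show ?thesis using close_inv_stuck[OF inv i big] L C3 by auto
    next
      case True
      let ?X = "{x. x < n \<and> arr t3 ''M'' x = 0}"
      define t4 where "t4 = seta (setv t3 ''tot'' (var t ''tot'' + var t3 ''val'')) ''l'' i (var t3 ''val'')"
      define t5 where "t5 = sem (relabel (eqb (Get ''M'' (Var ''x'')) (Const 0)) (Plus (Var ''i'') (Const 1))) t4"
      have env4: "env n p k t4" using env3 unfolding t4_def by (simp add: env_seta env_setv)
      have L4: "node_of n (arr t4 ''C'') = (W, L, c)" using L C3 by (simp add: t4_def)
      have "node_of n (arr t5 ''C'') = (W, label ?X i L, c)"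
        unfolding t5_def by (rule relabel[OF env4 L4]) (auto simp: t4_def C3(4))
      moreover have "sem ?b (setv t ''i'' i) = t5"
        unfolding run using True e3 C3 by (simp add: t4_def t5_def)
      moreover have "arr t5 ''l'' = (arr t ''l'')(i := var t3 ''val'')" "var t5 ''tot'' = var t ''tot'' + var t3 ''val''"
        unfolding t5_def by (simp_all add: frame_arr frame_var t4_def C3)
      ultimately show ?thesis using close_inv_grow[OF inv i p fl(1)[OF True]] by auto
    qed
  next
    case (3 t)
    then show ?case using e by simp
  qed
  then show ?thesis using that by blast
qed

section \<open>Choosing a branching set\<close>

definition loose :: "nat \<Rightarrow> (nat \<Rightarrow> nat \<Rightarrow> nat) \<Rightarrow> (nat \<Rightarrow> nat) \<Rightarrow> nat \<Rightarrow> nat \<Rightarrow> bool" where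
  "loose n W L i v \<longleftrightarrow> (\<forall>Y\<in>feas n L i. v \<in> Y \<longrightarrow> lam n W L i + 2 \<le> cut n W Y)"

definition tight :: "nat \<Rightarrow> (nat \<Rightarrow> nat \<Rightarrow> nat) \<Rightarrow> (nat \<Rightarrow> nat) \<Rightarrow> nat \<Rightarrow> nat set \<Rightarrow> bool" where
  "tight n W L i U \<longleftrightarrow> cut n W (cls n L i \<union> U) = lam n W L i + 1 \<and>
     (\<forall>Z\<in>feas n L i. cls n L i \<union> U \<subset> Z \<longrightarrow> lam n W L i + 2 \<le> cut n W Z)"

text \<open>The value \<open>0\<close> of \<open>m\<close> encodes that no tight set contains \<open>v\<close>.\<close>

definition report :: "nat \<Rightarrow> (nat \<Rightarrow> nat \<Rightarrow> nat) \<Rightarrow> (nat \<Rightarrow> nat) \<Rightarrow> nat \<Rightarrow> nat \<Rightarrow> nat \<Rightarrow> nat set \<Rightarrow> bool" where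
  "report n W L i v m U \<longleftrightarrow> m = 0 \<and> loose n W L i v \<or>
     0 < m \<and> m = card U \<and> v \<in> U \<and> tight n W L i U \<and>
     (\<forall>Z\<in>feas n L i. v \<in> Z \<longrightarrow> cut n W Z = lam n W L i + 1 \<longrightarrow> Z \<subseteq> cls n L i \<union> U)"

definition candidate :: "nat \<Rightarrow> (nat \<Rightarrow> nat \<Rightarrow> nat) \<Rightarrow> (nat \<Rightarrow> nat) \<Rightarrow> nat \<Rightarrow> nat \<Rightarrow> nat set \<Rightarrow> bool" where
  "candidate n W L i m U \<longleftrightarrow> U \<subseteq> {v. v < n \<and> L v = 0} \<and> 0 < between n W (cls n L i) U \<and>
     (if m = 0 then \<exists>v. U = {v} \<and> loose n W L i v else tight n W L i U \<and> m = card U)"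

lemma feas_insert: "v < n \<Longrightarrow> L v = 0 \<Longrightarrow>
    insert v (cls n L i) \<subseteq> Y \<and> Y \<subseteq> {..<n} \<and> Y \<inter> others n L i = {} \<longleftrightarrow> Y \<in> feas n L i \<and> v \<in> Y"
  by (auto simp: feas_others)

text \<open>Any strict superset of \<open>X\<close> still contains \<open>v\<close>. It cannot have
  the minimum value, since \<open>X\<close> is the largest such set, so it costs at least one unit
  more; this gives the maximality in \<open>tight\<close>.\<close>

lemma report_tight:
  assumes cl: "closed_at n W L i" and v: "v < n" "L v = 0"
    and X: "largest_min_cut n W (insert v (cls n L i)) (others n L i) X (lam n W L i + 1)"
  shows "report n W L i v (card {x \<in> X. L x = 0}) {x \<in> X. L x = 0}"
proof -
  let ?U = "{x \<in> X. L x = 0}"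
  have fX: "X \<in> feas n L i" "v \<in> X"
    using X feas_insert[of v n L i X] v unfolding largest_min_cut_def by blast+
  have XU: "X = cls n L i \<union> ?U" using fX(1) by (auto simp: feas_def cls_def)
  have cX: "cut n W X = lam n W L i + 1" using X by (simp add: largest_min_cut_def)
  have min: "lam n W L i + 1 \<le> cut n W Y" "cut n W Y = lam n W L i + 1 \<Longrightarrow> Y \<subseteq> X"
    if "Y \<in> feas n L i" "v \<in> Y" for Y
    using X that feas_insert[of v n L i Y] v unfolding largest_min_cut_def by blast+
  have "lam n W L i + 2 \<le> cut n W Z" if Z: "Z \<in> feas n L i" "X \<subset> Z" for Z
  proof -
    have "v \<in> Z" using Z(2) fX(2) by blast
    then have "cut n W Z \<noteq> lam n W L i + 1" using min(2)[OF Z(1)] Z(2) by blast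
    then show ?thesis using min(1)[OF Z(1) \<open>v \<in> Z\<close>] by linarith
  qed
  then have "tight n W L i ?U" unfolding tight_def XU[symmetric] using cX by blast
  moreover have "finite ?U" using feas_finite[OF fX(1)] by simp
  then have "0 < card ?U" using fX(2) v(2) by (auto simp: card_gt_0_iff)
  ultimately show ?thesis unfolding report_def XU[symmetric] using min(2) fX(2) v(2) by blast
qed

lemma report_loose:
  assumes cl: "closed_at n W L i" and v: "v < n" "L v = 0"
    and X: "largest_min_cut n W (insert v (cls n L i)) (others n L i) X m" and m: "m \<noteq> lam n W L i + 1"
  shows "report n W L i v 0 U"
proof -
  have fX: "X \<in> feas n L i" "v \<in> X"
    using X feas_insert[of v n L i X] v unfolding largest_min_cut_def by blast+
  have "X \<noteq> cls n L i" using fX(2) v(2) by (auto simp: cls_def)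
  then have "lam n W L i < m" using closed_at_gt[OF cl fX(1)] X by (simp add: largest_min_cut_def)
  then have "lam n W L i + 2 \<le> m" using m by linarith
  moreover have "m \<le> cut n W Y" if "Y \<in> feas n L i" "v \<in> Y" for Y
    using X that feas_insert[of v n L i Y] v unfolding largest_min_cut_def by blast
  ultimately show ?thesis unfolding report_def loose_def by (meson le_trans)
qed

lemma report_stuck:
  assumes v: "v < n" "L v = 0" and le: "lam n W L i \<le> 2 * k"
    and big: "\<And>Y. insert v (cls n L i) \<subseteq> Y \<Longrightarrow> Y \<subseteq> {..<n} \<Longrightarrow> Y \<inter> others n L i = {} \<Longrightarrow> 2 * k + 2 \<le> cut n W Y"
  shows "report n W L i v 0 U"
proof -
  have "2 * k + 2 \<le> cut n W Y" if "Y \<in> feas n L i" "v \<in> Y" for Y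
    using big[of Y] that feas_insert[of v n L i Y] v by blast
  then have "loose n W L i v" using le unfolding loose_def by fastforce
  then show ?thesis by (simp add: report_def)
qed

lemma candidate_report:
  assumes r: "report n W L i v m U" and v: "v < n" "L v = 0" and adj: "0 < between n W (cls n L i) {v}"
    and U: "U \<subseteq> {v. v < n \<and> L v = 0}"
  shows "candidate n W L i m (if 0 < m then U else {v})"
proof (cases "0 < m")
  case True
  then have "v \<in> U" "tight n W L i U" "m = card U" using r by (auto simp: report_def)
  moreover from this have "between n W (cls n L i) {v} \<le> between n W (cls n L i) U"
    by (intro between_mono) auto
  ultimately show ?thesis using True U adj by (simp add: candidate_def)
next
  case False
  then show ?thesis using r v adj by (simp add: candidate_def report_def)
qed

definition pairs :: "nat \<Rightarrow> nat \<Rightarrow> nat \<Rightarrow> (nat \<times> nat) set" where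
  "pairs n i m = {(j, v). v < n \<and> (j < i \<or> j = i \<and> v < m)}"

lemma pairs_Suc: "m < n \<Longrightarrow> pairs n i (Suc m) = insert (i, m) (pairs n i m)"
  and pairs_row: "pairs n i n = pairs n (Suc i) 0"
  by (auto simp: pairs_def less_Suc_eq)

text \<open>Records \<open>best\<close> as a bound on the free part of every tight set containing an
  examined vertex adjacent to its class. Once all pairs are examined this yields the assumption
  \<open>largest\<close> of the tight branching.\<close>

definition covered ::
  "nat \<Rightarrow> (nat \<Rightarrow> nat \<Rightarrow> nat) \<Rightarrow> (nat \<Rightarrow> nat) \<Rightarrow> (nat \<times> nat) set \<Rightarrow> nat \<Rightarrow> bool" where
  "covered n W L Z best \<longleftrightarrow>
     (\<forall>j v Y. (j, v) \<in> Z \<longrightarrow> L v = 0 \<longrightarrow> 0 < between n W (cls n L j) {v} \<longrightarrow>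
        Y \<in> feas n L j \<longrightarrow> v \<in> Y \<longrightarrow> cut n W Y = lam n W L j + 1 \<longrightarrow> card (Y - cls n L j) \<le> best)"

text \<open>\<open>i = p\<close>, which is not a terminal index, encodes that no candidate has been
  met. A candidate with \<open>best = 0\<close> is a loose vertex and gives way to any tight
  set.\<close>

definition select_inv ::
  "nat \<Rightarrow> nat \<Rightarrow> (nat \<Rightarrow> nat \<Rightarrow> nat) \<Rightarrow> (nat \<Rightarrow> nat) \<Rightarrow> (nat \<times> nat) set \<Rightarrow> nat \<Rightarrow> nat \<Rightarrow> nat set \<Rightarrow> bool" where
  "select_inv n p W L Z best i U \<longleftrightarrow> covered n W L Z best \<and>
     (i = p \<and> best = 0 \<and> (\<forall>j v. (j, v) \<in> Z \<longrightarrow> L v = 0 \<longrightarrow> between n W (cls n L j) {v} = 0) \<or>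
      i < p \<and> candidate n W L i best U)"

lemma covered_insert:
  assumes cov: "covered n W L Z b" and "b \<le> m"
    and new: "\<And>Y. \<lbrakk>L v = 0; 0 < between n W (cls n L j) {v}; Y \<in> feas n L j; v \<in> Y;
      cut n W Y = lam n W L j + 1\<rbrakk> \<Longrightarrow> card (Y - cls n L j) \<le> m"
  shows "covered n W L (insert (j, v) Z) m"
  unfolding covered_def
proof (intro allI impI)
  fix l w Y
  assume lw: "(l, w) \<in> insert (j, v) Z" and rest: "L w = 0" "0 < between n W (cls n L l) {w}"
    "Y \<in> feas n L l" "w \<in> Y" "cut n W Y = lam n W L l + 1"
  show "card (Y - cls n L l) \<le> m"
  proof (cases "l = j \<and> w = v")
    case True
    then show ?thesis using new[of Y] rest by blast
  next
    case False
    then have "(l, w) \<in> Z" using lw by blast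
    then have "card (Y - cls n L l) \<le> b" using cov rest unfolding covered_def by blast
    then show ?thesis using \<open>b \<le> m\<close> by (rule le_trans)
  qed
qed

lemma select_inv_skip:
  assumes inv: "select_inv n p W L Z best i U" and no: "L v \<noteq> 0 \<or> between n W (cls n L j) {v} = 0"
  shows "select_inv n p W L (insert (j, v) Z) best i U"
proof -
  have cov: "covered n W L (insert (j, v) Z) best"
    using inv no by (intro covered_insert[where b = best]) (auto simp: select_inv_def)
  from inv consider "i = p" "best = 0" "\<forall>j v. (j, v) \<in> Z \<longrightarrow> L v = 0 \<longrightarrow> between n W (cls n L j) {v} = 0"
    | "i < p" "candidate n W L i best U"
    unfolding select_inv_def by blast
  then show ?thesis
  proof cases
    case 1
    then have "\<forall>l w. (l, w) \<in> insert (j, v) Z \<longrightarrow> L w = 0 \<longrightarrow> between n W (cls n L l) {w} = 0"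
      using no by auto
    with cov 1 show ?thesis unfolding select_inv_def by blast
  next
    case 2
    with cov show ?thesis unfolding select_inv_def by blast
  qed
qed

lemma report_card:
  assumes r: "report n W L j v m U" and U: "U \<subseteq> {v. v < n \<and> L v = 0}"
    and Y: "Y \<in> feas n L j" "v \<in> Y" "cut n W Y = lam n W L j + 1"
  shows "card (Y - cls n L j) \<le> m"
proof -
  have "\<not> loose n W L j v" using Y by (auto simp: loose_def)
  then have "m = card U" "Y \<subseteq> cls n L j \<union> U" using r Y unfolding report_def by blast+
  moreover have "finite U" using U by (rule finite_subset) simp
  ultimately show ?thesis by (auto intro: card_mono)
qed

lemma select_inv_update:
  assumes inv: "select_inv n p W L Z best i U" and j: "j < p" and v: "v < n" "L v = 0"
    and adj: "0 < between n W (cls n L j) {v}"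
    and r: "report n W L j v m U'" and U': "U' \<subseteq> {v. v < n \<and> L v = 0}"
    and better: "best < m \<or> best = 0"
  shows "select_inv n p W L (insert (j, v) Z) m j (if 0 < m then U' else {v})"
proof -
  have "covered n W L (insert (j, v) Z) m"
  proof (rule covered_insert)
    show "covered n W L Z best" using inv by (simp add: select_inv_def)
    show "best \<le> m" using better by auto
  qed (rule report_card[OF r U'])
  then show ?thesis unfolding select_inv_def using j candidate_report[OF r v adj U'] by blast
qed

lemma select_inv_keep:
  assumes inv: "select_inv n p W L Z best i U"
    and r: "report n W L j v m U'" and U': "U' \<subseteq> {v. v < n \<and> L v = 0}"
    and worse: "\<not> (best < m \<or> best = 0)"
  shows "select_inv n p W L (insert (j, v) Z) best i U"
proof -
  have "covered n W L (insert (j, v) Z) best"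
  proof (rule covered_insert)
    show "covered n W L Z best" using inv by (simp add: select_inv_def)
    show "card (Y - cls n L j) \<le> best"
      if "Y \<in> feas n L j" "v \<in> Y" "cut n W Y = lam n W L j + 1" for Y
      using report_card[OF r U' that] worse by linarith
  qed simp
  moreover have "i < p \<and> candidate n W L i best U"
    using inv worse unfolding select_inv_def by blast
  ultimately show ?thesis unfolding select_inv_def by blast
qed

section \<open>Probing one terminal and one vertex by a flow computation\<close>

definition in_free :: bexp where
  "in_free = Conj (eqb (Get ''M'' (Var ''x'')) (Const 0)) (eqb lab (Const 0))"

definition count_free :: prog where
  "count_free = PFor ''x'' ''n'' (PCond in_free (PAssign ''sz'' (Plus (Var ''sz'') (Const 1))) PSkip)"

lemma meta_count_free [simp]: "modv count_free = {''x'', ''sz''}" "moda count_free = {}"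
    "bounds count_free = {''n''}" "counters_ok count_free"
  by (auto simp: count_free_def)

lemma bval_in_free:
  assumes "env n p k s" "node_of n (arr s ''C'') = (W, L, c)" "x < n"
    and "var t ''x'' = x" "var t ''nn'' = var s ''nn''" "arr t ''C'' = arr s ''C''" "arr t ''M'' = arr s ''M''"
  shows "bval in_free t \<longleftrightarrow> x \<in> {x. x < n \<and> arr s ''M'' x = 0 \<and> L x = 0}"
  using assms envD(3)[OF assms(1)] by (auto simp: in_free_def node_of_def Lt_def)

lemma count_free:
  assumes env: "env n p k s" and C: "node_of n (arr s ''C'') = (W, L, c)"
  shows "var (sem count_free s) ''sz'' = var s ''sz'' + card {x. x < n \<and> arr s ''M'' x = 0 \<and> L x = 0}"
proof -
  let ?U = "{x. x < n \<and> arr s ''M'' x = 0 \<and> L x = 0}"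
  have "var (sem count_free s) ''sz'' = var s ''sz'' + card (?U \<inter> {..<n})"
    unfolding count_free_def
  proof (rule For_induct[where P = "\<lambda>i t. var t ''sz'' = var s ''sz'' + card (?U \<inter> {..<i})"], goal_cases)
    case (2 i t)
    have i: "i < n" using 2(1) envD(1)[OF env] by simp
    have b: "bval in_free (setv t ''x'' i) \<longleftrightarrow> i \<in> ?U"
      by (rule bval_in_free[OF env C i]) (simp_all add: 2(3,4))
    show ?case
    proof (cases "i \<in> ?U")
      case True
      have "?U \<inter> {..<Suc i} = insert i (?U \<inter> {..<i})" using True by (auto simp: less_Suc_eq)
      then show ?thesis using True b 2(2) by simp
    next
      case False
      have "?U \<inter> {..<Suc i} = ?U \<inter> {..<i}" using False by (auto simp: less_Suc_eq)
      then show ?thesis using False b 2(2) by simp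
    qed
  next
    case (3 t)
    then show ?case using envD(1)[OF env] by simp
  qed simp
  moreover have "?U \<inter> {..<n} = ?U" by auto
  ultimately show ?thesis by simp
qed

definition probe :: prog where
  "probe = mark ''A'' (Neg (Conj (Neg (in_class ''i'')) (Neg (eqb (Var ''x'') (Var ''v''))))) ;;;
     mark ''B'' (in_other ''i'') ;;; flow ;;; PAssign ''sz'' (Const 0) ;;;
     PCond (Conj (Neg (Less (Var ''u'') (Var ''n''))) (eqb (Var ''val'') (Plus (Get ''l'' (Var ''i'')) (Const 1))))
       count_free PSkip"

lemma meta_probe [simp]: "modv probe = {''x'', ''l'', ''y'', ''u'', ''val'', ''h'', ''q'', ''sz''}"
    "moda probe = {''A'', ''B'', ''F'', ''M'', ''X''}" "bounds probe = {''n'', ''R''}" "counters_ok probe"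
  by (auto simp: probe_def)

lemma probe:
  assumes env: "env n p k s" and C: "node_of n (arr s ''C'') = (W, L, c)"
    and i: "var s ''i'' = i" and v: "var s ''v'' = v" "v < n" "L v = 0"
    and cl: "closed_at n W L i" and l: "arr s ''l'' i = lam n W L i" and le: "lam n W L i \<le> 2 * k"
  shows "report n W L i v (var (sem probe s) ''sz'') {x. x < n \<and> arr (sem probe s) ''M'' x = 0 \<and> L x = 0}"
proof -
  let ?b = "Neg (Conj (Neg (in_class ''i'')) (Neg (eqb (Var ''x'') (Var ''v''))))"
  let ?c = "PCond (Conj (Neg (Less (Var ''u'') (Var ''n''))) (eqb (Var ''val'') (Plus (Get ''l'' (Var ''i'')) (Const 1))))
       count_free PSkip"
  define s1 where "s1 = sem (mark ''A'' ?b) s"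
  define s2 where "s2 = sem (mark ''B'' (in_other ''i'')) s1"
  define s3 where "s3 = setv (sem flow s2) ''sz'' 0"
  have run: "sem probe s = sem ?c s3"
    by (simp only: probe_def sem.simps(4) s1_def s2_def s3_def sem.simps(2) aval.simps)
  have env1: "env n p k s1" unfolding s1_def by (rule env_sem[OF _ env]) (simp add: keeps_env_def)
  have env2: "env n p k s2" unfolding s2_def by (rule env_sem[OF _ env1]) (simp add: keeps_env_def)
  have envf: "env n p k (sem flow s2)" by (rule env_sem[OF _ env2]) (simp add: keeps_env_def)
  then have env3: "env n p k s3" unfolding s3_def by (simp add: env_setv)
  have L: "arr s ''C'' (n * n + x) = L x" if "x < n" for x
    using C that by (auto simp: node_of_def Lt_def)
  have "marks n (arr s1 ''A'') = insert v (cls n L i)"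
    unfolding s1_def using envD[OF env] i v L
    by (subst mark(1)[where G = "\<lambda>x. L x = Suc i \<or> x = v"]) (auto simp: cls_def)
  then have A: "marks n (arr s2 ''A'') = insert v (cls n L i)"
    unfolding s2_def by (simp add: frame_arr)
  have C1: "node_of n (arr s1 ''C'') = (W, L, c)" "var s1 ''i'' = i"
    using C i unfolding s1_def by (simp_all add: frame_arr frame_var)
  have B: "marks n (arr s2 ''B'') = others n L i"
    unfolding s2_def by (rule mark_class(2)[OF env1 C1(1) _ C1(2)]) simp_all
  have C2: "node_of n (arr s2 ''C'') = (W, L, c)"
    using C1 unfolding s2_def by (simp add: frame_arr)
  then have W: "Wt n (arr s2 ''C'') = W" by (simp add: node_of_def)
  note fl = flow[OF env2 A B, unfolded W]
  have C3: "node_of n (arr s3 ''C'') = (W, L, c)" "arr s3 ''l'' = arr s ''l''" "var s3 ''i'' = i"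
      "var s3 ''sz'' = 0" "var s3 ''u'' = var (sem flow s2) ''u''" "var s3 ''val'' = var (sem flow s2) ''val''"
      "arr s3 ''M'' = arr (sem flow s2) ''M''"
    using C2 i unfolding s3_def s2_def s1_def by (simp_all add: frame_arr frame_var)
  have e3: "var s3 ''n'' = n" using envD[OF env3] by simp
  have M: "arr (sem probe s) ''M'' = arr s3 ''M''" unfolding run by (simp add: frame_arr)
  show ?thesis
  proof (cases "var s3 ''u'' = n")
    case False
    then have "sem probe s = s3" unfolding run using fl(3) C3 e3 by simp
    then have "var (sem probe s) ''sz'' = 0" using C3 by simp
    moreover have "report n W L i v 0 U" for U
      by (rule report_stuck[OF v(2,3) le]) (use fl(2) False C3 in auto)
    ultimately show ?thesis by simp
  next
    case True
    then have X: "largest_min_cut n W (insert v (cls n L i)) (others n L i)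
        {x. x < n \<and> arr s3 ''M'' x = 0} (var s3 ''val'')"
      using fl(1) C3 by simp
    show ?thesis
    proof (cases "var s3 ''val'' = lam n W L i + 1")
      case False
      then have "sem probe s = s3" unfolding run using C3 l by simp
      then have "var (sem probe s) ''sz'' = 0" using C3 by simp
      then show ?thesis using report_loose[OF cl v(2,3) X False] by simp
    next
      case t: True
      then have "sem probe s = sem count_free s3" unfolding run using C3 l True e3 by simp
      then have "var (sem probe s) ''sz'' = card {x. x < n \<and> arr s3 ''M'' x = 0 \<and> L x = 0}"
        using count_free[OF env3 C3(1)] C3 by simp
      then show ?thesis using report_tight[OF cl v(2,3) X[unfolded t]] M by simp
    qed
  qed
qed


definition record_best :: prog where
  "record_best = PCond (Neg (Conj (Neg (Less (Var ''best'') (Var ''sz''))) (posb (Var ''best''))))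
     (PAssign ''best'' (Var ''sz'') ;;; PAssign ''bi'' (Var ''i'') ;;;
      PCond (posb (Var ''sz'')) (mark ''U'' in_free) (mark ''U'' (eqb (Var ''x'') (Var ''v'')))) PSkip"

lemma meta_record_best [simp]: "modv record_best = {''x'', ''best'', ''bi''}" "moda record_best = {''U''}"
    "bounds record_best = {''n''}" "counters_ok record_best"
  by (auto simp: record_best_def)

lemma record_best:
  assumes env: "env n p k s" and C: "node_of n (arr s ''C'') = (W, L, c)"
    and v: "var s ''v'' = v" "v < n" and better: "var s ''best'' < var s ''sz'' \<or> var s ''best'' = 0"
  shows "var (sem record_best s) ''best'' = var s ''sz''" "var (sem record_best s) ''bi'' = var s ''i''"
    and "marks n (arr (sem record_best s) ''U'') =
      (if 0 < var s ''sz'' then {x. x < n \<and> arr s ''M'' x = 0 \<and> L x = 0} else {v})"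
proof -
  let ?s = "setv (setv s ''best'' (var s ''sz'')) ''bi'' (var s ''i'')"
  have run: "sem record_best s = (if 0 < var s ''sz'' then sem (mark ''U'' in_free) ?s
      else sem (mark ''U'' (eqb (Var ''x'') (Var ''v''))) ?s)"
    using better by (auto simp: record_best_def)
  have n: "var ?s ''n'' = n" using envD(1)[OF env] by simp
  show "var (sem record_best s) ''best'' = var s ''sz''" "var (sem record_best s) ''bi'' = var s ''i''"
    unfolding run by (simp_all add: frame_var)
  have 1: "marks n (arr (sem (mark ''U'' in_free) ?s) ''U'') =
      {x. x < n \<and> x \<in> {x. x < n \<and> arr s ''M'' x = 0 \<and> L x = 0}}"
    by (rule mark(1)[OF n], rule bval_in_free[OF env C]) simp_all
  have 2: "marks n (arr (sem (mark ''U'' (eqb (Var ''x'') (Var ''v''))) ?s) ''U'') = {x. x < n \<and> x = v}"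
    using v by (intro mark(1)[OF n]) auto
  have 3: "{x. x < n \<and> x = v} = {v}" using v(2) by auto
  show "marks n (arr (sem record_best s) ''U'') =
      (if 0 < var s ''sz'' then {x. x < n \<and> arr s ''M'' x = 0 \<and> L x = 0} else {v})"
    unfolding run using 1 2 3 by (cases "0 < var s ''sz''") (simp_all only: if_True if_False mem_Collect_eq conj_ac, auto)
qed

definition examine :: prog where
  "examine = PCond (eqb (Get ''C'' (Plus (Var ''nn'') (Var ''v''))) (Const 0))
     (mark ''P'' (in_class ''i'') ;;; mark ''Q'' (eqb (Var ''x'') (Var ''v'')) ;;; sumw ;;;
      PCond (posb (Var ''a'')) (probe ;;; record_best) PSkip) PSkip"

lemma meta_examine [simp]:
  "modv examine = {''x'', ''l'', ''y'', ''u'', ''val'', ''h'', ''q'', ''sz'', ''best'', ''bi'', ''a''}"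
  "moda examine = {''A'', ''B'', ''F'', ''M'', ''X'', ''U'', ''P'', ''Q''}"
  "bounds examine = {''n'', ''R''}" "counters_ok examine"
  by (auto simp: examine_def)

lemma examine:
  assumes env: "env n p k s" and C: "node_of n (arr s ''C'') = (W, L, c)"
    and i: "var s ''i'' = i" "i < p" and v: "var s ''v'' = v" "v < n"
    and cl: "closed_at n W L i" and l: "arr s ''l'' i = lam n W L i" and le: "lam n W L i \<le> 2 * k"
    and inv: "select_inv n p W L Z (var s ''best'') (var s ''bi'') (marks n (arr s ''U''))"
  shows "select_inv n p W L (insert (i, v) Z) (var (sem examine s) ''best'') (var (sem examine s) ''bi'')
    (marks n (arr (sem examine s) ''U''))"
proof -
  note e = envD[OF env]
  have Lv: "arr s ''C'' (n * n + v) = L v" using C v(2) by (auto simp: node_of_def Lt_def)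
  show ?thesis
  proof (cases "L v = 0")
    case False
    then have "sem examine s = s" using Lv e v by (simp add: examine_def)
    then show ?thesis using select_inv_skip[OF inv] False by simp
  next
    case L0: True
    define s1 where "s1 = sem (mark ''P'' (in_class ''i'')) s"
    define s2 where "s2 = sem (mark ''Q'' (eqb (Var ''x'') (Var ''v''))) s1"
    define s3 where "s3 = sem sumw s2"
    let ?c = "PCond (posb (Var ''a'')) (probe ;;; record_best) PSkip"
    have run: "sem examine s = sem ?c s3"
      using Lv e v L0 by (simp add: examine_def s1_def s2_def s3_def)
    have env1: "env n p k s1" unfolding s1_def by (rule env_sem[OF _ env]) (simp add: keeps_env_def)
    have env2: "env n p k s2" unfolding s2_def by (rule env_sem[OF _ env1]) (simp add: keeps_env_def)
    have env3: "env n p k s3" unfolding s3_def by (rule env_sem[OF _ env2]) (simp add: keeps_env_def)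
    have fr: "arr s3 ''C'' = arr s ''C''" "arr s2 ''C'' = arr s ''C''" "var s3 ''i'' = i" "var s3 ''v'' = v"
      "arr s3 ''l'' = arr s ''l''" "arr s3 ''U'' = arr s ''U''"
      "var s3 ''best'' = var s ''best''" "var s3 ''bi'' = var s ''bi''" "arr s2 ''P'' = arr s1 ''P''"
      using i v unfolding s3_def s2_def s1_def by (simp_all add: frame_arr frame_var)
    have P: "marks n (arr s2 ''P'') = cls n L i"
      unfolding fr s1_def by (rule mark_class(1)[OF env C _ i(1)]) simp_all
    have "var s1 ''v'' = v" unfolding s1_def using v by (simp add: frame_var)
    then have Q: "marks n (arr s2 ''Q'') = {v}"
      unfolding s2_def using envD(1)[OF env1] v(2)
      by (subst mark(1)[where G = "\<lambda>x. x = v"]) auto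
    have W: "Wt n (arr s2 ''C'') = W" using C fr by (simp add: node_of_def)
    have a: "var s3 ''a'' = between n W (cls n L i) {v}"
      unfolding s3_def sumw[OF env2] P Q W ..
    show ?thesis
    proof (cases "between n W (cls n L i) {v} = 0")
      case True
      then have "sem examine s = s3" unfolding run using a by simp
      then show ?thesis using select_inv_skip[OF inv, of v i] True fr by simp
    next
      case False
      define s4 where "s4 = sem probe s3"
      have run': "sem examine s = sem record_best s4" unfolding run using a False by (simp add: s4_def)
      have C3: "node_of n (arr s3 ''C'') = (W, L, c)" "arr s3 ''l'' i = lam n W L i" using C fr l by simp_all
      let ?U = "{x. x < n \<and> arr s4 ''M'' x = 0 \<and> L x = 0}"
      have r: "report n W L i v (var s4 ''sz'') ?U"
        unfolding s4_def by (rule probe[OF env3 C3(1) fr(3,4) v(2) L0 cl C3(2) le])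
      have env4: "env n p k s4" unfolding s4_def by (rule env_sem[OF _ env3]) (simp add: keeps_env_def)
      have fr4: "node_of n (arr s4 ''C'') = (W, L, c)" "var s4 ''v'' = v" "var s4 ''i'' = i"
        "var s4 ''best'' = var s ''best''" "var s4 ''bi'' = var s ''bi''" "arr s4 ''U'' = arr s ''U''"
        unfolding s4_def using C3 fr by (simp_all add: frame_arr frame_var)
      have U: "?U \<subseteq> {v. v < n \<and> L v = 0}" by auto
      show ?thesis
      proof (cases "var s ''best'' < var s4 ''sz'' \<or> var s ''best'' = 0")
        case True
        then have b: "var s4 ''best'' < var s4 ''sz'' \<or> var s4 ''best'' = 0" using fr4 by simp
        have adj: "0 < between n W (cls n L i) {v}" using False by simp
        show ?thesis
          unfolding run' record_best[OF env4 fr4(1,2) v(2) b] fr4(3)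
          by (rule select_inv_update[OF inv i(2) v(2) L0 adj r U True])
      next
        case worse: False
        then have "sem record_best s4 = s4" using fr4 by (auto simp: record_best_def)
        then show ?thesis unfolding run' using select_inv_keep[OF inv r U worse] fr4 by simp
      qed
    qed
  qed
qed

definition select :: prog where
  "select = PAssign ''best'' (Const 0) ;;; PAssign ''bi'' (Var ''p'') ;;;
     PFor ''i'' ''p'' (PFor ''v'' ''n'' examine)"

lemma meta_select [simp]:
  "modv select = {''x'', ''l'', ''y'', ''u'', ''val'', ''h'', ''q'', ''sz'', ''best'', ''bi'', ''a'', ''i'', ''v''}"
  "moda select = {''A'', ''B'', ''F'', ''M'', ''X'', ''U'', ''P'', ''Q''}"
  "bounds select = {''n'', ''p'', ''R''}" "counters_ok select"
  by (auto simp: select_def)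

lemma select:
  assumes env: "env n p k s" and C: "node_of n (arr s ''C'') = (W, L, c)"
    and cl: "\<And>j. j < p \<Longrightarrow> closed_at n W L j" and l: "\<And>j. j < p \<Longrightarrow> arr s ''l'' j = lam n W L j"
    and le: "\<And>j. j < p \<Longrightarrow> lam n W L j \<le> 2 * k"
  shows "select_inv n p W L (pairs n p 0) (var (sem select s) ''best'') (var (sem select s) ''bi'')
    (marks n (arr (sem select s) ''U''))"
proof -
  note e = envD[OF env]
  let ?s = "setv (setv s ''best'' 0) ''bi'' p"
  let ?I = "\<lambda>i m t. select_inv n p W L (pairs n i m) (var t ''best'') (var t ''bi'') (marks n (arr t ''U''))"
  have run: "sem select s = sem (PFor ''i'' ''p'' (PFor ''v'' ''n'' examine)) ?s"
    using e by (simp add: select_def del: sem.simps(6))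
  show ?thesis
    unfolding run
  proof (rule For_induct[where P = "\<lambda>i. ?I i 0"], goal_cases)
    case 1
    show ?case by (simp add: select_inv_def covered_def pairs_def)
  next
    case (2 i t)
    note o2 = 2
    have i: "i < p" using 2(1) e by simp
    show ?case
    proof (rule For_induct[where P = "?I i"], goal_cases)
      case 1
      show ?case using o2(2) by simp
    next
      case (2 m t')
      have m: "m < n" using 2(1) o2(3)[of "''n''"] e by simp
      let ?t = "setv t' ''v'' m"
      have var: "var t' z = var s z" if "z \<in> envvars" for z
        using 2(3)[of z] o2(3)[of z] that by auto
      have arr: "arr t' z = arr s z" if "z \<in> {''C'', ''l'', ''r''}" for z
        using 2(4)[of z] o2(4)[of z] that by auto
      have envt: "env n p k ?t"
        by (rule env_cong[OF env]) (use var arr[of "''r''"] in auto)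
      have Ct: "node_of n (arr ?t ''C'') = (W, L, c)" using arr[of "''C''"] C by simp
      have it: "var ?t ''i'' = i" using 2(3)[of "''i''"] by simp
      have vt: "var ?t ''v'' = m" by simp
      have lt: "arr ?t ''l'' i = lam n W L i" using arr[of "''l''"] l[OF i] by simp
      have inv: "select_inv n p W L (pairs n i m) (var ?t ''best'') (var ?t ''bi'') (marks n (arr ?t ''U''))"
        using 2(2) by simp
      show ?case
        unfolding pairs_Suc[OF m] by (rule examine[OF envt Ct it i vt m cl[OF i] lt le[OF i] inv])
    next
      case (3 t')
      have "var t ''n'' = n" using o2(3)[of "''n''"] e by simp
      then show ?case using 3(1) by (simp add: pairs_row)
    qed
  next
    case (3 t)
    then show ?case using e by simp
  qed
qed

section \<open>Generating the successors\<close>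

lemma select_branching:
  assumes sym: "symmetric W" and cl: "\<And>j. j < p \<Longrightarrow> closed_at n W L j"
    and alive: "k \<le> lower n p (W, L, c)" "lower n p (W, L, c) \<le> 2 * k"
    and inv: "select_inv n p W L (pairs n p 0) best i U"
    and ex: "j < p" "v < n" "L v = 0" "0 < between n W (cls n L j) {v}"
  shows "branching n p k W L c i U"
    and "best = 0 \<Longrightarrow> \<exists>v. loose_branching n p k W L c i U v"
    and "0 < best \<Longrightarrow> tight_branching n p k W L c i U"
proof -
  have mem: "(l, w) \<in> pairs n p 0" if "l < p" "w < n" for l w using that by (simp add: pairs_def)
  have cand: "i < p" "candidate n W L i best U"
    using inv mem[OF ex(1,2)] ex unfolding select_inv_def by (metis less_irrefl)+
  show br: "branching n p k W L c i U"
    using sym cl alive cand by unfold_locales (auto simp: candidate_def)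
  show "\<exists>v. loose_branching n p k W L c i U v" if "best = 0"
  proof -
    from cand(2) that obtain v where "U = {v}" "loose n W L i v" by (auto simp: candidate_def)
    then have "loose_branching n p k W L c i U v"
      using br unfolding loose_branching_def loose_branching_axioms_def loose_def by blast
    then show ?thesis ..
  qed
  show "tight_branching n p k W L c i U" if "0 < best"
  proof -
    have t: "tight n W L i U" "best = card U" using cand(2) that by (auto simp: candidate_def)
    have "card (Y - cls n L l) \<le> card U"
      if l: "l < p" and Y: "Y \<in> feas n L l" "cut n W Y = lam n W L l + 1"
        "0 < between n W (cls n L l) (Y - cls n L l)" for l Y
    proof -
      \<comment> \<open>An edge from the class into the free part of \<open>Y\<close> supplies an
        examined pair \<open>(l, w)\<close>, to which the bound in \<open>covered\<close>
        applies.\<close>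
      obtain u w where uw: "u < n" "w < n" "u \<in> cls n L l" "w \<in> Y - cls n L l" "0 < W u w"
        using between_pos_obtains[OF Y(3)] by blast
      have "L w = 0" using uw Y(1) by (auto simp: feas_def cls_def)
      moreover have "0 < between n W (cls n L l) {w}" using uw by (intro between_pos) auto
      moreover have "covered n W L (pairs n p 0) best" using inv by (simp add: select_inv_def)
      ultimately show ?thesis using Y uw mem[OF l uw(2)] t(2) unfolding covered_def by blast
    qed
    then show ?thesis
      using br t(1) unfolding tight_branching_def tight_branching_axioms_def tight_def by blast
  qed
qed

lemma mark_copy:
  assumes "env n p k s" "a \<noteq> b"
  shows "marks n (arr (sem (mark a (posb (Get b (Var ''x'')))) s) a) = marks n (arr s b)"
  using envD(1)[OF assms(1)] assms(2)
  by (subst mark(1)[where G = "\<lambda>x. arr s b x \<noteq> 0"]) (auto simp: marks_def)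

definition decide :: prog where
  "decide = mark ''P'' (in_class ''bi'') ;;; mark ''Q'' (posb (Get ''U'' (Var ''x''))) ;;; sumw ;;;
     PAssign ''aa'' (Var ''a'') ;;; PAssign ''spec'' (Const 0) ;;;
     PCond (posb (Var ''best''))
       (PCond (eqb (Var ''aa'') (Const 1)) (PAssign ''spec'' (Const 1)) PSkip ;;;
        PFor ''j'' ''p'' (PCond (Neg (eqb (Var ''j'') (Var ''bi'')))
          (mark ''P'' (in_class ''j'') ;;; sumw ;;;
           PCond (Neg (Less (Var ''a'') (Var ''aa''))) (PAssign ''spec'' (Const 1)) PSkip) PSkip)) PSkip"

lemma meta_decide [simp]:
  "modv decide = {''x'', ''y'', ''a'', ''aa'', ''spec'', ''j''}"
  "moda decide = {''P'', ''Q''}" "bounds decide = {''n'', ''p''}" "counters_ok decide"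
  by (auto simp: decide_def)

text \<open>A neighbour is labelled only while its child is being pushed. Afterwards the label is
  removed and its edges to the enlarged class are deleted for good, so later children see all
  smaller neighbours excluded.\<close>

definition visit :: prog where
  "visit = PCond (eqb (Get ''C'' (Plus (Var ''nn'') (Var ''z''))) (Const 0))
     (mark ''P'' (posb (Get ''U'' (Var ''x''))) ;;; mark ''Q'' (eqb (Var ''x'') (Var ''z'')) ;;; sumw ;;;
      PCond (posb (Var ''a''))
        (PStore ''C'' (Plus (Var ''nn'') (Var ''z'')) (Plus (Var ''bi'') (Const 1)) ;;; push_frame ;;;
         PStore ''C'' (Plus (Var ''nn'') (Var ''z'')) (Const 0) ;;;
         mark ''P'' (in_class ''bi'') ;;; del) PSkip) PSkip"

lemma meta_visit [simp]:
  "modv visit = {''x'', ''y'', ''a'', ''o''}"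
  "moda visit = {''P'', ''Q'', ''C'', ''S''}" "bounds visit = {''n'', ''fs''}" "counters_ok visit"
  by (auto simp: visit_def)

text \<open>The node is first pushed unchanged: this both keeps a copy and reserves the frame at
  \<open>''ob''\<close>. When the other children are in place, the copy is reloaded and its frame
  overwritten by \<open>out\<close>.\<close>

definition expand :: prog where
  "expand = PAssign ''ob'' (Var ''o'') ;;; push_frame ;;;
     relabel (posb (Get ''U'' (Var ''x''))) (Plus (Var ''bi'') (Const 1)) ;;;
     PCond (posb (Var ''spec'')) (PFor ''z'' ''n'' visit) push_frame ;;;
     load ''ob'' ;;; mark ''P'' (in_class ''bi'') ;;; mark ''Q'' (posb (Get ''U'' (Var ''x''))) ;;;
     del ;;; save ''ob''"

lemma meta_expand [simp]:
  "modv expand = {''x'', ''y'', ''a'', ''o'', ''ob'', ''z''}"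
  "moda expand = {''P'', ''Q'', ''C'', ''S''}" "bounds expand = {''n'', ''fs''}" "counters_ok expand"
  by (auto simp: expand_def)

lemma between_delete:
  assumes "\<And>u v. u \<in> A \<Longrightarrow> v \<in> B \<Longrightarrow> \<not> (u \<in> P \<and> v \<in> Q \<or> u \<in> Q \<and> v \<in> P)"
  shows "between n (delete P Q W) A B = between n W A B"
  unfolding between_def wsum_def
proof (intro sum.cong refl)
  fix u v
  show "of_bool (u \<in> A \<and> v \<in> B) * delete P Q W u v = of_bool (u \<in> A \<and> v \<in> B) * W u v"
    using assms[of u v] by (cases "u \<in> A \<and> v \<in> B") (auto simp: delete_def)
qed

lemma delete_delete: "delete P A (delete P B W) = delete P (A \<union> B) W"
  by (intro ext) (auto simp: delete_def)

context branching
begin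

lemma decide:
  assumes env: "env n p k s" and C: "node_of n (arr s ''C'') = (W, L, c)"
    and bi: "var s ''bi'' = i" and mU: "marks n (arr s ''U'') = U"
  shows "0 < var (sem decide s) ''spec'' \<longleftrightarrow> 0 < var s ''best'' \<and> special"
proof -
  define s1 where "s1 = sem (mark ''P'' (in_class ''bi'')) s"
  define s2 where "s2 = sem (mark ''Q'' (posb (Get ''U'' (Var ''x'')))) s1"
  define s3 where "s3 = sem sumw s2"
  let ?s = "setv (setv s3 ''aa'' (var s3 ''a'')) ''spec'' 0"
  let ?b = "PCond (Neg (eqb (Var ''j'') (Var ''bi'')))
          (mark ''P'' (in_class ''j'') ;;; sumw ;;;
           PCond (Neg (Less (Var ''a'') (Var ''aa''))) (PAssign ''spec'' (Const 1)) PSkip) PSkip"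
  let ?c = "PCond (posb (Var ''best''))
       (PCond (eqb (Var ''aa'') (Const 1)) (PAssign ''spec'' (Const 1)) PSkip ;;; PFor ''j'' ''p'' ?b) PSkip"
  have run: "sem decide s = sem ?c ?s"
    by (simp only: decide_def sem.simps(4) s1_def s2_def s3_def sem.simps(2) aval.simps)
  have env1: "env n p k s1" unfolding s1_def by (rule env_sem[OF _ env]) (simp add: keeps_env_def)
  have env2: "env n p k s2" unfolding s2_def by (rule env_sem[OF _ env1]) (simp add: keeps_env_def)
  have env3: "env n p k s3" unfolding s3_def by (rule env_sem[OF _ env2]) (simp add: keeps_env_def)
  have fr: "arr s2 ''C'' = arr s ''C''" "arr s3 ''C'' = arr s ''C''" "arr s2 ''P'' = arr s1 ''P''"
    "arr s1 ''U'' = arr s ''U''" "var s3 ''bi'' = i" "var s3 ''best'' = var s ''best''" "arr s3 ''Q'' = arr s2 ''Q''"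
    using bi unfolding s3_def s2_def s1_def by (simp_all add: frame_arr frame_var)
  have P: "marks n (arr s2 ''P'') = S"
    unfolding fr s1_def by (rule mark_class(1)[OF env C _ bi]) simp_all
  have Q: "marks n (arr s2 ''Q'') = U"
    unfolding s2_def by (subst mark_copy[OF env1]) (simp_all add: fr mU)
  have W: "Wt n (arr s2 ''C'') = W" using C fr by (simp add: node_of_def)
  have a: "var s3 ''a'' = between n W S U" unfolding s3_def sumw[OF env2] P Q W ..
  show ?thesis
  proof (cases "0 < var s ''best''")
    case False
    then have "sem decide s = ?s" unfolding run using fr by simp
    then show ?thesis using False by simp
  next
    case True
    define s4 where "s4 = sem (PCond (eqb (Var ''aa'') (Const 1)) (PAssign ''spec'' (Const 1)) PSkip) ?s"
    have run4: "sem decide s = sem (PFor ''j'' ''p'' ?b) s4"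
      unfolding run s4_def using True fr by (simp del: sem.simps(6))
    have s4: "var s4 ''spec'' = of_bool (between n W S U = 1)" "var s4 ''aa'' = between n W S U"
      using a by (auto simp: s4_def)
    have env4: "env n p k s4" unfolding s4_def using env3 by (auto simp: env_setv)
    have fr4: "arr s4 = arr s3" "var s4 ''bi'' = i" unfolding s4_def using fr by auto
    let ?I = "\<lambda>m t. 0 < var t ''spec'' \<longleftrightarrow> between n W S U = 1 \<or>
      (\<exists>j<m. j \<noteq> i \<and> between n W S U \<le> between n W (cls n L j) U)"
    have "?I p (sem decide s)"
      unfolding run4
    proof (rule For_induct[where P = ?I], goal_cases)
      case 1
      show ?case using s4 by simp
    next
      case (2 m t)
      let ?t = "setv t ''j'' m"
      have envt: "env n p k ?t"
      proof (rule env_cong[OF env4])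
        show "var ?t z = var s4 z" if "z \<in> envvars" for z using 2(3)[of z] that by auto
        show "arr ?t ''r'' = arr s4 ''r''" using 2(4)[of "''r''"] by simp
      qed
      have vt: "var t ''bi'' = i" "var t ''aa'' = between n W S U"
        using 2(3)[of "''bi''"] 2(3)[of "''aa''"] fr4 s4 by simp_all
      have at: "arr t ''C'' = arr s ''C''" "arr t ''Q'' = arr s2 ''Q''"
        using 2(4)[of "''C''"] 2(4)[of "''Q''"] fr4 fr by simp_all
      show ?case
      proof (cases "m = i")
        case True
        then have "sem ?b ?t = ?t" using vt by simp
        then show ?thesis using 2(2) True by (auto simp: less_Suc_eq)
      next
        case False
        define t1 where "t1 = sem (mark ''P'' (in_class ''j'')) ?t"
        define t2 where "t2 = sem sumw t1"
        have Ct: "node_of n (arr ?t ''C'') = (W, L, c)" "var ?t ''j'' = m" using at C by simp_all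
        have envt1: "env n p k t1" unfolding t1_def by (rule env_sem[OF _ envt]) (simp add: keeps_env_def)
        have Pt: "marks n (arr t1 ''P'') = cls n L m"
          unfolding t1_def by (rule mark_class(1)[OF envt Ct(1) _ Ct(2)]) simp_all
        have Qt: "marks n (arr t1 ''Q'') = U" "Wt n (arr t1 ''C'') = W"
          unfolding t1_def using at Q C by (simp_all add: frame_arr node_of_def)
        have at2: "var t2 ''a'' = between n W (cls n L m) U" unfolding t2_def sumw[OF envt1] Pt Qt ..
        have vt2: "var t2 ''aa'' = between n W S U" "var t2 ''spec'' = var t ''spec''"
          unfolding t2_def t1_def using vt by (simp_all add: frame_var)
        have "sem ?b ?t = sem (PCond (Neg (Less (Var ''a'') (Var ''aa''))) (PAssign ''spec'' (Const 1)) PSkip) t2"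
          using False vt by (simp add: t1_def t2_def)
        then have "0 < var (sem ?b ?t) ''spec'' \<longleftrightarrow>
            0 < var t ''spec'' \<or> between n W S U \<le> between n W (cls n L m) U"
          using at2 vt2 by auto
        then show ?thesis using 2(2) False by (auto simp: less_Suc_eq)
      qed
    next
      case (3 t)
      then show ?case using envD(2)[OF env4] by simp
    qed
    then show ?thesis using True unfolding special_def by blast
  qed
qed

definition before :: "nat \<Rightarrow> nat set" where
  "before z = {y \<in> nbrs. y < z}"

text \<open>The working node just before \<open>z\<close> is visited: \<open>U\<close> is labelled
  and its smaller neighbours are cut off. It starts as \<open>ins\<close> and differs from
  \<open>via z\<close> only in the label of \<open>z\<close>.\<close>

definition cur :: "nat \<Rightarrow> node" where
  "cur z = (delete (S \<union> U) (before z) W, label U i L, c + between n W (S \<union> U) (before z))"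

lemma cls_label: "cls n (label U i L) i = S \<union> U"
  using U by (auto simp: cls_def label_def)

lemma before_Suc: "before (Suc z) = (if z \<in> nbrs then {z} \<union> before z else before z)"
  by (auto simp: before_def less_Suc_eq)

lemma not_before: "z \<notin> before z" "before z \<inter> (S \<union> U) = {}"
  by (auto simp: before_def nbrs_def cls_def)

lemma delete_cur:
  assumes z: "z \<in> nbrs"
  shows "(delete (S \<union> U) {z} (delete (S \<union> U) (before z) W), label U i L,
     c + between n W (S \<union> U) (before z) + between n (delete (S \<union> U) (before z) W) (S \<union> U) {z}) = cur (Suc z)"
proof -
  have "between n (delete (S \<union> U) (before z) W) (S \<union> U) {z} = between n W (S \<union> U) {z}"
    using not_before[of z] z by (intro between_delete) (auto simp: nbrs_def cls_def)
  moreover have "between n W (S \<union> U) ({z} \<union> before z) = between n W (S \<union> U) {z} + between n W (S \<union> U) (before z)"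
    using not_before(1)[of z] by (intro between_Un) auto
  ultimately show ?thesis using z by (simp add: cur_def before_Suc delete_delete)
qed

lemma visit:
  assumes env: "env n p k s" and C: "node_of n (arr s ''C'') = cur z" and z: "var s ''z'' = z" "z < n"
    and bi: "var s ''bi'' = i" and mU: "marks n (arr s ''U'') = U" and st: "stack n s Ns"
  shows "node_of n (arr (sem visit s) ''C'') = cur (Suc z)"
    and "stack n (sem visit s) (Ns @ (if z \<in> nbrs then [via z] else []))"
proof -
  note e = envD[OF env]
  let ?W = "delete (S \<union> U) (before z) W"
  have "arr s ''C'' (n * n + z) = label U i L z"
    using C z(2) by (auto simp: node_of_def Lt_def cur_def dest: fun_cong[of _ _ z])
  then have lab0: "arr s ''C'' (n * n + z) = 0 \<longleftrightarrow> L z = 0 \<and> z \<notin> U" by (auto simp: label_def)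
  have "(node_of n (arr (sem visit s) ''C'') = cur (Suc z)) \<and>
    stack n (sem visit s) (Ns @ (if z \<in> nbrs then [via z] else []))"
  proof (cases "L z = 0 \<and> z \<notin> U")
    case False
    then have "arr s ''C'' (n * n + z) \<noteq> 0" using lab0 by blast
    then have "sem visit s = s" using e z(1) by (simp add: visit_def)
    moreover have "z \<notin> nbrs" using False by (auto simp: nbrs_def)
    ultimately show ?thesis using C st by (simp add: cur_def before_Suc)
  next
    case L0: True
    define s1 where "s1 = sem (mark ''P'' (posb (Get ''U'' (Var ''x'')))) s"
    define s2 where "s2 = sem (mark ''Q'' (eqb (Var ''x'') (Var ''z''))) s1"
    define s3 where "s3 = sem sumw s2"
    let ?c = "PCond (posb (Var ''a''))
        (PStore ''C'' (Plus (Var ''nn'') (Var ''z'')) (Plus (Var ''bi'') (Const 1)) ;;; push_frame ;;;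
         PStore ''C'' (Plus (Var ''nn'') (Var ''z'')) (Const 0) ;;;
         mark ''P'' (in_class ''bi'') ;;; del) PSkip"
    have "arr s ''C'' (n * n + z) = 0" using lab0 L0 by blast
    then have run: "sem visit s = sem ?c s3"
      using e z(1) by (simp add: visit_def s1_def s2_def s3_def)
    have env1: "env n p k s1" unfolding s1_def by (rule env_sem[OF _ env]) (simp add: keeps_env_def)
    have env2: "env n p k s2" unfolding s2_def by (rule env_sem[OF _ env1]) (simp add: keeps_env_def)
    have env3: "env n p k s3" unfolding s3_def by (rule env_sem[OF _ env2]) (simp add: keeps_env_def)
    have fr: "arr s2 ''C'' = arr s ''C''" "arr s3 ''C'' = arr s ''C''" "arr s2 ''P'' = arr s1 ''P''"
      "var s3 ''bi'' = i" "var s3 ''z'' = z" "var s1 ''z'' = z" "arr s3 ''Q'' = arr s2 ''Q''"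
      "var s3 ''o'' = var s ''o''" "arr s3 ''S'' = arr s ''S''"
      using bi z unfolding s3_def s2_def s1_def by (simp_all add: frame_arr frame_var)
    have P: "marks n (arr s2 ''P'') = U"
      unfolding fr s1_def by (subst mark_copy[OF env]) (simp_all add: mU)
    have Q: "marks n (arr s2 ''Q'') = {z}"
      unfolding s2_def using envD(1)[OF env1] z(2) fr
      by (subst mark(1)[where G = "\<lambda>x. x = z"]) auto
    have W: "Wt n (arr s2 ''C'') = ?W" using C fr by (simp add: node_of_def cur_def)
    have "var s3 ''a'' = between n ?W U {z}" unfolding s3_def sumw[OF env2] P Q W ..
    \<comment> \<open>The neighbour test runs on the reduced weights, but only edges to smaller
      neighbours have been deleted so far.\<close>
    also have "\<dots> = between n W U {z}"
      using not_before[of z] L0 by (intro between_delete) (auto simp: cls_def)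
    finally have a: "0 < var s3 ''a'' \<longleftrightarrow> z \<in> nbrs" using L0 z(2) by (auto simp: nbrs_def)
    show ?thesis
    proof (cases "z \<in> nbrs")
      case False
      then have "sem visit s = s3" unfolding run using a by simp
      then show ?thesis using False C fr stack_cong[OF st] by (simp add: cur_def before_Suc)
    next
      case True
      define s4 where "s4 = seta s3 ''C'' (n * n + z) (Suc i)"
      define s5 where "s5 = sem push_frame s4"
      define s6 where "s6 = seta s5 ''C'' (n * n + z) 0"
      define s7 where "s7 = sem (mark ''P'' (in_class ''bi'')) s6"
      have e3: "var s3 ''nn'' = n * n" using envD[OF env3] by simp
      have e5: "var s5 ''nn'' = n * n" "var s5 ''z'' = z" "var s5 ''bi'' = i"
        unfolding s5_def s4_def using e3 fr by (simp_all add: frame_var)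
      have run': "sem visit s = sem del s7"
        unfolding run s7_def s6_def using a True e3 e5 fr by (simp add: s5_def s4_def)
      have env4: "env n p k s4" unfolding s4_def using env3 by (simp add: env_seta)
      have env5: "env n p k s5" unfolding s5_def by (rule env_sem[OF _ env4]) (simp add: keeps_env_def)
      have env6: "env n p k s6" unfolding s6_def using env5 by (simp add: env_seta)
      have env7: "env n p k s7" unfolding s7_def by (rule env_sem[OF _ env6]) (simp add: keeps_env_def)
      have lab1: "(label U i L)(z := Suc i) = label (insert z U) i L"
        by (auto simp: label_def fun_eq_iff)
      have lab2: "(label (insert z U) i L)(z := 0) = label U i L"
        using L0 by (auto simp: label_def fun_eq_iff)
      have C4: "node_of n (arr s4 ''C'') = via z"
        using node_of_store_label[OF C[unfolded cur_def] z(2), of "Suc i"] fr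
        by (simp add: s4_def lab1 via_def before_def)
      have st4: "stack n s4 Ns" by (rule stack_cong[OF st]) (simp_all add: s4_def fr)
      have st5: "stack n s5 (Ns @ [via z])"
        unfolding s5_def using push_frame[OF env4 st4] C4 by simp
      have "arr s5 ''C'' = arr s4 ''C''" unfolding s5_def by (simp add: frame_arr)
      then have C6: "node_of n (arr s6 ''C'') = (?W, label U i L, c + between n W (S \<union> U) (before z))"
        using node_of_store_label[OF C4[unfolded via_def] z(2), of 0]
        by (simp add: s6_def lab2 before_def)
      have bi6: "var s6 ''bi'' = i" using e5 by (simp add: s6_def)
      have C7: "node_of n (arr s7 ''C'') = (?W, label U i L, c + between n W (S \<union> U) (before z))"
        unfolding s7_def using C6 by (simp add: frame_arr)
      have P7: "marks n (arr s7 ''P'') = S \<union> U"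
        unfolding s7_def cls_label[symmetric] by (rule mark_class(1)[OF env6 C6 _ bi6]) simp_all
      have Q7: "marks n (arr s7 ''Q'') = {z}"
        using Q fr unfolding s7_def s6_def s5_def s4_def by (simp add: frame_arr)
      have disj: "(S \<union> U) \<inter> {z} = {}" using L0 by (auto simp: cls_def)
      have "node_of n (arr (sem visit s) ''C'') = cur (Suc z)"
        unfolding run' del[OF env7 C7 P7 Q7 disj] by (rule delete_cur[OF True])
      moreover have "stack n (sem visit s) (Ns @ [via z])"
        unfolding run' by (rule stack_cong[OF st5]) (simp_all add: frame_var frame_arr s7_def s6_def)
      ultimately show ?thesis using True by simp
    qed
  qed
  then show "node_of n (arr (sem visit s) ''C'') = cur (Suc z)"
    and "stack n (sem visit s) (Ns @ (if z \<in> nbrs then [via z] else []))" by blast+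
qed

lemma visit_all:
  assumes env: "env n p k s" and C: "node_of n (arr s ''C'') = ins"
    and bi: "var s ''bi'' = i" and mU: "marks n (arr s ''U'') = U" and st: "stack n s Ns"
  shows "stack n (sem (PFor ''z'' ''n'' visit) s) (Ns @ map via (filter (\<lambda>z. z \<in> nbrs) [0..<n]))"
proof (rule For_induct[where P = "\<lambda>z t. node_of n (arr t ''C'') = cur z \<and>
    stack n t (Ns @ map via (filter (\<lambda>z. z \<in> nbrs) [0..<z]))"], goal_cases)
  case 1
  have "before 0 = {}" "delete (S \<union> U) {} W = W" by (auto simp: before_def delete_def fun_eq_iff)
  then have "cur 0 = ins" by (simp add: cur_def ins_def between_empty)
  then show ?case using C st by simp
next
  case (2 z t)
  let ?t = "setv t ''z'' z"
  have z: "z < n" using 2(1) envD(1)[OF env] by simp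
  have envt: "env n p k ?t"
  proof (rule env_cong[OF env])
    show "var ?t y = var s y" if "y \<in> envvars" for y using 2(3)[of y] that by auto
    show "arr ?t ''r'' = arr s ''r''" using 2(4)[of "''r''"] by simp
  qed
  have Ct: "node_of n (arr ?t ''C'') = cur z" using 2(2) by simp
  have zt: "var ?t ''z'' = z" by simp
  have bit: "var ?t ''bi'' = i" using 2(3)[of "''bi''"] bi by simp
  have Ut: "marks n (arr ?t ''U'') = U" using 2(4)[of "''U''"] mU by simp
  have stt: "stack n ?t (Ns @ map via (filter (\<lambda>z. z \<in> nbrs) [0..<z]))"
    by (rule stack_cong[OF conjunct2[OF 2(2)]]) simp_all
  note v = visit[OF envt Ct zt z bit Ut stt]
  have "Ns @ map via (filter (\<lambda>z. z \<in> nbrs) [0..<Suc z]) =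
    (Ns @ map via (filter (\<lambda>z. z \<in> nbrs) [0..<z])) @ (if z \<in> nbrs then [via z] else [])" by simp
  then show ?case using v by metis
next
  case (3 t)
  have "stack n (setv t ''z'' (var s ''n'')) (Ns @ map via (filter (\<lambda>z. z \<in> nbrs) [0..<var s ''n'']))"
    by (rule stack_cong[OF conjunct2[OF 3(1)]]) simp_all
  then show ?case using envD(1)[OF env] by simp
qed

lemma expand:
  assumes env: "env n p k s" and C: "node_of n (arr s ''C'') = (W, L, c)"
    and bi: "var s ''bi'' = i" and mU: "marks n (arr s ''U'') = U" and st: "stack n s Ns"
  shows "stack n (sem expand s) (Ns @ out # (if 0 < var s ''spec''
      then map via (filter (\<lambda>z. z \<in> nbrs) [0..<n]) else [ins]))"
proof -
  let ?ob = "length Ns * fsize n"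
  define s1 where "s1 = setv s ''ob'' ?ob"
  define s2 where "s2 = sem push_frame s1"
  define s3 where "s3 = sem (relabel (posb (Get ''U'' (Var ''x''))) (Plus (Var ''bi'') (Const 1))) s2"
  define s4 where "s4 = sem (PCond (posb (Var ''spec'')) (PFor ''z'' ''n'' visit) push_frame) s3"
  define s5 where "s5 = sem (load ''ob'') s4"
  define s6 where "s6 = sem (mark ''P'' (in_class ''bi'')) s5"
  define s7 where "s7 = sem (mark ''Q'' (posb (Get ''U'' (Var ''x'')))) s6"
  define s8 where "s8 = sem del s7"
  let ?Ms = "if 0 < var s ''spec'' then map via (filter (\<lambda>z. z \<in> nbrs) [0..<n]) else [ins]"
  have o: "var s ''o'' = ?ob" using st by (simp add: stack_def)
  have run: "sem expand s = sem (save ''ob'') s8"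
    by (simp only: expand_def sem.simps(4) sem.simps(2) aval.simps o s1_def s2_def s3_def s4_def s5_def s6_def
        s7_def s8_def)
  have env1: "env n p k s1" unfolding s1_def using env by (simp add: env_setv)
  have env2: "env n p k s2" unfolding s2_def by (rule env_sem[OF _ env1]) (simp add: keeps_env_def)
  have env3: "env n p k s3" unfolding s3_def by (rule env_sem[OF _ env2]) (simp add: keeps_env_def)
  have env4: "env n p k s4" unfolding s4_def by (rule env_sem[OF _ env3]) (simp add: keeps_env_def)
  have env5: "env n p k s5" unfolding s5_def by (rule env_sem[OF _ env4]) (simp add: keeps_env_def)
  have env6: "env n p k s6" unfolding s6_def by (rule env_sem[OF _ env5]) (simp add: keeps_env_def)
  have env7: "env n p k s7" unfolding s7_def by (rule env_sem[OF _ env6]) (simp add: keeps_env_def)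
  have env8: "env n p k s8" unfolding s8_def by (rule env_sem[OF _ env7]) (simp add: keeps_env_def)
  have st1: "stack n s1 Ns" by (rule stack_cong[OF st]) (simp_all add: s1_def)
  have C1: "arr s1 ''C'' = arr s ''C''" by (simp add: s1_def)
  have st2: "stack n s2 (Ns @ [(W, L, c)])" unfolding s2_def using push_frame[OF env1 st1] C C1 by simp
  have fr2: "node_of n (arr s2 ''C'') = (W, L, c)" "var s2 ''bi'' = i" "arr s2 ''U'' = arr s ''U''"
    "var s2 ''spec'' = var s ''spec''" "var s2 ''ob'' = ?ob"
    using C C1 bi unfolding s2_def by (simp_all add: frame_arr frame_var s1_def)
  have Ux: "x < n \<Longrightarrow> arr s ''U'' x \<noteq> 0 \<longleftrightarrow> x \<in> U" for x using mU by (auto simp: marks_def)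
  have C3: "node_of n (arr s3 ''C'') = ins"
    unfolding s3_def ins_def using U(1) Ux fr2 by (intro relabel[OF env2 fr2(1)]) auto
  have st3: "stack n s3 (Ns @ [(W, L, c)])"
    unfolding s3_def by (rule stack_cong[OF st2]) (simp_all add: frame_arr frame_var)
  have fr3: "var s3 ''bi'' = i" "arr s3 ''U'' = arr s ''U''" "var s3 ''spec'' = var s ''spec''" "var s3 ''ob'' = ?ob"
    unfolding s3_def using fr2 by (simp_all add: frame_arr frame_var)
  have mU3: "marks n (arr s3 ''U'') = U" using fr3 mU by simp
  have st4: "stack n s4 (Ns @ (W, L, c) # ?Ms)"
  proof (cases "0 < var s ''spec''")
    case True
    then have "s4 = sem (PFor ''z'' ''n'' visit) s3" unfolding s4_def using fr3 by (simp del: sem.simps(6))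
    then show ?thesis using visit_all[OF env3 C3 fr3(1) mU3 st3] True by simp
  next
    case False
    then have "s4 = sem push_frame s3" unfolding s4_def using fr3 by simp
    then show ?thesis using push_frame[OF env3 st3] C3 False by simp
  qed
  have fr4: "var s4 ''bi'' = i" "arr s4 ''U'' = arr s ''U''" "var s4 ''ob'' = ?ob"
    unfolding s4_def using fr3 by (simp_all add: frame_arr frame_var del: sem.simps)
  have C5: "node_of n (arr s5 ''C'') = (W, L, c)"
    unfolding s5_def by (rule load_stack[OF env4 st4 fr4(3)]) simp
  have bi5: "var s5 ''bi'' = i" unfolding s5_def using fr4 by (simp add: frame_var)
  have P7: "marks n (arr s7 ''P'') = S"
  proof -
    have "marks n (arr s6 ''P'') = S"
      unfolding s6_def by (rule mark_class(1)[OF env5 C5 _ bi5]) simp_all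
    then show ?thesis unfolding s7_def by (simp add: frame_arr)
  qed
  have "arr s6 ''U'' = arr s ''U''" unfolding s6_def s5_def using fr4 by (simp add: frame_arr)
  then have Q7: "marks n (arr s7 ''Q'') = U"
    unfolding s7_def by (subst mark_copy[OF env6]) (simp_all add: mU)
  have C7: "node_of n (arr s7 ''C'') = (W, L, c)"
    unfolding s7_def s6_def using C5 by (simp add: frame_arr)
  have C8: "node_of n (arr s8 ''C'') = out"
    unfolding s8_def del[OF env7 C7 P7 Q7 SU] out_def ..
  have st8: "stack n s8 (Ns @ (W, L, c) # ?Ms)"
    by (rule stack_cong[OF st4]) (simp_all add: s8_def s7_def s6_def s5_def frame_arr frame_var)
  have ob8: "var s8 ''ob'' = ?ob"
    unfolding s8_def s7_def s6_def s5_def using fr4 by (simp add: frame_var)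
  show ?thesis unfolding run using save_stack[OF env8 st8 ob8] C8 by simp
qed

end

section \<open>One step of the search\<close>

context branching
begin

lemma valid_children:
  assumes v: "valid n ts W\<^sub>0 (W, L, c)" and p: "p = length ts"
  shows "valid n ts W\<^sub>0 out" "valid n ts W\<^sub>0 ins" "z \<in> nbrs \<Longrightarrow> valid n ts W\<^sub>0 (via z)"
proof -
  show "valid n ts W\<^sub>0 out" unfolding out_def by (rule valid_delete[OF v])
  show "valid n ts W\<^sub>0 ins" unfolding ins_def using U(2) i p by (intro valid_label[OF v]) auto
  assume "z \<in> nbrs"
  then have "valid n ts W\<^sub>0 (W, label (insert z U) i L, c)"
    using U(2) i p by (intro valid_label[OF v]) (auto simp: nbrs_def)
  then show "valid n ts W\<^sub>0 (via z)" unfolding via_def by (rule valid_delete)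
qed

definition successors :: "nat \<Rightarrow> node list" where
  "successors best = out # (if 0 < best \<and> special then map via (filter (\<lambda>z. z \<in> nbrs) [0..<n]) else [ins])"

lemma valid_successors:
  assumes "valid n ts W\<^sub>0 (W, L, c)" "p = length ts" "N \<in> set (successors best)"
  shows "valid n ts W\<^sub>0 N"
  using assms(3) valid_children[OF assms(1,2)] unfolding successors_def by (auto split: if_split_asm)

end

lemma select_successors:
  assumes "symmetric W" "\<And>j. j < p \<Longrightarrow> closed_at n W L j"
    and "k \<le> lower n p (W, L, c)" "lower n p (W, L, c) \<le> 2 * k"
    and "select_inv n p W L (pairs n p 0) best i U"
    and "j < p" "v < n" "L v = 0" "0 < between n W (cls n L j) {v}"
  defines "Ns \<equiv> branching.successors n p W L c i U best"
  shows "branching n p k W L c i U"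
    and "sum_list (map (pot n p k) Ns) + 1 \<le> pot n p k (W, L, c)"
    and "solution n p k (W, L, c) f \<Longrightarrow> \<exists>N\<in>set Ns. \<exists>f. solution n p k N f"
proof -
  note sb = select_branching[OF assms(1-9)]
  show br: "branching n p k W L c i U" by (rule sb(1))
  have "sum_list (map (pot n p k) Ns) + 1 \<le> pot n p k (W, L, c) \<and>
    (\<forall>f. solution n p k (W, L, c) f \<longrightarrow> (\<exists>N\<in>set Ns. \<exists>f. solution n p k N f))"
  proof (cases "best = 0")
    case True
    then obtain w where lb: "loose_branching n p k W L c i U w" using sb(2) by blast
    have "Ns = [branching.out n W L c i U, branching.ins W L c i U]"
      using True by (simp add: Ns_def branching.successors_def[OF br])
    then show ?thesis
      using loose_branching.decreasing[OF lb] loose_branching.complete[OF lb] by simp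
  next
    case False
    then have tb: "tight_branching n p k W L c i U" using sb(3) by blast
    have "Ns = tight_branching.children n p W L c i U"
      using False by (simp add: Ns_def branching.successors_def[OF br] tight_branching.children_def[OF tb])
    then show ?thesis
      using tight_branching.decreasing[OF tb] tight_branching.complete[OF tb] by simp
  qed
  then show "sum_list (map (pot n p k) Ns) + 1 \<le> pot n p k (W, L, c)"
    and "solution n p k (W, L, c) f \<Longrightarrow> \<exists>N\<in>set Ns. \<exists>f. solution n p k N f" by blast+
qed

definition check :: prog where
  "check = PFor ''x'' ''n'' (PStore ''part'' (Var ''x'') (Minus lab (Const 1))) ;;;
     PAssign ''a'' (Plus (Get ''C'' spent) (Get ''C'' spent)) ;;;
     dsum (Neg (eqb (Get ''part'' (Var ''x'')) (Get ''part'' (Var ''y''))))"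

lemma meta_check [simp]: "modv check = {''x'', ''y'', ''a''}" "moda check = {''part''}"
    "bounds check = {''n''}" "counters_ok check"
  by (auto simp: check_def)

lemma check:
  assumes env: "env n p k s" and C: "node_of n (arr s ''C'') = (W, L, c)"
  shows "\<And>v. v < n \<Longrightarrow> arr (sem check s) ''part'' v = L v - 1"
    and "var (sem check s) ''a'' = 2 * c + cost2 n W (\<lambda>v. L v - 1)"
proof -
  note e = envD[OF env]
  let ?f = "PFor ''x'' ''n'' (PStore ''part'' (Var ''x'') (Minus lab (Const 1)))"
  let ?b = "Neg (eqb (Get ''part'' (Var ''x'')) (Get ''part'' (Var ''y'')))"
  define s1 where "s1 = sem ?f s"
  define s2 where "s2 = setv s1 ''a'' (c + c)"
  have L: "arr s ''C'' (n * n + v) = L v" if "v < n" for v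
    using C that by (auto simp: node_of_def Lt_def)
  have "\<forall>v<n. arr s1 ''part'' v = L v - 1"
    unfolding s1_def
  proof (rule For_induct[where P = "\<lambda>i t. \<forall>v<i. arr t ''part'' v = L v - 1"], goal_cases)
    case (2 i t)
    have "i < n" "var t ''nn'' = n * n" using 2(1) 2(3)[of "''nn''"] e by simp_all
    then show ?case using 2(2) 2(4)[of "''C''"] L by (auto simp: less_Suc_eq)
  qed (use e in auto)
  then have part: "\<And>v. v < n \<Longrightarrow> arr s2 ''part'' v = L v - 1" by (simp add: s2_def)
  have env1: "env n p k s1" unfolding s1_def by (rule env_sem[OF _ env]) (simp add: keeps_env_def)
  then have env2: "env n p k s2" by (simp add: s2_def env_setv)
  have C1: "arr s1 ''C'' = arr s ''C''" unfolding s1_def by (simp add: frame_arr del: sem.simps)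
  then have C2: "arr s2 ''C'' = arr s ''C''" by (simp add: s2_def)
  have "arr s ''C'' (n * n + n) = c" using C by (simp add: node_of_def)
  then have c: "aval (Plus (Get ''C'' spent) (Get ''C'' spent)) s1 = c + c"
    using envD(1,3)[OF env1] C1 by simp
  have run: "sem check s = sem (dsum ?b) s2"
    unfolding check_def sem.simps(4) s1_def[symmetric] sem.simps(2) c s2_def[symmetric] ..
  show "arr (sem check s) ''part'' v = L v - 1" if "v < n" for v
    unfolding run using part[OF that] by (simp add: frame_arr)
  have W: "Wt n (arr s2 ''C'') = W" using C C2 by (simp add: node_of_def)
  have "var (sem (dsum ?b) s2) ''a'' = var s2 ''a'' + wsum n (Wt n (arr s2 ''C'')) (\<lambda>u v. of_bool (L u - 1 \<noteq> L v - 1))"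
    by (rule dsum[OF env2]) (auto simp: part)
  then show "var (sem check s) ''a'' = 2 * c + cost2 n W (\<lambda>v. L v - 1)"
    unfolding run W cost2_def by (simp add: s2_def)
qed

text \<open>On success \<open>''o''\<close> is set to \<open>0\<close>, which discards all open
  nodes and thereby ends the outer loop.\<close>

definition step :: prog where
  "step = pop_frame ;;; close ;;;
     PCond (Less (Var ''K'') (Var ''tot'')) PSkip
       (check ;;; PCond (Neg (Less (Var ''K'') (Var ''a'')))
         (PAssign ''found'' (Const 1) ;;; PAssign ''o'' (Const 0))
         (select ;;; decide ;;; expand))"

lemma keeps_env_step: "keeps_env step"
  by (simp add: keeps_env_def step_def)

lemma meta_step: "bounds step = {''n'', ''p'', ''fs'', ''R''}" "counters_ok step"
    "modv step \<inter> {''n'', ''p'', ''fs'', ''R''} = {}"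
  by (auto simp: step_def)

definition search_inv ::
  "nat \<Rightarrow> nat list \<Rightarrow> nat \<Rightarrow> (nat \<Rightarrow> nat \<Rightarrow> nat) \<Rightarrow> node \<Rightarrow> state \<Rightarrow> bool" where
  "search_inv n ts k W\<^sub>0 N\<^sub>0 s \<longleftrightarrow> env n (length ts) k s \<and>
     (var s ''found'' = 0 \<and> (\<exists>Ns. stack n s Ns \<and> (\<forall>N\<in>set Ns. valid n ts W\<^sub>0 N) \<and>
         ((\<exists>f. solution n (length ts) k N\<^sub>0 f) \<longrightarrow> (\<exists>N\<in>set Ns. \<exists>f. solution n (length ts) k N f))) \<or>
      var s ''found'' \<noteq> 0 \<and> var s ''o'' = 0 \<and>
         (\<forall>v<n. arr s ''part'' v < length ts) \<and> (\<forall>i<length ts. arr s ''part'' (ts ! i) = i) \<and>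
         cost2 n W\<^sub>0 (arr s ''part'') \<le> 2 * k)"

text \<open>The termination measure of the outer loop. A popped node is worth at least one more than
  its children together, so the value at the root bounds the number of iterations.\<close>

definition stack_pot :: "nat \<Rightarrow> nat \<Rightarrow> nat \<Rightarrow> state \<Rightarrow> nat" where
  "stack_pot n p k s =
     sum_list (map (\<lambda>j. pot n p k (frame n (arr s ''S'') j)) [0..<var s ''o'' div fsize n])"

lemma stack_pot:
  assumes "stack n s Ns"
  shows "stack_pot n p k s = sum_list (map (pot n p k) Ns)"
proof -
  have "var s ''o'' = length Ns * fsize n" using assms by (simp add: stack_def)
  then have "var s ''o'' div fsize n = length Ns" by (metis add_is_0 nonzero_mult_div_cancel_right one_neq_zero)
  moreover have "map (\<lambda>j. pot n p k (frame n (arr s ''S'') j)) [0..<length Ns] = map (pot n p k) Ns"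
    using assms by (intro nth_equalityI) (auto simp: stack_def)
  ultimately show ?thesis by (simp add: stack_pot_def)
qed

lemma cost2_cong: "(\<And>v. v < n \<Longrightarrow> f v = g v) \<Longrightarrow> cost2 n W f = cost2 n W g"
  by (simp add: cost2_def wsum_def)

lemma close_outcome:
  assumes inv: "close_inv n p k ts W\<^sub>0 N\<^sub>0 p (W, L, c) tot l"
  shows "2 * k < tot \<Longrightarrow> \<not> (\<exists>f. solution n p k N\<^sub>0 f)"
    and "tot \<le> 2 * k \<Longrightarrow> lower n p (W, L, c) \<le> 2 * k \<and>
      (\<forall>j<p. closed_at n W L j \<and> l j = lam n W L j \<and> lam n W L j \<le> 2 * k)"
proof -
  have fin: "2 * k < tot \<and> 2 * k < lower n p (W, L, c) \<or>
     tot = lower n p (W, L, c) \<and> (\<forall>j<p. closed_at n W L j \<and> l j = lam n W L j)"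
    and trans: "(\<exists>f. solution n p k N\<^sub>0 f) \<longrightarrow> (\<exists>f. solution n p k (W, L, c) f)"
    using inv unfolding close_inv_def prod.case lower.simps by blast+
  show "\<not> (\<exists>f. solution n p k N\<^sub>0 f)" if "2 * k < tot"
  proof
    assume "\<exists>f. solution n p k N\<^sub>0 f"
    then obtain f where "solution n p k (W, L, c) f" using trans by blast
    from lower_bound[OF this] that fin show False by linarith
  qed
  assume tot: "tot \<le> 2 * k"
  then have "\<not> 2 * k < tot" by linarith
  then have "tot = lower n p (W, L, c)" and *: "\<forall>j<p. closed_at n W L j \<and> l j = lam n W L j"
    using fin by blast+
  with tot have low: "lower n p (W, L, c) \<le> 2 * k" by metis
  have "lam n W L j \<le> lower n p (W, L, c)" if "j < p" for j
    using that member_le_sum[of j "{..<p}" "lam n W L"] by simp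
  then have "lam n W L j \<le> 2 * k" if "j < p" for j using that low le_trans by blast
  with * low show "lower n p (W, L, c) \<le> 2 * k \<and>
      (\<forall>j<p. closed_at n W L j \<and> l j = lam n W L j \<and> lam n W L j \<le> 2 * k)" by blast
qed

text \<open>Failure of the default assignment is used twice. The general bound on its cost puts the
  node into the range of \<open>pot_branch\<close>; the sharper bound for separated classes shows
  that a vertex to branch on exists.\<close>

lemma unfinished_node:
  assumes sym: "symmetric W" and cl: "\<And>j. j < p \<Longrightarrow> closed_at n W L j" and Lp: "\<And>v. L v \<le> p"
    and low: "lower n p (W, L, c) \<le> 2 * k" and cost: "2 * k < 2 * c + cost2 n W (\<lambda>v. L v - 1)"
  shows "k \<le> lower n p (W, L, c)"
    and "\<exists>j v. j < p \<and> v < n \<and> L v = 0 \<and> 0 < between n W (cls n L j) {v}"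
proof -
  have "cost2 n W (\<lambda>v. L v - 1) \<le> 2 * (\<Sum>i<p. lam n W L i)"
    by (rule default_cost[OF sym cl Lp])
  with cost show "k \<le> lower n p (W, L, c)" by simp
  show "\<exists>j v. j < p \<and> v < n \<and> L v = 0 \<and> 0 < between n W (cls n L j) {v}"
  proof (rule ccontr)
    assume none: "\<not> ?thesis"
    have sep: "between n W (cls n L j) {v} = 0" if h: "j < p" "v < n" "L v = 0" for j v
    proof (rule ccontr)
      assume "between n W (cls n L j) {v} \<noteq> 0"
      then have "\<exists>j v. j < p \<and> v < n \<and> L v = 0 \<and> 0 < between n W (cls n L j) {v}"
        using h by (intro exI conjI) simp_all
      with none show False by contradiction
    qed
    have "cost2 n W (\<lambda>v. L v - 1) \<le> (\<Sum>i<p. lam n W L i)"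
      by (rule default_cost_separated[OF sym cl Lp sep])
    with low cost show False by simp
  qed
qed

lemma step:
  assumes inv: "search_inv n ts k W\<^sub>0 N\<^sub>0 s" and run: "0 < var s ''o''"
    and ts: "0 < length ts" "set ts \<subseteq> {..<n}"
  shows "search_inv n ts k W\<^sub>0 N\<^sub>0 (sem step s)"
    and "stack_pot n (length ts) k (sem step s) < stack_pot n (length ts) k s"
proof -
  define p where "p = length ts"
  have p0: "0 < p" using ts(1) by (simp add: p_def)
  have env: "env n p k s" using inv by (simp add: search_inv_def p_def)
  have found: "var s ''found'' = 0" using inv run by (auto simp: search_inv_def)
  then obtain Ns where st: "stack n s Ns" and val: "\<forall>N\<in>set Ns. valid n ts W\<^sub>0 N"
    and sol: "(\<exists>f. solution n p k N\<^sub>0 f) \<longrightarrow> (\<exists>N\<in>set Ns. \<exists>f. solution n p k N f)"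
    using inv by (auto simp: search_inv_def p_def)
  have "Ns \<noteq> []" using st run by (auto simp: stack_def)
  then obtain Ms N where Ns: "Ns = Ms @ [N]" by (metis append_butlast_last_id)
  define s1 where "s1 = sem pop_frame s"
  define s2 where "s2 = sem close s1"
  note pop = pop_frame[OF env st[unfolded Ns], folded s1_def]
  have env1: "env n p k s1" unfolding s1_def by (rule env_sem[OF _ env]) (simp add: keeps_env_def)
  have env2: "env n p k s2" unfolding s2_def by (rule env_sem[OF _ env1]) (simp add: keeps_env_def)
  have vN: "valid n ts W\<^sub>0 N" using val Ns by simp
  obtain W L c where C2: "node_of n (arr s2 ''C'') = (W, L, c)"
    and cinv: "close_inv n p k ts W\<^sub>0 N p (W, L, c) (var s2 ''tot'') (arr s2 ''l'')"
    using close[OF env1 p_def pop(2) vN, folded s2_def] by blast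
  note out = close_outcome[OF cinv]
  have st2: "stack n s2 Ms" by (rule stack_cong[OF pop(1)]) (simp_all add: s2_def frame_arr frame_var)
  have found2: "var s2 ''found'' = 0" unfolding s2_def s1_def using found by (simp add: frame_var)
  have pot_s: "stack_pot n p k s = sum_list (map (pot n p k) Ms) + pot n p k N"
    using stack_pot[OF st] Ns by simp
  let ?c = "check ;;; PCond (Neg (Less (Var ''K'') (Var ''a'')))
         (PAssign ''found'' (Const 1) ;;; PAssign ''o'' (Const 0)) (select ;;; decide ;;; expand)"
  have run2: "sem step s = (if 2 * k < var s2 ''tot'' then s2 else sem ?c s2)"
    using envD(6)[OF env2] by (simp add: step_def s1_def[symmetric] s2_def[symmetric])
  have env': "env n p k (sem step s)" by (rule env_sem[OF keeps_env_step env])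
  have "search_inv n ts k W\<^sub>0 N\<^sub>0 (sem step s) \<and> stack_pot n p k (sem step s) < stack_pot n p k s"
  proof (cases "2 * k < var s2 ''tot''")
    case True
    then have s': "sem step s = s2" using run2 by simp
    have "search_inv n ts k W\<^sub>0 N\<^sub>0 s2"
      unfolding search_inv_def p_def[symmetric]
      using env2 found2 st2 val sol out(1)[OF True] Ns by auto
    then show ?thesis using s' stack_pot[OF st2] pot_s pot_pos by simp
  next
    case False
    define s3 where "s3 = sem check s2"
    have env3: "env n p k s3" unfolding s3_def by (rule env_sem[OF _ env2]) (simp add: keeps_env_def)
    note ch = check[OF env2 C2, folded s3_def]
    have low: "lower n p (W, L, c) \<le> 2 * k"
      and cl: "\<And>j. j < p \<Longrightarrow> closed_at n W L j" and l2: "\<And>j. j < p \<Longrightarrow> arr s2 ''l'' j = lam n W L j"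
      and lam: "\<And>j. j < p \<Longrightarrow> lam n W L j \<le> 2 * k"
      using out(2) False by auto
    have v2: "valid n ts W\<^sub>0 (W, L, c)" using cinv by (simp add: close_inv_def)
    have sym: "symmetric W" and Lp: "\<And>v. L v \<le> p" and Lts: "\<And>i. i < p \<Longrightarrow> L (ts ! i) = Suc i"
      and sound: "\<And>f. cost2 n W\<^sub>0 f \<le> cost2 n W f + 2 * c"
      using v2 by (auto simp: valid_def p_def)
    have C3: "node_of n (arr s3 ''C'') = (W, L, c)" unfolding s3_def using C2 by (simp add: frame_arr)
    have st3: "stack n s3 Ms" by (rule stack_cong[OF st2]) (simp_all add: s3_def frame_arr frame_var)
    have fr3: "arr s3 ''l'' = arr s2 ''l''" "var s3 ''found'' = 0"
      unfolding s3_def using found2 by (simp_all add: frame_arr frame_var)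
    show ?thesis
    proof (cases "var s3 ''a'' \<le> 2 * k")
      case True
      then have s': "sem step s = setv (setv s3 ''found'' 1) ''o'' 0"
        using run2 False envD(6)[OF env3] by (simp add: s3_def[symmetric])
      have part: "cost2 n W (arr s3 ''part'') = cost2 n W (\<lambda>v. L v - 1)"
        by (rule cost2_cong) (rule ch(1))
      have "cost2 n W\<^sub>0 (arr s3 ''part'') \<le> 2 * k"
        using sound[of "arr s3 ''part''"] part ch(2) True by linarith
      moreover have "arr s3 ''part'' v < p" if "v < n" for v
        using ch(1)[OF that] Lp[of v] p0 by linarith
      moreover have "arr s3 ''part'' (ts ! i) = i" if "i < p" for i
      proof -
        have "ts ! i \<in> set ts" using that by (simp add: p_def)
        then have "ts ! i < n" using ts(2) by blast
        then show ?thesis using ch(1) Lts[OF that] by simp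
      qed
      ultimately have "search_inv n ts k W\<^sub>0 N\<^sub>0 (sem step s)"
        using env' by (simp add: search_inv_def s' p_def)
      moreover have "stack_pot n p k (sem step s) = 0" by (simp add: s' stack_pot_def)
      ultimately show ?thesis using pot_s pot_pos[of n p k N] by simp
    next
      case cost: False
      define s4 where "s4 = sem select s3"
      define s5 where "s5 = sem decide s4"
      have s': "sem step s = sem expand s5"
        using run2 False envD(6)[OF env3] cost by (simp add: s3_def[symmetric] s4_def s5_def)
      have env4: "env n p k s4" unfolding s4_def by (rule env_sem[OF _ env3]) (simp add: keeps_env_def)
      have env5: "env n p k s5" unfolding s5_def by (rule env_sem[OF _ env4]) (simp add: keeps_env_def)
      define i where "i = var s4 ''bi''"
      define U where "U = marks n (arr s4 ''U'')"
      define best where "best = var s4 ''best''"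
      have l3: "\<And>j. j < p \<Longrightarrow> arr s3 ''l'' j = lam n W L j" using l2 fr3 by simp
      have sinv: "select_inv n p W L (pairs n p 0) best i U"
        using select[OF env3 C3 cl l3 lam, folded s4_def] by (simp add: i_def U_def best_def)
      have "2 * k < 2 * c + cost2 n W (\<lambda>v. L v - 1)" using ch(2) cost by simp
      note un = unfinished_node[OF sym cl Lp low this]
      then obtain j v where jv: "j < p" "v < n" "L v = 0" "0 < between n W (cls n L j) {v}" by blast
      let ?Ch = "branching.successors n p W L c i U best"
      have su: "branching n p k W L c i U"
        "sum_list (map (pot n p k) ?Ch) + 1 \<le> pot n p k (W, L, c)"
        "\<And>f. solution n p k (W, L, c) f \<Longrightarrow> \<exists>N\<in>set ?Ch. \<exists>f. solution n p k N f"
        by (rule select_successors[OF sym cl un(1) low sinv jv]; assumption)+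
      have C4: "node_of n (arr s4 ''C'') = (W, L, c)" unfolding s4_def using C3 by (simp add: frame_arr)
      have C5: "node_of n (arr s5 ''C'') = (W, L, c)" unfolding s5_def using C4 by (simp add: frame_arr)
      have st5: "stack n s5 Ms"
        by (rule stack_cong[OF st3]) (simp_all add: s5_def s4_def frame_arr frame_var)
      have bi5: "var s5 ''bi'' = i" "marks n (arr s5 ''U'') = U"
        unfolding s5_def by (simp_all add: i_def U_def frame_arr frame_var)
      have spec: "0 < var s5 ''spec'' \<longleftrightarrow> 0 < best \<and> branching.special n p W L i U"
        unfolding s5_def best_def
        by (rule branching.decide[OF su(1) env4 C4]) (simp_all add: i_def U_def)
      have st': "stack n (sem step s) (Ms @ ?Ch)"
        unfolding s' using branching.expand[OF su(1) env5 C5 bi5 st5] spec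
        by (simp add: branching.successors_def[OF su(1)])
      have lo: "lower n p N \<le> lower n p (W, L, c)" using cinv by (simp add: close_inv_def)
      have "stack_pot n p k (sem step s) < stack_pot n p k s"
        using stack_pot[OF st', of p k] su(2) pot_antimono[OF lo, of k] pot_s by simp
      moreover have "var (sem step s) ''found'' = 0"
        unfolding s' s5_def s4_def using fr3 by (simp add: frame_var)
      moreover have "\<forall>N\<in>set (Ms @ ?Ch). valid n ts W\<^sub>0 N"
        using val Ns branching.valid_successors[OF su(1) v2 p_def] by auto
      moreover have "\<exists>N\<in>set (Ms @ ?Ch). \<exists>f. solution n p k N f" if "\<exists>f. solution n p k N\<^sub>0 f"
      proof -
        from that sol obtain M where M: "M \<in> set Ns" "\<exists>f. solution n p k M f" by blast
        show ?thesis
        proof (cases "M \<in> set Ms")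
          case False
          then have "\<exists>f. solution n p k N f" using M Ns by simp
          then obtain f where "solution n p k (W, L, c) f" using cinv by (auto simp: close_inv_def)
          from su(3)[OF this] show ?thesis by auto
        qed (use M in auto)
      qed
      ultimately show ?thesis using env' st' unfolding search_inv_def p_def[symmetric] by blast
    qed
  qed
  then show "search_inv n ts k W\<^sub>0 N\<^sub>0 (sem step s)"
    and "stack_pot n (length ts) k (sem step s) < stack_pot n (length ts) k s" by (simp_all add: p_def)
qed

section \<open>The complete algorithm\<close>

text \<open>Products are replaced by repeated addition of \<open>n\<close>. Without terminals only
  the empty partition qualifies, which exists exactly if \<open>n = 0\<close>; this case is decided
  here and the stack stays empty.\<close>

definition init :: prog where
  "init = PFor ''i'' ''n'' (PStore ''r'' (Var ''i'') (Var ''nn'') ;;; PAssign ''nn'' (Plus (Var ''nn'') (Var ''n''))) ;;;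
     PAssign ''fs'' (Plus (Var ''nn'') (Plus (Var ''n'') (Const 1))) ;;;
     PAssign ''K'' (Plus (Var ''k'') (Var ''k'')) ;;; PAssign ''R'' (Plus (Var ''K'') (Const 2)) ;;;
     PCond (posb (Var ''p''))
       (copy_matrix ''S'' ''w'' ;;;
        PFor ''i'' ''p'' (PStore ''S'' (Plus (Var ''nn'') (Get ''t'' (Var ''i''))) (Plus (Var ''i'') (Const 1))) ;;;
        PAssign ''o'' (Var ''fs''))
       (PCond (posb (Var ''n'')) PSkip (PAssign ''found'' (Const 1)))"

lemma meta_init: "bounds init = {''n'', ''p''}" "counters_ok init" "modv init \<inter> {''n'', ''p''} = {}"
  by (auto simp: init_def)

definition matrix :: "nat \<Rightarrow> nat set set \<Rightarrow> (nat set \<Rightarrow> nat) \<Rightarrow> nat \<Rightarrow> nat \<Rightarrow> nat" where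
  "matrix n E w u v = (if u < n \<and> v < n \<and> {u, v} \<in> E then w {u, v} else 0)"

lemma symmetric_matrix: "symmetric (matrix n E w)"
  by (simp add: symmetric_def matrix_def insert_commute conj_ac)

definition root_labels :: "nat list \<Rightarrow> (nat \<Rightarrow> nat) \<Rightarrow> bool" where
  "root_labels ts L \<longleftrightarrow> (\<forall>j<length ts. L (ts ! j) = Suc j) \<and> (\<forall>v. v \<notin> set ts \<longrightarrow> L v = 0)"

lemma init:
  fixes k :: nat
  assumes inst: "mtc_instance n E w ts"
  defines "s \<equiv> sem init (mtc_input n E w ts k)"
  shows "ts = [] \<Longrightarrow> var s ''o'' = 0 \<and> var s ''found'' = of_bool (n = 0)"
    and "ts \<noteq> [] \<Longrightarrow> env n (length ts) k s \<and> var s ''found'' = 0 \<and>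
      (\<exists>L. root_labels ts L \<and> stack n s [(matrix n E w, L, 0)])"
proof -
  define p where "p = length ts"
  have ts: "distinct ts" "set ts \<subseteq> {..<n}" using inst by (auto simp: mtc_instance_def)
  let ?s = "mtc_input n E w ts k"
  let ?rows = "PFor ''i'' ''n'' (PStore ''r'' (Var ''i'') (Var ''nn'') ;;; PAssign ''nn'' (Plus (Var ''nn'') (Var ''n'')))"
  let ?fill = "copy_matrix ''S'' ''w'' ;;;
        PFor ''i'' ''p'' (PStore ''S'' (Plus (Var ''nn'') (Get ''t'' (Var ''i''))) (Plus (Var ''i'') (Const 1))) ;;;
        PAssign ''o'' (Var ''fs'')"
  let ?none = "PCond (posb (Var ''n'')) PSkip (PAssign ''found'' (Const 1))"
  have v0: "var ?s ''n'' = n" "var ?s ''p'' = p" "var ?s ''k'' = k" "var ?s ''nn'' = 0" "var ?s ''o'' = 0"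
    "var ?s ''found'' = 0"
    by (simp_all add: mtc_input_def p_def)
  have a0: "arr ?s ''S'' = (\<lambda>_. 0)" "arr ?s ''t'' = (\<lambda>i. if i < length ts then ts ! i else 0)"
    "arr ?s ''w'' = (\<lambda>x. if x < n * n \<and> {x div n, x mod n} \<in> E then w {x div n, x mod n} else 0)"
    by (simp_all add: mtc_input_def)
  have Ww: "Wt n (arr ?s ''w'') = matrix n E w"
  proof (intro ext)
    fix u v
    show "Wt n (arr ?s ''w'') u v = matrix n E w u v"
      using cell_less[of u n v] by (auto simp: Wt_def matrix_def a0)
  qed
  define s1 where "s1 = sem ?rows ?s"
  have rows: "var s1 ''nn'' = n * n \<and> (\<forall>u<n. arr s1 ''r'' u = u * n)"
    unfolding s1_def
  proof (rule For_induct[where P = "\<lambda>i t. var t ''nn'' = i * n \<and> (\<forall>u<i. arr t ''r'' u = u * n)"], goal_cases)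
    case (2 i t)
    have "var t ''n'' = n" using 2(3)[of "''n''"] v0 by simp
    then show ?case using 2(2) by (auto simp: less_Suc_eq)
  qed (use v0 in auto)
  have fr1: "var s1 ''n'' = n" "var s1 ''p'' = p" "var s1 ''k'' = k" "var s1 ''o'' = 0" "var s1 ''found'' = 0"
    "arr s1 ''S'' = arr ?s ''S''" "arr s1 ''t'' = arr ?s ''t''" "arr s1 ''w'' = arr ?s ''w''"
    unfolding s1_def using v0 by (simp_all add: frame_var frame_arr del: sem.simps(6))
  define s2 where "s2 = setv (setv (setv s1 ''fs'' (fsize n)) ''K'' (k + k)) ''R'' (k + k + 2)"
  have env2: "env n p k s2" using rows fr1 by (simp add: env_def s2_def)
  have run: "s = (if 0 < p then sem ?fill s2 else sem ?none s2)"
  proof -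
    have "s = sem (PCond (posb (Var ''p'')) ?fill ?none) (setv (setv (setv s1 ''fs''
        (aval (Plus (Var ''nn'') (Plus (Var ''n'') (Const 1))) s1)) ''K'' (k + k)) ''R'' (k + k + 2))"
      using fr1 by (simp add: s_def init_def s1_def[symmetric] del: sem.simps(5,6))
    moreover have "aval (Plus (Var ''nn'') (Plus (Var ''n'') (Const 1))) s1 = fsize n" using rows fr1 by simp
    ultimately have "s = sem (PCond (posb (Var ''p'')) ?fill ?none) s2" by (simp only: s2_def)
    then show ?thesis using envD(2)[OF env2] by (simp del: sem.simps(4,6))
  qed
  show "var s ''o'' = 0 \<and> var s ''found'' = of_bool (n = 0)" if "ts = []"
    using that run fr1 by (simp add: p_def s2_def)
  show "env n (length ts) k s \<and> var s ''found'' = 0 \<and>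
      (\<exists>L. root_labels ts L \<and> stack n s [(matrix n E w, L, 0)])" if "ts \<noteq> []"
  proof -
    define s3 where "s3 = sem (copy_matrix ''S'' ''w'') s2"
    let ?labels = "PFor ''i'' ''p'' (PStore ''S'' (Plus (Var ''nn'') (Get ''t'' (Var ''i''))) (Plus (Var ''i'') (Const 1)))"
    define s4 where "s4 = sem ?labels s3"
    have env3: "env n p k s3" unfolding s3_def by (rule env_sem[OF _ env2]) (simp add: keeps_env_def)
    have env4: "env n p k s4" unfolding s4_def by (rule env_sem[OF _ env3]) (simp add: keeps_env_def)
    have s: "s = setv s4 ''o'' (fsize n)"
    proof -
      have "0 < p" using that by (simp add: p_def)
      then have "s = sem ?fill s2" unfolding run by (rule if_P)
      also have "\<dots> = setv s4 ''o'' (var s4 ''fs'')"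
        by (simp only: sem.simps(4) sem.simps(2) aval.simps s3_def s4_def)
      finally show ?thesis using envD(4)[OF env4] by simp
    qed
    have fr2: "arr s2 ''S'' = (\<lambda>_. 0)" "Wt n (arr s2 ''w'') = matrix n E w"
      using fr1 a0 Ww by (simp_all add: s2_def)
    have fr3: "arr s3 ''t'' = arr ?s ''t''" unfolding s3_def using fr1 by (simp add: frame_arr s2_def)
    have W3: "Wt n (arr s3 ''S'') = matrix n E w" "\<And>q. n * n \<le> q \<Longrightarrow> arr s3 ''S'' q = 0"
      unfolding s3_def using copy_matrix[OF envD(1,7)[OF env2], of "''S''" "''w''"] fr2 by simp_all
    let ?I = "\<lambda>i t. \<exists>L. node_of n (arr t ''S'') = (matrix n E w, L, 0) \<and>
      (\<forall>j<i. L (ts ! j) = Suc j) \<and> (\<forall>v. v \<notin> set (take i ts) \<longrightarrow> L v = 0)"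
    have "?I p s4"
      unfolding s4_def
    proof (rule For_induct[where P = ?I], goal_cases)
      case 1
      have "node_of n (arr s3 ''S'') = (matrix n E w, \<lambda>_. 0, 0)"
        using W3 by (auto simp: node_of_def Lt_def fun_eq_iff)
      then show ?case by auto
    next
      case (2 i t)
      have i: "i < p" using 2(1) envD(2)[OF env3] by simp
      from 2(2) obtain L where L: "node_of n (arr t ''S'') = (matrix n E w, L, 0)"
        "\<And>j. j < i \<Longrightarrow> L (ts ! j) = Suc j" "\<And>v. v \<notin> set (take i ts) \<Longrightarrow> L v = 0" by blast
      have t: "var t ''nn'' = n * n" "arr t ''t'' i = ts ! i"
        using 2(3)[of "''nn''"] 2(4)[of "''t''"] envD(3)[OF env3] fr3 a0 i by (simp_all add: p_def)
      have "ts ! i \<in> set ts" using i by (simp add: p_def)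
      then have "ts ! i < n" using ts(2) by blast
      note N = node_of_store_label[OF L(1) this, of "Suc i"]
      have "ts ! j \<noteq> ts ! i" if "j < i" for j
        using that i ts(1) by (simp add: nth_eq_iff_index_eq p_def)
      then have "\<forall>j<Suc i. (L(ts ! i := Suc i)) (ts ! j) = Suc j"
        using L(2) by (simp add: less_Suc_eq)
      moreover have "\<forall>v. v \<notin> set (take (Suc i) ts) \<longrightarrow> (L(ts ! i := Suc i)) v = 0"
        using L(3) i by (simp add: take_Suc_conv_app_nth p_def)
      ultimately show ?case using N t by (intro exI[of _ "L(ts ! i := Suc i)"]) simp
    next
      case (3 t)
      then show ?case using envD(2)[OF env3] by simp
    qed
    then obtain L where L: "node_of n (arr s4 ''S'') = (matrix n E w, L, 0)" "root_labels ts L"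
      by (auto simp: root_labels_def p_def)
    have "frame n (arr s4 ''S'') 0 = node_of n (arr s4 ''S'')" by (simp add: frame_def)
    then have "stack n s [(matrix n E w, L, 0)]" using L by (simp add: stack_def s)
    moreover have "env n p k s" using env4 by (simp add: s env_setv)
    moreover have "var s ''found'' = 0"
      unfolding s s4_def s3_def s2_def using fr1 by (simp add: frame_var del: sem.simps(6))
    ultimately show ?thesis using L(2) by (auto simp: p_def)
  qed
qed

section \<open>Assignments and multiterminal cuts\<close>

definition parts :: "nat \<Rightarrow> nat \<Rightarrow> (nat \<Rightarrow> nat) \<Rightarrow> nat set list" where
  "parts n p f = map (fiber n f) [0..<p]"

text \<open>The ordered pairs with different values are grouped by their underlying edge, and every
  crossing edge arises from exactly two of them.\<close>

lemma cut_size_parts: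
  assumes inst: "mtc_instance n E w ts" and f: "\<And>v. v < n \<Longrightarrow> f v < p"
  shows "cost2 n (matrix n E w) f = 2 * cut_size E w (parts n p f)"
proof -
  have sub: "\<And>e. e \<in> E \<Longrightarrow> e \<subseteq> {..<n} \<and> card e = 2" using inst by (auto simp: mtc_instance_def)
  have finE: "finite E" by (rule finite_subset[of _ "Pow {..<n}"]) (use sub in auto)
  define D where "D = {(u, v). u < n \<and> v < n \<and> f u \<noteq> f v \<and> {u, v} \<in> E}"
  define T where "T = {e \<in> E. \<exists>A\<in>set (parts n p f). \<exists>B\<in>set (parts n p f). A \<noteq> B \<and> e \<inter> A \<noteq> {} \<and> e \<inter> B \<noteq> {}}"
  have finD: "finite D" by (rule finite_subset[of _ "{..<n} \<times> {..<n}"]) (auto simp: D_def)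
  have cross: "{u, v} \<in> T \<longleftrightarrow> f u \<noteq> f v" if "{u, v} \<in> E" for u v
  proof
    have uv: "u < n" "v < n" using sub[OF that] by auto
    assume ne: "f u \<noteq> f v"
    have "fiber n f (f u) \<noteq> fiber n f (f v)" using uv ne by (auto simp: fiber_def)
    moreover have "fiber n f (f u) \<in> set (parts n p f)" "fiber n f (f v) \<in> set (parts n p f)"
      using uv f by (auto simp: parts_def)
    moreover have "u \<in> fiber n f (f u)" "v \<in> fiber n f (f v)" using uv by (simp_all add: fiber_def)
    ultimately show "{u, v} \<in> T" using that unfolding T_def by blast
  next
    assume "{u, v} \<in> T"
    then obtain i j where "fiber n f i \<noteq> fiber n f j" "{u, v} \<inter> fiber n f i \<noteq> {}" "{u, v} \<inter> fiber n f j \<noteq> {}"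
      by (auto simp: T_def parts_def)
    then show "f u \<noteq> f v" by (auto simp: fiber_def)
  qed
  have "cost2 n (matrix n E w) f = (\<Sum>(u, v)\<in>{..<n} \<times> {..<n}. of_bool (f u \<noteq> f v) * matrix n E w u v)"
    unfolding cost2_def wsum_def by (rule sum.cartesian_product)
  also have "\<dots> = (\<Sum>(u, v)\<in>D. w {u, v})"
    by (rule sum.mono_neutral_cong_right) (auto simp: D_def matrix_def split: if_splits)
  also have "\<dots> = (\<Sum>e\<in>T. \<Sum>x\<in>{x \<in> D. {fst x, snd x} = e}. w {fst x, snd x})"
  proof -
    have "(\<lambda>x. {fst x, snd x}) ` D \<subseteq> T" using cross by (auto simp: D_def)
    moreover have "finite T" using finE by (simp add: T_def)
    ultimately show ?thesis using sum.group[OF finD, of T "\<lambda>x. {fst x, snd x}" "\<lambda>x. w {fst x, snd x}"]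
      by (simp add: case_prod_beta)
  qed
  also have "\<dots> = (\<Sum>e\<in>T. 2 * w e)"
  proof (rule sum.cong[OF refl])
    fix e assume e: "e \<in> T"
    then have "e \<in> E" by (simp add: T_def)
    then obtain a b where ab: "e = {a, b}" "a \<noteq> b" using sub by (metis card_2_iff)
    have fab: "f a \<noteq> f b" using e cross[of a b] \<open>e \<in> E\<close> ab by simp
    have n: "a < n" "b < n" using sub[OF \<open>e \<in> E\<close>] ab by auto
    have "{x \<in> D. {fst x, snd x} = e} = {(a, b), (b, a)}"
      using fab n \<open>e \<in> E\<close> ab by (auto simp: D_def doubleton_eq_iff insert_commute)
    then show "(\<Sum>x\<in>{x \<in> D. {fst x, snd x} = e}. w {fst x, snd x}) = 2 * w e"
      using ab by (simp add: insert_commute)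
  qed
  also have "\<dots> = 2 * cut_size E w (parts n p f)"
    by (simp add: cut_size_def T_def sum_distrib_left)
  finally show ?thesis .
qed

lemma parts_multiterminal_cut:
  assumes inst: "mtc_instance n E w ts"
    and f: "\<And>v. v < n \<Longrightarrow> f v < length ts" "\<And>i. i < length ts \<Longrightarrow> f (ts ! i) = i"
  shows "multiterminal_cut n ts (parts n (length ts) f)"
proof -
  let ?Ps = "parts n (length ts) f"
  have ts: "ts ! i < n" if "i < length ts" for i
    using inst nth_mem[OF that] by (auto simp: mtc_instance_def)
  have mem: "ts ! i \<in> fiber n f i" if "i < length ts" for i
    using ts[OF that] f(2)[OF that] by (simp add: fiber_def)
  have "inj_on (fiber n f) {0..<length ts}"
  proof (rule inj_onI)
    fix i j assume ij: "i \<in> {0..<length ts}" "fiber n f i = fiber n f j"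
    then have "ts ! i \<in> fiber n f j" using mem[of i] by auto
    then show "i = j" using f(2)[of i] ij(1) by (simp add: fiber_def)
  qed
  then have "distinct ?Ps" by (simp add: parts_def distinct_map)
  moreover have "partition_on {..<n} (set ?Ps)"
  proof (rule partition_onI)
    show "\<Union> (set ?Ps) = {..<n}" using f(1) by (auto simp: parts_def fiber_def)
    show "disjnt P Q" if "P \<in> set ?Ps" "Q \<in> set ?Ps" "P \<noteq> Q" for P Q
      using that by (auto simp: parts_def fiber_def disjnt_def)
    show "{} \<notin> set ?Ps"
    proof
      assume "{} \<in> set ?Ps"
      then obtain i where "i < length ts" "fiber n f i = {}" by (auto simp: parts_def)
      then show False using mem[of i] by blast
    qed
  qed
  ultimately show ?thesis using mem by (simp add: multiterminal_cut_def parts_def)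
qed

lemma multiterminal_cut_parts:
  assumes cut: "multiterminal_cut n ts Ps"
  obtains f where "Ps = parts n (length ts) f" "\<And>v. v < n \<Longrightarrow> f v < length ts"
    "\<And>i. i < length ts \<Longrightarrow> f (ts ! i) = i"
proof -
  have len: "length Ps = length ts" and dis: "distinct Ps" and part: "partition_on {..<n} (set Ps)"
    and mem: "\<And>i. i < length ts \<Longrightarrow> ts ! i \<in> Ps ! i"
    using cut by (auto simp: multiterminal_cut_def)
  have un: "\<Union> (set Ps) = {..<n}" and dj: "disjoint (set Ps)"
    using part by (auto simp: partition_on_def)
  have uniq: "i = j" if "i < length ts" "j < length ts" "v \<in> Ps ! i" "v \<in> Ps ! j" for i j v
  proof (rule ccontr)
    assume "i \<noteq> j"
    then have "Ps ! i \<noteq> Ps ! j" using dis that len by (simp add: nth_eq_iff_index_eq)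
    then have "Ps ! i \<inter> Ps ! j = {}" using dj that len by (intro disjointD[OF dj]) auto
    then show False using that by blast
  qed
  define f where "f v = (THE i. i < length ts \<and> v \<in> Ps ! i)" for v
  have fI: "f v = i" if "i < length ts" "v \<in> Ps ! i" for i v
    unfolding f_def using that uniq by (intro the_equality) auto
  have ex: "f v < length ts \<and> v \<in> Ps ! f v" if "v < n" for v
  proof -
    have "v \<in> \<Union> (set Ps)" using un that by simp
    then obtain i where "i < length ts" "v \<in> Ps ! i" using len by (auto simp: in_set_conv_nth)
    then show ?thesis using fI by simp
  qed
  have "Ps ! i = fiber n f i" if i: "i < length ts" for i
  proof
    have "Ps ! i \<subseteq> {..<n}" using un i len nth_mem[of i Ps] by auto
    then show "Ps ! i \<subseteq> fiber n f i" using fI[OF i] by (auto simp: fiber_def)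
    show "fiber n f i \<subseteq> Ps ! i" using ex by (auto simp: fiber_def)
  qed
  then have "Ps = parts n (length ts) f"
    using len by (intro nth_equalityI) (auto simp: parts_def)
  then show ?thesis using that ex fI mem by blast
qed

definition algorithm :: com where
  "algorithm = Seq (compile init) (While (Less (Const 0) (Var ''o'')) (compile step))"

text \<open>With \<open>r\<close> the \<open>d\<close>-th root of \<open>q\<close>, the product is
  the \<open>d\<close>-th power of \<open>(k + 4) * r ^ k\<close>, which is bounded because
  \<open>k * r ^ k\<close> tends to zero and \<open>r ^ k \<le> 1\<close>.\<close>

lemma exponential_absorbs_polynomial:
  fixes q :: real
  assumes "0 < q" "q < 1"
  shows "\<exists>B. \<forall>k. real (k + 4) ^ d * q ^ k \<le> B"
proof (cases "d = 0")
  case True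
  have "q ^ k \<le> 1" for k using assms by (intro power_le_one) auto
  then show ?thesis using True by auto
next
  case False
  define r where "r = root d q"
  have r: "0 < r" "r < 1" "r ^ d = q" using assms False by (simp_all add: r_def)
  have "(\<lambda>k. real k * r ^ k) \<longlonglongrightarrow> 0" using r by (intro powser_times_n_limit_0) auto
  then have "Bseq (\<lambda>k. real k * r ^ k)" by (intro convergent_imp_Bseq convergentI)
  then obtain B where B: "\<And>k. \<bar>real k * r ^ k\<bar> \<le> B" by (auto simp: Bseq_def)
  have "real (k + 4) ^ d * q ^ k \<le> (B + 4) ^ d" for k
  proof -
    have "real (k + 4) * r ^ k \<le> B + 4"
      using B[of k] power_le_one[of r k] r by (simp add: algebra_simps)
    moreover have "0 \<le> real (k + 4) * r ^ k" using r by simp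
    ultimately have "(real (k + 4) * r ^ k) ^ d \<le> (B + 4) ^ d" by (rule power_mono)
    moreover have "(real (k + 4) * r ^ k) ^ d = real (k + 4) ^ d * q ^ k"
      using r(3) by (simp add: power_mult_distrib power_mult[symmetric] mult.commute[of k d]) (simp add: power_mult)
    ultimately show ?thesis by simp
  qed
  then show ?thesis by blast
qed

lemma algorithm_correct:
  assumes inst: "mtc_instance n E w ts"
  shows "\<exists>t s. exec algorithm (mtc_input n E w ts k) t s \<and> mtc_correct n E w ts k (mtc_output n ts s) \<and>
    t \<le> (ptime init (fsize n + 2 * k + 2) + (4 + ptime step (fsize n + 2 * k + 2))) * (1 + trib (k + 3))"
proof -
  \<comment> \<open>One value above all loop bounds: \<open>n\<close>, \<open>p \<le> n\<close>, the
    frame size and the number \<open>2 * k + 2\<close> of augmentation rounds.\<close>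
  let ?N = "fsize n + 2 * k + 2"
  let ?b = "Less (Const 0) (Var ''o'')"
  let ?T = "(ptime init ?N + (4 + ptime step ?N)) * (1 + trib (k + 3))"
  define p where "p = length ts"
  define s0 where "s0 = mtc_input n E w ts k"
  define s1 where "s1 = sem init s0"
  have ts: "distinct ts" "set ts \<subseteq> {..<n}" using inst by (auto simp: mtc_instance_def)
  have "card (set ts) \<le> card {..<n}" using ts(2) by (intro card_mono) auto
  then have p: "p \<le> n" using ts(1) by (simp add: p_def distinct_card)
  have var0: "var s0 ''n'' = n" "var s0 ''p'' = p" by (simp_all add: s0_def mtc_input_def p_def)
  have "\<exists>t. exec (compile init) s0 t s1 \<and> t \<le> ptime init ?N"
    unfolding s1_def
  proof (rule compile_exec[OF meta_init(2)])
    fix y assume "y \<in> bounds init"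
    then consider "y = ''n''" | "y = ''p''" unfolding meta_init(1) by blast
    then show "y \<notin> modv init \<and> var s0 y \<le> ?N"
    proof cases
      case 1
      then show ?thesis using meta_init(3) var0 by simp
    next
      case 2
      then show ?thesis using meta_init(3) var0 p by simp
    qed
  qed
  then obtain t1 where t1: "exec (compile init) s0 t1 s1" "t1 \<le> ptime init ?N" by blast
  note ini = init[OF inst, of k, folded s0_def s1_def]
  show ?thesis
  proof (cases "ts = []")
    case True
    have b: "\<not> bval ?b s1" using ini(1)[OF True] by simp
    have "exec algorithm s0 (t1 + (1 + bcost ?b)) s1"
      unfolding algorithm_def by (rule exec.Seq[OF t1(1) exec.WhileFalse[OF b]])
    moreover have "mtc_correct n E w ts k (mtc_output n ts s1)"
    proof (cases "n = 0")
      case n: True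
      then show ?thesis using ini(1)[OF True] True
        by (simp add: mtc_output_def mtc_correct_def multiterminal_cut_def cut_size_def partition_on_def)
    next
      case False
      have "\<not> multiterminal_cut n [] Ps" for Ps
        using False by (auto simp: multiterminal_cut_def partition_on_def)
      then show ?thesis using ini(1)[OF True] True False by (simp add: mtc_output_def mtc_correct_def)
    qed
    moreover have "t1 + (1 + bcost ?b) \<le> ?T"
    proof -
      have "t1 + (1 + bcost ?b) \<le> ptime init ?N + (4 + ptime step ?N)" using t1(2) by simp
      also have "\<dots> \<le> ?T" by simp
      finally show ?thesis .
    qed
    ultimately show ?thesis unfolding s0_def by blast
  next
    case False
    then obtain L where env1: "env n p k s1" and f1: "var s1 ''found'' = 0" and L: "root_labels ts L"
      and st: "stack n s1 [(matrix n E w, L, 0)]" using ini(2) by (auto simp: p_def)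
    let ?W = "matrix n E w"
    let ?root = "(?W, L, 0) :: node"
    have p0: "0 < length ts" using False by simp
    have Lp: "L v \<le> length ts" for v
    proof (cases "v \<in> set ts")
      case True
      then obtain j where "j < length ts" "ts ! j = v" by (auto simp: in_set_conv_nth)
      then show ?thesis using L by (auto simp: root_labels_def)
    qed (use L in \<open>simp add: root_labels_def\<close>)
    have val: "valid n ts ?W ?root"
      using L Lp symmetric_matrix by (auto simp: valid_def root_labels_def)
    have inv1: "search_inv n ts k ?W ?root s1"
      unfolding search_inv_def p_def[symmetric]
      using env1 f1 st val by (intro conjI disjI1 exI[of _ "[?root]"]) simp_all
    have body: "search_inv n ts k ?W ?root (sem step s) \<and> stack_pot n p k (sem step s) < stack_pot n p k s \<and>
        (\<exists>t. exec (compile step) s t (sem step s) \<and> t \<le> ptime step ?N)"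
      if inv: "search_inv n ts k ?W ?root s" and b: "bval ?b s" for s
    proof -
      have o: "0 < var s ''o''" using b by simp
      have "env n p k s" using inv by (simp add: search_inv_def p_def)
      note e = envD[OF this]
      have "\<exists>t. exec (compile step) s t (sem step s) \<and> t \<le> ptime step ?N"
      proof (rule compile_exec[OF meta_step(2)])
        fix y assume "y \<in> bounds step"
        then have y: "y \<in> {''n'', ''p'', ''fs'', ''R''}" unfolding meta_step(1) .
        then have "y \<notin> modv step" using meta_step(3) by blast
        moreover from y consider "y = ''n''" | "y = ''p''" | "y = ''fs''" | "y = ''R''" by blast
        then have "var s y \<le> ?N" by cases (use e p in simp_all)
        ultimately show "y \<notin> modv step \<and> var s y \<le> ?N" ..
      qed
      then show ?thesis using step[OF inv o p0 ts(2)] by (simp add: p_def)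
    qed
    obtain t2 s2 where t2: "exec (While ?b (compile step)) s1 t2 s2"
      and inv2: "search_inv n ts k ?W ?root s2" and o2: "\<not> bval ?b s2"
      and le2: "t2 \<le> Suc (stack_pot n p k s1) * (1 + bcost ?b + ptime step ?N)"
      using while_exec[of "search_inv n ts k ?W ?root" s1 ?b step "stack_pot n p k" "ptime step ?N", OF inv1 body]
      by blast
    have ex: "exec algorithm s0 (t1 + t2) s2"
      unfolding algorithm_def by (rule exec.Seq[OF t1(1) t2])
    have "stack_pot n p k s1 \<le> trib (k + 3)"
      using stack_pot[OF st] pot_le_root by simp
    then have "t2 \<le> (1 + trib (k + 3)) * (4 + ptime step ?N)"
      using le2 by (intro le_trans[OF le2] mult_le_mono) simp_all
    moreover have "t1 \<le> ptime init ?N * (1 + trib (k + 3))" using t1(2) by simp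
    ultimately have time: "t1 + t2 \<le> ?T" by (simp add: algebra_simps)
    have "mtc_correct n E w ts k (mtc_output n ts s2)"
    proof (cases "var s2 ''found'' = 0")
      case True
      then obtain Ns where Ns: "stack n s2 Ns"
        "(\<exists>f. solution n (length ts) k ?root f) \<longrightarrow> (\<exists>N\<in>set Ns. \<exists>f. solution n (length ts) k N f)"
        using inv2 by (auto simp: search_inv_def)
      have "Ns = []" using Ns(1) o2 by (simp add: stack_def)
      then have none: "\<not> solution n (length ts) k ?root f" for f using Ns(2) by auto
      have "\<not> (multiterminal_cut n ts Ps \<and> cut_size E w Ps \<le> k)" for Ps
      proof
        assume Ps: "multiterminal_cut n ts Ps \<and> cut_size E w Ps \<le> k"
        then obtain f where f: "Ps = parts n (length ts) f" "\<And>v. v < n \<Longrightarrow> f v < length ts"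
          "\<And>i. i < length ts \<Longrightarrow> f (ts ! i) = i" using multiterminal_cut_parts by blast
        have "L v = Suc (f v)" if "L v \<noteq> 0" for v
        proof -
          have "v \<in> set ts" using L that by (auto simp: root_labels_def)
          then obtain j where "j < length ts" "ts ! j = v" by (auto simp: in_set_conv_nth)
          then show ?thesis using L f(3) by (auto simp: root_labels_def)
        qed
        moreover have "cost2 n ?W f \<le> 2 * k" using cut_size_parts[OF inst f(2)] Ps f(1) by simp
        ultimately have "solution n (length ts) k ?root f" using f(2) by (simp add: compatible_def)
        with none show False by blast
      qed
      then show ?thesis using True by (simp add: mtc_output_def mtc_correct_def)
    next
      case found: False
      let ?f = "arr s2 ''part''"
      have f: "\<And>v. v < n \<Longrightarrow> ?f v < length ts" "\<And>i. i < length ts \<Longrightarrow> ?f (ts ! i) = i" "cost2 n ?W ?f \<le> 2 * k"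
        using inv2 found by (auto simp: search_inv_def)
      have "cut_size E w (parts n (length ts) ?f) \<le> k" using cut_size_parts[OF inst f(1)] f(3) by simp
      moreover have "mtc_output n ts s2 = Some (parts n (length ts) ?f)"
        using found by (simp add: mtc_output_def parts_def fiber_def)
      ultimately show ?thesis
        using parts_multiterminal_cut[OF inst f(1,2)] by (simp add: mtc_correct_def)
    qed
    then show ?thesis using ex time unfolding s0_def by blast
  qed
qed

theorem theorem1:
  "\<exists>(c :: com) (C :: real) (d :: nat).
     solves_mtc_in_time c (\<lambda>n k. C * (1.84 ^ k * real (max 1 n) ^ d))"
proof -
  obtain C\<^sub>1 d\<^sub>1 where i: "\<And>N. ptime init N \<le> C\<^sub>1 * Suc N ^ d\<^sub>1" using ptime_polynomial by blast
  obtain C\<^sub>2 d\<^sub>2 where st: "\<And>N. ptime step N \<le> C\<^sub>2 * Suc N ^ d\<^sub>2" using ptime_polynomial by blast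
  define d where "d = d\<^sub>1 + d\<^sub>2"
  obtain B where B: "\<And>k. real (k + 4) ^ d * (1.8395 / 1.84 :: real) ^ k \<le> B"
    using exponential_absorbs_polynomial[of "1.8395 / 1.84" d] by auto
  define A where "A = real (C\<^sub>1 + C\<^sub>2 + 4)"
  define C where "C = A * 2 ^ d * 20 * B"
  have "solves_mtc_in_time algorithm (\<lambda>n k. C * (1.84 ^ k * real (max 1 n) ^ (2 * d)))"
    unfolding solves_mtc_in_time_def
  proof (intro allI impI)
    fix n E w ts k
    assume inst: "mtc_instance n E w ts"
    let ?N = "fsize n + 2 * k + 2"
    let ?m = "max 1 n"
    obtain t s where ts: "exec algorithm (mtc_input n E w ts k) t s" "mtc_correct n E w ts k (mtc_output n ts s)"
      "t \<le> (ptime init ?N + (4 + ptime step ?N)) * (1 + trib (k + 3))"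
      using algorithm_correct[OF inst] by blast
    have pw: "Suc ?N ^ d\<^sub>1 \<le> Suc ?N ^ d" "Suc ?N ^ d\<^sub>2 \<le> Suc ?N ^ d" "1 \<le> Suc ?N ^ d"
      by (auto simp: d_def intro!: power_increasing simp del: power_Suc)
    have "ptime init ?N + (4 + ptime step ?N) \<le> C\<^sub>1 * Suc ?N ^ d\<^sub>1 + (4 * 1 + C\<^sub>2 * Suc ?N ^ d\<^sub>2)"
      using i[of ?N] st[of ?N] by linarith
    also have "\<dots> \<le> C\<^sub>1 * Suc ?N ^ d + (4 * Suc ?N ^ d + C\<^sub>2 * Suc ?N ^ d)"
      by (intro add_mono mult_le_mono2 pw)
    also have "\<dots> = (C\<^sub>1 + C\<^sub>2 + 4) * Suc ?N ^ d" by (simp add: algebra_simps)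
    finally have poly: "real (ptime init ?N + (4 + ptime step ?N)) \<le> A * real (Suc ?N) ^ d"
      unfolding A_def by (metis of_nat_le_iff of_nat_mult of_nat_power)
    \<comment> \<open>The loop bounds are quadratic in \<open>n\<close> and linear in
      \<open>k\<close>. Separating the two factors explains the final exponent \<open>2 * d\<close>
      and the offset \<open>k + 4\<close>.\<close>
    have "Suc ?N \<le> ?m\<^sup>2 * (2 * (k + 4))"
    proof -
      have sq: "n * n \<le> ?m\<^sup>2" unfolding power2_eq_square by (intro mult_le_mono) auto
      have "n \<le> n * n" by simp
      also note sq
      finally have m: "n \<le> ?m\<^sup>2" "1 \<le> ?m\<^sup>2" by simp_all
      have "1 * (2 * k) \<le> ?m\<^sup>2 * (2 * k)" by (intro mult_le_mono1 m(2))
      moreover have "?m\<^sup>2 * (2 * (k + 4)) = ?m\<^sup>2 * (2 * k) + 8 * ?m\<^sup>2" by (simp add: algebra_simps)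
      ultimately show ?thesis using m sq by linarith
    qed
    then have "real (Suc ?N) \<le> real (?m\<^sup>2 * (2 * (k + 4)))" by (simp only: of_nat_le_iff)
    also have "\<dots> = real ?m ^ 2 * (2 * real (k + 4))"
      by (simp only: of_nat_mult of_nat_power of_nat_numeral)
    finally have "real (Suc ?N) \<le> real ?m ^ 2 * (2 * real (k + 4))" .
    then have "real (Suc ?N) ^ d \<le> (real ?m ^ 2 * (2 * real (k + 4))) ^ d"
      by (intro power_mono) auto
    also have "\<dots> = 2 ^ d * real (k + 4) ^ d * real ?m ^ (2 * d)"
      unfolding power_mult_distrib power_mult[of "real ?m" 2 d] by (simp only: mult_ac)
    finally have size: "real (Suc ?N) ^ d \<le> 2 ^ d * real (k + 4) ^ d * real ?m ^ (2 * d)" .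
    have "real (1 + trib (k + 3)) \<le> 1 + 3 / 2 * 1.8395 ^ (k + 3)"
      using trib_bound[of "k + 3"] by simp
    \<comment> \<open>Since \<open>y \<ge> 1\<close>, the left side is at most
      \<open>(1 + 3 / 2 * 6.224426979875) * y\<close>, about \<open>10.34 * y\<close>; the constant
      \<open>20\<close> is a generous rounding.\<close>
    also have "\<dots> \<le> 20 * 1.8395 ^ k"
    proof -
      define y :: real where "y = 1.8395 ^ k"
      have "1 \<le> y" unfolding y_def by (intro one_le_power) simp
      have pw: "1.8395 ^ (k + 3) = 6.224426979875 * y"
        by (simp add: y_def power_add power3_eq_cube)
      show ?thesis unfolding pw y_def[symmetric] using \<open>1 \<le> y\<close> by (simp add: field_simps)
    qed
    finally have tr: "real (1 + trib (k + 3)) \<le> 20 * 1.8395 ^ k" .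
    have "real t \<le> real (ptime init ?N + (4 + ptime step ?N)) * real (1 + trib (k + 3))"
      using ts(3) by (metis of_nat_le_iff of_nat_mult)
    also have "\<dots> \<le> (A * (2 ^ d * real (k + 4) ^ d * real ?m ^ (2 * d))) * (20 * 1.8395 ^ k)"
    proof (rule mult_mono[OF _ tr])
      have "A * real (Suc ?N) ^ d \<le> A * (2 ^ d * real (k + 4) ^ d * real ?m ^ (2 * d))"
        using size by (intro mult_left_mono) (auto simp: A_def)
      with poly show "real (ptime init ?N + (4 + ptime step ?N))
          \<le> A * (2 ^ d * real (k + 4) ^ d * real ?m ^ (2 * d))" by linarith
    qed (auto simp: A_def)
    also have "\<dots> = A * 2 ^ d * 20 * real ?m ^ (2 * d) * (real (k + 4) ^ d * 1.8395 ^ k)"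
      by (simp only: mult_ac)
    \<comment> \<open>Here the gap between the two bases pays: the polynomial in \<open>k\<close>
      times \<open>(1.8395 / 1.84) ^ k\<close> is at most \<open>B\<close>.\<close>
    also have "\<dots> \<le> A * 2 ^ d * 20 * real ?m ^ (2 * d) * (B * 1.84 ^ k)"
    proof (rule mult_left_mono)
      have "real (k + 4) ^ d * (1.8395 / 1.84) ^ k * 1.84 ^ k \<le> B * 1.84 ^ k"
        by (intro mult_right_mono B) simp
      moreover have "(1.8395 / 1.84) ^ k * 1.84 ^ k = (1.8395 :: real) ^ k"
        unfolding power_mult_distrib[symmetric] by simp
      ultimately show "real (k + 4) ^ d * 1.8395 ^ k \<le> B * 1.84 ^ k" by (metis mult.assoc)
    qed (auto simp: A_def)
    also have "\<dots> = C * (1.84 ^ k * real ?m ^ (2 * d))" by (simp add: C_def)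
    finally show "\<exists>t s. exec algorithm (mtc_input n E w ts k) t s \<and>
        mtc_correct n E w ts k (mtc_output n ts s) \<and> real t \<le> C * (1.84 ^ k * real ?m ^ (2 * d))"
      using ts(1,2) by blast
  qed
  then show ?thesis by blast
qed

end
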